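(* Let $f \colon \{-1,1\}^n \to \{-1,1\}$ with $\widetilde{\deg}(f) = d$. Then there is a function $g \colon \{-1,1\}^m \to \{-1,1\}$ with $m = O(n \log^4 n)$ and $\widetilde{\deg}(g) = \Omega(n^{1/3} \cdot d^{2/3} \cdot \log n)$ such that moreover: (i) if $f$ is computed by a circuit of depth $k$, then $g$ is computed by a circuit of depth $k+3$; (ii) if $f$ is computed by a monotone circuit of depth $k$ with $\mathsf{AND}$ gates at the bottom, then $g$ is computed by a monotone circuit of depth $k+2$ with $\mathsf{AND}$ gates at the bottom; (iii) if $f$ is computed by a monotone DNF of width $w$, then $g$ is computed by a monotone DNF of width $O(w \cdot \log^2 n)$. The constants implicit in the $O$ and $\Omega$ notation are absolute.
   Context: Boolean functions map to $\{-1,1\}$, with $-1$ interpreted as TRUE and $+1$ as FALSE. The approximate degree $\widetilde{\deg}(f)$ is the least degree of a real polynomial $p$ with $|p(x) - f(x)| \le 1/3$ for all $x$ in the domain of $f$. Circuits consist of unbounded fan-in $\mathsf{AND}$, $\mathsf{OR}$ gates and $\mathsf{NOT}$ gates and, unless otherwise specified, have size polynomial in the number of inputs; a circuit is monotone if it has no $\mathsf{NOT}$ gates. The width of a DNF is the maximum number of literals in a clause. Logarithms are base 2. *)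

theory Defs
  imports
    Complex_Main
    "HOL-Library.FuncSet"
    "HOL-Library.Poly_Mapping"
    "HOL-Computational_Algebra.Polynomial"
begin

section \<open>Boolean functions and approximate degree\<close>

definition cube :: "nat \<Rightarrow> (nat \<Rightarrow> real) set" where
  "cube n = {..<n} \<rightarrow>\<^sub>E {-1, 1}"

definition boolean_function :: "nat \<Rightarrow> ((nat \<Rightarrow> real) \<Rightarrow> real) \<Rightarrow> bool" where
  "boolean_function n f \<longleftrightarrow> f \<in> cube n \<rightarrow> {-1, 1}"

text \<open>Multivariate real polynomials: finitely supported maps from monomials (finitely supported
  exponent vectors) to coefficients.\<close>

type_synonym mpoly = "(nat \<Rightarrow>\<^sub>0 nat) \<Rightarrow>\<^sub>0 real"

definition mpoly_vars :: "mpoly \<Rightarrow> nat set" where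
  "mpoly_vars p = (\<Union>a\<in>Poly_Mapping.keys p. Poly_Mapping.keys a)"

definition mpoly_eval :: "mpoly \<Rightarrow> (nat \<Rightarrow> real) \<Rightarrow> real" where
  "mpoly_eval p x =
    (\<Sum>a\<in>Poly_Mapping.keys p. Poly_Mapping.lookup p a *
      (\<Prod>i\<in>Poly_Mapping.keys a. x i ^ Poly_Mapping.lookup a i))"

text \<open>The zero polynomial gets degree 0.\<close>

definition mpoly_degree :: "mpoly \<Rightarrow> nat" where
  "mpoly_degree p =
    Max (insert 0 ((\<lambda>a. \<Sum>i\<in>Poly_Mapping.keys a. Poly_Mapping.lookup a i) ` Poly_Mapping.keys p))"

definition approx_degree :: "nat \<Rightarrow> ((nat \<Rightarrow> real) \<Rightarrow> real) \<Rightarrow> nat" where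
  "approx_degree n f =
    (LEAST d. \<exists>p. mpoly_vars p \<subseteq> {..<n} \<and> mpoly_degree p = d \<and>
                  (\<forall>x\<in>cube n. \<bar>mpoly_eval p x - f x\<bar> \<le> 1 / 3))"

definition of_truth :: "bool \<Rightarrow> real" where
  "of_truth b = (if b then -1 else 1)"


section \<open>Circuits\<close>

text \<open>A circuit is a directed acyclic graph, given by its gates in topological order together with
  an output node; \<open>Gate j\<close> refers to the \<open>j\<close>-th gate of the list. Gates may have fan-in 0: the
  empty conjunction is true and the empty disjunction is false.\<close>

datatype node = Input nat | Gate nat

datatype gate = And_gate "node list" | Or_gate "node list" | Not_gate node

datatype circuit = Circuit (gates: "gate list") (out_node: node)

fun gate_inputs :: "gate \<Rightarrow> node set" where
  "gate_inputs (And_gate us) = set us"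
| "gate_inputs (Or_gate us) = set us"
| "gate_inputs (Not_gate u) = {u}"

fun node_ok :: "nat \<Rightarrow> nat \<Rightarrow> node \<Rightarrow> bool" where
  "node_ok n l (Input i) \<longleftrightarrow> i < n"
| "node_ok n l (Gate j) \<longleftrightarrow> j < l"

definition wf_circuit :: "nat \<Rightarrow> circuit \<Rightarrow> bool" where
  "wf_circuit n c \<longleftrightarrow>
    (\<forall>j<length (gates c). \<forall>u\<in>gate_inputs (gates c ! j). node_ok n j u) \<and>
    node_ok n (length (gates c)) (out_node c)"

text \<open>Computes a value for every gate from the values of the preceding gates.\<close>

definition run_gates :: "('v list \<Rightarrow> gate \<Rightarrow> 'v) \<Rightarrow> gate list \<Rightarrow> 'v list" where
  "run_gates h gs = fold (\<lambda>g vs. vs @ [h vs g]) gs []"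

text \<open>The input value \<open>-1\<close> means true.\<close>

fun node_value :: "(nat \<Rightarrow> real) \<Rightarrow> bool list \<Rightarrow> node \<Rightarrow> bool" where
  "node_value x vs (Input i) \<longleftrightarrow> x i = -1"
| "node_value x vs (Gate j) \<longleftrightarrow> vs ! j"

fun gate_value :: "(nat \<Rightarrow> real) \<Rightarrow> bool list \<Rightarrow> gate \<Rightarrow> bool" where
  "gate_value x vs (And_gate us) \<longleftrightarrow> (\<forall>u\<in>set us. node_value x vs u)"
| "gate_value x vs (Or_gate us) \<longleftrightarrow> (\<exists>u\<in>set us. node_value x vs u)"
| "gate_value x vs (Not_gate u) \<longleftrightarrow> \<not> node_value x vs u"

definition circuit_value :: "circuit \<Rightarrow> (nat \<Rightarrow> real) \<Rightarrow> bool" where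
  "circuit_value c x = node_value x (run_gates (gate_value x) (gates c)) (out_node c)"

definition circuit_computes :: "nat \<Rightarrow> circuit \<Rightarrow> ((nat \<Rightarrow> real) \<Rightarrow> real) \<Rightarrow> bool" where
  "circuit_computes n c f \<longleftrightarrow>
    wf_circuit n c \<and> (\<forall>x\<in>cube n. f x = of_truth (circuit_value c x))"

definition circuit_size :: "circuit \<Rightarrow> nat" where
  "circuit_size c = length (gates c)"

text \<open>The depth is the largest number of AND and OR gates on a path to the output. As usual for
  constant-depth circuits, NOT gates do not count, so that every DNF has depth 2.\<close>

fun node_depth :: "nat list \<Rightarrow> node \<Rightarrow> nat" where
  "node_depth ds (Input i) = 0"
| "node_depth ds (Gate j) = ds ! j"

fun gate_depth :: "nat list \<Rightarrow> gate \<Rightarrow> nat" where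
  "gate_depth ds (And_gate us) = Suc (Max (insert 0 (node_depth ds ` set us)))"
| "gate_depth ds (Or_gate us) = Suc (Max (insert 0 (node_depth ds ` set us)))"
| "gate_depth ds (Not_gate u) = node_depth ds u"

definition circuit_depth :: "circuit \<Rightarrow> nat" where
  "circuit_depth c = node_depth (run_gates gate_depth (gates c)) (out_node c)"

definition monotone_circuit :: "circuit \<Rightarrow> bool" where
  "monotone_circuit c \<longleftrightarrow> (\<forall>g\<in>set (gates c). \<nexists>u. g = Not_gate u)"

text \<open>Input variables feed only AND gates. In particular the output is not itself an input
  variable, so the AND layer cannot be missing.\<close>

definition and_bottom :: "circuit \<Rightarrow> bool" where
  "and_bottom c \<longleftrightarrow>
    (\<forall>g\<in>set (gates c). (\<exists>i. Input i \<in> gate_inputs g) \<longrightarrow> (\<exists>us. g = And_gate us)) \<and>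
    (\<nexists>i. out_node c = Input i)"


section \<open>DNFs\<close>

text \<open>A DNF is a set of clauses (conjunctions), each of which is a set of literals.\<close>

datatype literal = Pos nat | Neg nat

type_synonym dnf = "literal set set"

fun literal_var :: "literal \<Rightarrow> nat" where
  "literal_var (Pos i) = i"
| "literal_var (Neg i) = i"

fun literal_value :: "(nat \<Rightarrow> real) \<Rightarrow> literal \<Rightarrow> bool" where
  "literal_value x (Pos i) \<longleftrightarrow> x i = -1"
| "literal_value x (Neg i) \<longleftrightarrow> x i \<noteq> -1"

definition wf_dnf :: "nat \<Rightarrow> dnf \<Rightarrow> bool" where
  "wf_dnf n D \<longleftrightarrow> (\<forall>T\<in>D. \<forall>l\<in>T. literal_var l < n)"

definition dnf_value :: "dnf \<Rightarrow> (nat \<Rightarrow> real) \<Rightarrow> bool" where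
  "dnf_value D x \<longleftrightarrow> (\<exists>T\<in>D. \<forall>l\<in>T. literal_value x l)"

definition dnf_computes :: "nat \<Rightarrow> dnf \<Rightarrow> ((nat \<Rightarrow> real) \<Rightarrow> real) \<Rightarrow> bool" where
  "dnf_computes n D f \<longleftrightarrow>
    wf_dnf n D \<and> (\<forall>x\<in>cube n. f x = of_truth (dnf_value D x))"

text \<open>Well-formedness makes \<open>D\<close> and its clauses finite. The empty DNF gets width 0.\<close>

definition dnf_width :: "dnf \<Rightarrow> nat" where
  "dnf_width D = Max (insert 0 (card ` D))"

definition monotone_dnf :: "dnf \<Rightarrow> bool" where
  "monotone_dnf D \<longleftrightarrow> (\<forall>T\<in>D. \<forall>l\<in>T. \<exists>i. l = Pos i)"

end

theory Submission imports Defs begin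

text \<open>
  Write \<open>l = \<lceil>log n\<rceil>\<close>, \<open>r = 28 l\<close> and \<open>R = n r\<close>. The function \<open>g\<close> reads a list of \<open>N = O(n l\<^sup>3)\<close> entries, each
  of which encodes a number below \<open>R\<close> or nothing, and \<open>g = f \<circ> AND\<^sub>r \<circ> OR\<^sub>N\<close>: the \<open>i\<close>-th input of \<open>f\<close> is true
  iff all \<open>r\<close> numbers of the \<open>i\<close>-th block occur in the list. A number is encoded by its binary digits
  together with their complements, so that "the entry is \<open>q\<close>" is a monotone AND of input bits.

  For the lower bound, averaging a polynomial of degree \<open>D\<close> that approximates \<open>g\<close> over all lists with
  prescribed counts \<open>t\<close> gives a polynomial \<open>Q\<close> of degree \<open>D\<close> in \<open>t\<close>, which approximates the
  corresponding function whenever the counts add up to at most \<open>N\<close>. The counts are then drawn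
  independently from one of two distributions on \<open>{0..4 K\<^sup>2}\<close> with the same moments up to order \<open>K + 1\<close>,
  chosen by the bits of an input \<open>x\<close> of \<open>f\<close>: for a true bit a count is never 0, for a false bit it is
  0 with constant probability, so that \<open>r\<close> blocks together are wrong with polynomially small
  probability. Since matching moments are blind to \<open>x\<close>, the expectation of \<open>Q\<close> is a polynomial of
  degree at most \<open>D / (K + 2)\<close> in \<open>x\<close>, and it approximates \<open>f\<close>. Counts that add up to \<open>S > N\<close> are
  harmless: \<open>Q\<close> is \<open>O(4\<^sup>D exp(S / 8K\<^sup>2))\<close> there, whereas the distributions have bounded mean, so that
  \<open>S\<close> exceeds \<open>N\<close> with probability \<open>exp(- \<Omega>(N / K\<^sup>2))\<close>. The choice \<open>K \<approx> (n / d)\<^bsup>1/3\<^esup> log n\<close> balances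
  the two constraints \<open>D < d K\<close> and \<open>D < N / K\<^sup>2\<close>.
\<close>

section \<open>Polynomial functions and approximate degree\<close>

text \<open>Functions given by polynomials of degree at most \<open>D\<close>, treated as functions
  so that expectations and substitutions need no coefficient maps. The index type is arbitrary
  because the list indicators are indexed by pairs.\<close>

inductive polyfun :: "'i set \<Rightarrow> nat \<Rightarrow> (('i \<Rightarrow> real) \<Rightarrow> real) \<Rightarrow> bool" for I where
  const: "polyfun I D (\<lambda>x. c)"
| add: "polyfun I D F \<Longrightarrow> polyfun I D G \<Longrightarrow> polyfun I D (\<lambda>x. F x + G x)"
| var_mult: "i \<in> I \<Longrightarrow> polyfun I D F \<Longrightarrow> polyfun I (Suc D) (\<lambda>x. x i * F x)"

lemma polyfun_mono:
  assumes "polyfun I D F" "D \<le> E"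
  shows "polyfun I E F"
  using assms
proof (induction arbitrary: E rule: polyfun.induct)
  case (var_mult i D F)
  then obtain E' where "E = Suc E'" "D \<le> E'" by (cases E) auto
  then show ?case using var_mult by (auto intro: polyfun.var_mult)
qed (auto intro: polyfun.intros)

lemma polyfun_mult:
  assumes "polyfun I D F" "polyfun I E G"
  shows "polyfun I (D + E) (\<lambda>x. F x * G x)"
  using assms
proof (induction rule: polyfun.induct)
  case (const D c)
  from \<open>polyfun I E G\<close> have "polyfun I E (\<lambda>x. c * G x)"
  proof (induction rule: polyfun.induct)
    case (const D c')
    then show ?case by (rule polyfun.const)
  next
    case (add D F G)
    then show ?case using polyfun.add[of I D "\<lambda>x. c * F x" "\<lambda>x. c * G x"]
      by (simp add: distrib_left)
  next
    case (var_mult i D F)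
    then show ?case using polyfun.var_mult[of i I D "\<lambda>x. c * F x"]
      by (simp add: mult.left_commute)
  qed
  then show ?case by (rule polyfun_mono) simp
next
  case (add D F F')
  then show ?case using polyfun.add[of I "D + E" "\<lambda>x. F x * G x" "\<lambda>x. F' x * G x"]
    by (simp add: distrib_right)
next
  case (var_mult i D F)
  then show ?case using polyfun.var_mult[of i I "D + E" "\<lambda>x. F x * G x"]
    by (simp add: mult.assoc)
qed

lemma polyfun_var: "i \<in> I \<Longrightarrow> polyfun I (Suc 0) (\<lambda>x. x i)"
  using polyfun.var_mult[of i I 0 "\<lambda>x. 1"] polyfun.const[of I 0 1] by simp

lemma polyfun_cmult: "polyfun I D F \<Longrightarrow> polyfun I D (\<lambda>x. c * F x)"
  using polyfun_mult[OF polyfun.const[of I 0 c]] by simp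

lemma polyfun_diff: "polyfun I D F \<Longrightarrow> polyfun I D G \<Longrightarrow> polyfun I D (\<lambda>x. F x - G x)"
  using polyfun.add[OF _ polyfun_cmult[of I D G "-1"], of F] by simp

lemma polyfun_sum:
  "(\<And>a. a \<in> A \<Longrightarrow> polyfun I D (F a)) \<Longrightarrow> polyfun I D (\<lambda>x. \<Sum>a\<in>A. F a x)"
proof (induction A rule: infinite_finite_induct)
  case (insert a A)
  then show ?case using polyfun.add[of I D "F a" "\<lambda>x. \<Sum>a\<in>A. F a x"] by simp
qed (simp_all add: polyfun.const)

lemma polyfun_prod:
  "(\<And>a. a \<in> A \<Longrightarrow> polyfun I (d a) (F a)) \<Longrightarrow> polyfun I (\<Sum>a\<in>A. d a) (\<lambda>x. \<Prod>a\<in>A. F a x)"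
proof (induction A rule: infinite_finite_induct)
  case (insert a A)
  then show ?case using polyfun_mult[of I "d a" "F a" _ "\<lambda>x. \<Prod>a\<in>A. F a x"] by simp
qed (simp_all add: polyfun.const)

lemma polyfun_power: "polyfun I D F \<Longrightarrow> polyfun I (k * D) (\<lambda>x. F x ^ k)"
  using polyfun_prod[of "{..<k}" I "\<lambda>_. D" "\<lambda>_. F"] by simp

lemma polyfun_cong:
  assumes "polyfun I D F" "\<And>i. i \<in> I \<Longrightarrow> x i = y i"
  shows "F x = F y"
  using assms by (induction rule: polyfun.induct) auto

lemma polyfun_subst:
  assumes "polyfun I D F" "\<And>i. i \<in> I \<Longrightarrow> polyfun J (Suc 0) (\<sigma> i)"
  shows "polyfun J D (\<lambda>y. F (\<lambda>i. \<sigma> i y))"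
  using assms(1)
proof (induction rule: polyfun.induct)
  case (var_mult i D F)
  then show ?case using polyfun_mult[OF assms(2)[of i] var_mult.IH] by simp
qed (auto intro: polyfun.intros)

text \<open>Expansion into monomials by distributivity. It serves for claims that are preserved
  under sums, such as those about expectations.\<close>

lemma polyfun_monomial_induct [consumes 1, case_names monomial add]:
  assumes "polyfun I D F"
    and mono: "\<And>c xs. set xs \<subseteq> I \<Longrightarrow> length xs \<le> D \<Longrightarrow> P (\<lambda>x. c * prod_list (map x xs))"
    and add: "\<And>F G. P F \<Longrightarrow> P G \<Longrightarrow> P (\<lambda>x. F x + G x)"
  shows "P F"
proof -
  \<comment> \<open>The prefix \<open>ys\<close> collects the variables that have already been
    pulled out; \<open>length ys + E \<le> D\<close> keeps track of the degree.\<close>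
  have "P (\<lambda>x. prod_list (map x ys) * F x)"
    if "polyfun I E F" "set ys \<subseteq> I" "length ys + E \<le> D" for ys E F
    using that
  proof (induction arbitrary: ys rule: polyfun.induct)
    case (const E c)
    then show ?case using mono[of ys c] by (simp add: mult.commute)
  next
    case (add E F G)
    then show ?case using assms(3)[of "\<lambda>x. prod_list (map x ys) * F x" "\<lambda>x. prod_list (map x ys) * G x"]
      by (simp add: distrib_left)
  next
    case (var_mult i E F)
    then show ?case using var_mult.IH[of "i # ys"] by (simp add: mult_ac)
  qed
  from this[OF assms(1), of "[]"] show ?thesis by simp
qed

lemma prod_list_count_list:
  fixes x :: "'i \<Rightarrow> 'a :: comm_monoid_mult"
  assumes "finite I" "set xs \<subseteq> I"
  shows "prod_list (map x xs) = (\<Prod>i\<in>I. x i ^ count_list xs i)"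
  using assms(2)
proof (induction xs)
  case (Cons a xs)
  have "(\<Prod>i\<in>I. x i ^ count_list (a # xs) i) = (\<Prod>i\<in>I. (if i = a then x a else 1) * x i ^ count_list xs i)"
    by (rule prod.cong) auto
  also have "\<dots> = x a * (\<Prod>i\<in>I. x i ^ count_list xs i)"
    using Cons.prems assms(1) by (simp add: prod.distrib)
  finally show ?case using Cons by simp
qed auto

section \<open>Translation between \<open>polyfun\<close> and \<open>mpoly\<close>\<close>

lemma mpoly_eval_superset:
  assumes "finite A" "Poly_Mapping.keys p \<subseteq> A"
  shows "mpoly_eval p x = (\<Sum>a\<in>A. Poly_Mapping.lookup p a *
      (\<Prod>i\<in>Poly_Mapping.keys a. x i ^ Poly_Mapping.lookup a i))"
  unfolding mpoly_eval_def using assms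
  by (intro sum.mono_neutral_left) (auto simp: in_keys_iff)

lemma mpoly_eval_add: "mpoly_eval (p + q) x = mpoly_eval p x + mpoly_eval q x"
proof -
  let ?A = "Poly_Mapping.keys p \<union> Poly_Mapping.keys q"
  have "Poly_Mapping.keys (p + q) \<subseteq> ?A" by (rule keys_add)
  then show ?thesis
    by (simp add: mpoly_eval_superset[of ?A] lookup_add distrib_right sum.distrib)
qed

lemma mpoly_degree_le:
  "mpoly_degree p \<le> D \<longleftrightarrow>
    (\<forall>a\<in>Poly_Mapping.keys p. (\<Sum>i\<in>Poly_Mapping.keys a. Poly_Mapping.lookup a i) \<le> D)"
  unfolding mpoly_degree_def by (subst Max_le_iff) auto

lemma mpoly_of_polyfun:
  assumes "polyfun I D F"
  shows "\<exists>p. mpoly_vars p \<subseteq> I \<and> mpoly_degree p \<le> D \<and> (\<forall>x. mpoly_eval p x = F x)"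
  using assms
proof (induction rule: polyfun_monomial_induct)
  case (monomial c xs)
  \<comment> \<open>The exponent vector of the monomial: each variable gets its multiplicity in
    \<open>xs\<close>.\<close>
  define a where "a = (\<Sum>i\<in>set xs. Poly_Mapping.single i (count_list xs i))"
  have lookup_a: "Poly_Mapping.lookup a i = count_list xs i" for i
    unfolding a_def by (simp add: lookup_sum lookup_single when_def sum.delta)
  have keys_a: "Poly_Mapping.keys a = set xs"
    by (auto simp: in_keys_iff lookup_a count_list_0_iff)
  let ?p = "Poly_Mapping.single a c"
  have "mpoly_vars ?p \<subseteq> I" using monomial keys_a by (auto simp: mpoly_vars_def)
  moreover have "mpoly_degree ?p \<le> D"
    using monomial by (auto simp: mpoly_degree_le keys_a lookup_a sum_count_set)
  \<comment> \<open>For \<open>c = 0\<close> the polynomial \<open>?p\<close> has no keys at all, so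
    this case is separate.\<close>
  moreover have "mpoly_eval ?p x = c * prod_list (map x xs)" for x
    by (cases "c = 0") (simp_all add: mpoly_eval_def keys_a lookup_a prod_list_count_list[of "set xs" xs])
  ultimately show ?case by blast
next
  case (add F G)
  then obtain p q where p: "mpoly_vars p \<subseteq> I" "mpoly_degree p \<le> D" "\<forall>x. mpoly_eval p x = F x"
    and q: "mpoly_vars q \<subseteq> I" "mpoly_degree q \<le> D" "\<forall>x. mpoly_eval q x = G x" by blast
  have "mpoly_vars (p + q) \<subseteq> mpoly_vars p \<union> mpoly_vars q"
    using keys_add[of p q] unfolding mpoly_vars_def by blast
  moreover have "mpoly_degree (p + q) \<le> D"
    using keys_add[of p q] p(2) q(2) unfolding mpoly_degree_le by blast
  moreover have "\<forall>x. mpoly_eval (p + q) x = F x + G x"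
    using p(3) q(3) by (simp add: mpoly_eval_add)
  ultimately show ?case using p(1) q(1) by blast
qed

lemma polyfun_mpoly_eval:
  assumes "mpoly_vars p \<subseteq> I"
  shows "polyfun I (mpoly_degree p) (mpoly_eval p)"
proof -
  have "polyfun I (mpoly_degree p) (\<lambda>x. Poly_Mapping.lookup p a *
      (\<Prod>i\<in>Poly_Mapping.keys a. x i ^ Poly_Mapping.lookup a i))" if "a \<in> Poly_Mapping.keys p" for a
  proof -
    have "polyfun I (\<Sum>i\<in>Poly_Mapping.keys a. Poly_Mapping.lookup a i * Suc 0)
        (\<lambda>x. \<Prod>i\<in>Poly_Mapping.keys a. x i ^ Poly_Mapping.lookup a i)"
      using assms that by (intro polyfun_prod polyfun_power polyfun_var) (auto simp: mpoly_vars_def)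
    moreover have "(\<Sum>i\<in>Poly_Mapping.keys a. Poly_Mapping.lookup a i) \<le> mpoly_degree p"
      using that mpoly_degree_le[of p "mpoly_degree p"] by blast
    ultimately show ?thesis by (intro polyfun_cmult) (auto intro: polyfun_mono)
  qed
  then show ?thesis unfolding mpoly_eval_def by (rule polyfun_sum)
qed

section \<open>Functions on the cube; the approximate degree is attained\<close>

lemma finite_cube [simp]: "finite (cube n)"
  unfolding cube_def by (intro finite_PiE) auto

lemma cube_cases: "x \<in> cube n \<Longrightarrow> i < n \<Longrightarrow> x i = 1 \<or> x i = -1"
  unfolding cube_def by (auto simp: PiE_iff)

text \<open>Interpolation by the indicators of the points: the factor
  \<open>1 / 2 + z i / 2 * x i\<close> is 1 if \<open>x i = z i\<close> and 0 otherwise. Hence the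
  set under \<open>LEAST\<close> in \<open>approx_degree\<close> is not empty.\<close>

lemma polyfun_on_cube:
  "\<exists>F. polyfun {..<n} n F \<and> (\<forall>x\<in>cube n. F x = f x)"
proof -
  define F where "F = (\<lambda>x. \<Sum>z\<in>cube n. f z * (\<Prod>i\<in>{..<n}. 1 / 2 + z i / 2 * x i))"
  have "polyfun {..<n} (Suc 0) (\<lambda>x. 1 / 2 + z i / 2 * x i)" if "i < n" for i and z :: "nat \<Rightarrow> real"
    using that by (intro polyfun.add polyfun.const polyfun_cmult polyfun_var) simp
  then have "polyfun {..<n} (\<Sum>i\<in>{..<n}. Suc 0) (\<lambda>x. \<Prod>i\<in>{..<n}. 1 / 2 + z i / 2 * x i)"
    for z :: "nat \<Rightarrow> real"
    by (intro polyfun_prod) simp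
  then have "polyfun {..<n} n F"
    unfolding F_def by (intro polyfun_sum polyfun_cmult) simp
  moreover have "F x = f x" if x: "x \<in> cube n" for x
  proof -
    have "(\<Prod>i\<in>{..<n}. 1 / 2 + z i / 2 * x i) = (if z = x then 1 else 0)" if z: "z \<in> cube n" for z
    proof (cases "z = x")
      case True
      have "1 / 2 + x i / 2 * x i = 1" if "i < n" for i
        using cube_cases[OF x that] by auto
      then show ?thesis using True by simp
    next
      case False
      have "\<exists>i<n. z i \<noteq> x i"
      proof (rule ccontr)
        assume "\<not> ?thesis"
        then have "z = x" using x z unfolding cube_def by (intro PiE_ext) auto
        with False show False by simp
      qed
      then obtain i where i: "i < n" "z i \<noteq> x i" by blast
      then have "1 / 2 + z i / 2 * x i = 0"
        using cube_cases[OF x i(1)] cube_cases[OF z i(1)] by auto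
      with i have "(\<Prod>i\<in>{..<n}. 1 / 2 + z i / 2 * x i) = 0" by (intro prod_zero) auto
      with False show ?thesis by simp
    qed
    then have "F x = (\<Sum>z\<in>cube n. f z * (if z = x then 1 else 0))" unfolding F_def by simp
    also have "\<dots> = f x" using x by (simp add: if_distrib[of "(*) _"] sum.delta cong: if_cong)
    finally show ?thesis .
  qed
  ultimately show ?thesis by blast
qed

lemma approx_degree_le:
  assumes "polyfun {..<n} D F" "\<And>x. x \<in> cube n \<Longrightarrow> \<bar>F x - f x\<bar> \<le> 1 / 3"
  shows "approx_degree n f \<le> D"
proof -
  obtain p where p: "mpoly_vars p \<subseteq> {..<n}" "mpoly_degree p \<le> D" "\<And>x. mpoly_eval p x = F x"
    using mpoly_of_polyfun[OF assms(1)] by blast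
  have "approx_degree n f \<le> mpoly_degree p"
    unfolding approx_degree_def using p assms(2) by (intro Least_le exI[of _ p]) auto
  with p show ?thesis by simp
qed

lemma approx_degree_attained:
  obtains F where "polyfun {..<n} (approx_degree n f) F"
    "\<And>x. x \<in> cube n \<Longrightarrow> \<bar>F x - f x\<bar> \<le> 1 / 3"
proof -
  obtain F where F: "polyfun {..<n} n F" "\<forall>x\<in>cube n. F x = f x"
    using polyfun_on_cube by blast
  then obtain q where "mpoly_vars q \<subseteq> {..<n}" "\<forall>x. mpoly_eval q x = F x"
    using mpoly_of_polyfun by blast
  with F have "\<exists>d p. mpoly_vars p \<subseteq> {..<n} \<and> mpoly_degree p = d \<and>
      (\<forall>x\<in>cube n. \<bar>mpoly_eval p x - f x\<bar> \<le> 1 / 3)" by auto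
  from LeastI_ex[OF this] obtain p where "mpoly_vars p \<subseteq> {..<n}"
    "mpoly_degree p = approx_degree n f" "\<forall>x\<in>cube n. \<bar>mpoly_eval p x - f x\<bar> \<le> 1 / 3"
    unfolding approx_degree_def by blast
  then show ?thesis using that polyfun_mpoly_eval[of p "{..<n}"] by auto
qed

lemma approx_degree_le_arity: "approx_degree n f \<le> n"
  using polyfun_on_cube[of n f] approx_degree_le[of n n _ f] by auto


section \<open>Drawing lists from a bag\<close>

text \<open>The falling factorial, with a real argument so that it is a polynomial in
  \<open>x\<close>.\<close>

definition ff :: "real \<Rightarrow> nat \<Rightarrow> real" where
  "ff x a = (\<Prod>q<a. x - real q)"

lemma ff_0 [simp]: "ff x 0 = 1"
  by (simp add: ff_def)

lemma ff_Suc: "ff x (Suc a) = ff x a * (x - real a)"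
  by (simp add: ff_def)

text \<open>The counterpart of \<open>ff_Suc\<close> that splits off the first factor instead of the
  last; it describes how a count changes after one draw.\<close>

lemma ff_shift: "x * ff (x - 1) a = ff x (Suc a)"
  unfolding ff_def by (subst prod.lessThan_Suc_shift) (simp add: algebra_simps)

lemma ff_eq_0: "n < a \<Longrightarrow> ff (real n) a = 0"
  unfolding ff_def by (rule prod_zero) auto

lemma ff_pos: "a \<le> n \<Longrightarrow> ff (real n) a > 0"
  unfolding ff_def by (rule prod_pos) auto

text \<open>Expected value of \<open>\<Phi>\<close> on a random list of length \<open>N\<close>: \<open>s\<close> uniformly chosen positions are filled
  with items drawn without replacement from a bag that contains \<open>t i\<close> copies of each \<open>i < R\<close>; the other
  positions are \<open>None\<close>. It is meaningful only if \<open>s\<close> exceeds neither \<open>N\<close> nor the size of the bag.\<close>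

primrec bagavg :: "nat \<Rightarrow> nat \<Rightarrow> nat \<Rightarrow> (nat \<Rightarrow> nat) \<Rightarrow> (nat option list \<Rightarrow> real) \<Rightarrow> real" where
  "bagavg R 0 s t \<Phi> = \<Phi> []"
| "bagavg R (Suc N) s t \<Phi> =
    (1 - real s / real (Suc N)) * bagavg R N s t (\<lambda>l. \<Phi> (None # l)) +
    real s / real (Suc N) * (\<Sum>i<R. real (t i) / real (sum t {..<R}) *
      bagavg R N (s - 1) (t(i := t i - 1)) (\<lambda>l. \<Phi> (Some i # l)))"

lemma bagavg_cong:
  "(\<And>l. length l = N \<Longrightarrow> \<Phi> l = \<Psi> l) \<Longrightarrow> bagavg R N s t \<Phi> = bagavg R N s t \<Psi>"
proof (induction N arbitrary: s t \<Phi> \<Psi>)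
  case (Suc N)
  have "bagavg R N s' t' (\<lambda>l. \<Phi> (v # l)) = bagavg R N s' t' (\<lambda>l. \<Psi> (v # l))" for s' t' v
    by (rule Suc.IH) (simp add: Suc.prems)
  then show ?case by simp
qed simp

lemma bagavg_add:
  "bagavg R N s t (\<lambda>l. \<Phi> l + \<Psi> l) = bagavg R N s t \<Phi> + bagavg R N s t \<Psi>"
proof (induction N arbitrary: s t \<Phi> \<Psi>)
  case (Suc N)
  show ?case by (simp add: Suc.IH distrib_left sum.distrib del: fun_upd_apply)
qed simp

lemma bagavg_cmult: "bagavg R N s t (\<lambda>l. c * \<Phi> l) = c * bagavg R N s t \<Phi>"
proof (induction N arbitrary: s t \<Phi>)
  case (Suc N)
  show ?case by (simp add: Suc.IH distrib_left sum_distrib_left mult_ac del: fun_upd_apply)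
qed simp

lemma bagavg_zero [simp]: "bagavg R N s t (\<lambda>l. 0) = 0"
  using bagavg_cmult[of R N s t 0 "\<lambda>_. 0"] by simp

lemma sum_fun_upd_pred:
  fixes t :: "nat \<Rightarrow> nat"
  assumes "i < R" "t i > 0"
  shows "Suc (sum (t(i := t i - 1)) {..<R}) = sum t {..<R}"
proof -
  have "sum (t(i := t i - 1)) {..<R} = t i - 1 + sum t ({..<R} - {i})"
    using assms(1) by (subst sum.remove[of _ i]) (auto intro: sum.cong)
  moreover have "sum t {..<R} = t i + sum t ({..<R} - {i})"
    using assms(1) by (subst sum.remove[of _ i]) auto
  ultimately show ?thesis using assms(2) by simp
qed

text \<open>\<open>bagavg\<close> is a convex combination of the values of \<open>\<Phi>\<close> on
  the lists that can be drawn, so a bound on these lists passes to the average. The two bounds on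
  \<open>s\<close> make the weights nonnegative with sum 1 at every draw of positive
  probability.\<close>

lemma bagavg_close:
  assumes "s \<le> N" "s \<le> sum t {..<R}"
    and "\<And>l. length l = N \<Longrightarrow> (\<And>i. Some i \<in> set l \<Longrightarrow> i < R) \<Longrightarrow>
      (\<And>i. count_list l (Some i) \<le> t i) \<Longrightarrow> length (filter (\<lambda>v. v \<noteq> None) l) = s \<Longrightarrow>
      \<bar>\<Phi> l - v\<bar> \<le> \<epsilon>"
  shows "\<bar>bagavg R N s t \<Phi> - v\<bar> \<le> \<epsilon>"
  using assms
proof (induction N arbitrary: s t \<Phi>)
  case 0
  then show ?case by simp
next
  case (Suc N)
  define \<sigma> where "\<sigma> = real s / real (Suc N)"
  define S where "S = sum t {..<R}"
  define X where "X = bagavg R N s t (\<lambda>l. \<Phi> (None # l))"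
  define Y where "Y = (\<lambda>i. bagavg R N (s - 1) (t(i := t i - 1)) (\<lambda>l. \<Phi> (Some i # l)))"
  have \<sigma>: "0 \<le> \<sigma>" "\<sigma> \<le> 1" using Suc.prems(1) unfolding \<sigma>_def by (auto simp: field_simps)
  \<comment> \<open>For \<open>s = Suc N\<close> all positions must be filled: \<open>None\<close>
    has weight 0, and the induction hypothesis would not apply to it.\<close>
  have X: "\<bar>(1 - \<sigma>) * (X - v)\<bar> \<le> (1 - \<sigma>) * \<epsilon>"
  proof (cases "s = Suc N")
    case True
    then show ?thesis by (simp add: \<sigma>_def)
  next
    case False
    then have "\<bar>X - v\<bar> \<le> \<epsilon>"
      unfolding X_def
    proof (intro Suc.IH)
      fix l :: "nat option list"
      assume "length l = N" "\<And>i. Some i \<in> set l \<Longrightarrow> i < R" "\<And>i. count_list l (Some i) \<le> t i"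
        "length (filter (\<lambda>v. v \<noteq> None) l) = s"
      then show "\<bar>\<Phi> (None # l) - v\<bar> \<le> \<epsilon>" by (intro Suc.prems(3)) auto
    qed (use False Suc.prems(1,2) in auto)
    then show ?thesis using \<sigma> by (simp add: abs_mult mult_left_mono)
  qed
  have Y: "\<bar>\<sigma> * ((\<Sum>i<R. real (t i) / real S * Y i) - v)\<bar> \<le> \<sigma> * \<epsilon>"
  proof (cases "s = 0")
    case True
    then show ?thesis by (simp add: \<sigma>_def)
  next
    case False
    then have S: "S > 0" using Suc.prems(2) by (simp add: S_def)
    have w: "(\<Sum>i<R. real (t i) / real S) = 1"
    proof -
      have "(\<Sum>i<R. real (t i) / real S) = real S / real S"
        by (simp add: S_def flip: sum_divide_distrib)
      then show ?thesis using S by simp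
    qed
    have "\<bar>(\<Sum>i<R. real (t i) / real S * Y i) - v\<bar> = \<bar>\<Sum>i<R. real (t i) / real S * (Y i - v)\<bar>"
    proof -
      have "(\<Sum>i<R. real (t i) / real S * v) = v"
        using w by (simp only: mult_1 flip: sum_distrib_right)
      then show ?thesis by (simp only: right_diff_distrib sum_subtractf)
    qed
    also have "\<dots> \<le> (\<Sum>i<R. \<bar>real (t i) / real S * (Y i - v)\<bar>)" by (rule sum_abs)
    also have "\<dots> \<le> (\<Sum>i<R. real (t i) / real S * \<epsilon>)"
    proof (rule sum_mono)
      fix i assume i: "i \<in> {..<R}"
      show "\<bar>real (t i) / real S * (Y i - v)\<bar> \<le> real (t i) / real S * \<epsilon>"
      proof (cases "t i = 0")
        case False
        with i have "Suc (sum (t(i := t i - 1)) {..<R}) = sum t {..<R}"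
          by (intro sum_fun_upd_pred) auto
        moreover have "\<bar>\<Phi> (Some i # l) - v\<bar> \<le> \<epsilon>"
          if "length l = N" "\<And>j. Some j \<in> set l \<Longrightarrow> j < R"
            "\<And>j. count_list l (Some j) \<le> (t(i := t i - 1)) j"
            "length (filter (\<lambda>v. v \<noteq> None) l) = s - 1" for l
        proof (rule Suc.prems(3))
          fix j
          show "count_list (Some i # l) (Some j) \<le> t j"
            using that(3)[of j] False by (auto split: if_splits)
        qed (use that i \<open>s \<noteq> 0\<close> in auto)
        ultimately have "\<bar>Y i - v\<bar> \<le> \<epsilon>"
          unfolding Y_def using Suc.prems(1,2) by (intro Suc.IH) auto
        then show ?thesis by (simp add: abs_mult mult_left_mono divide_right_mono)
      qed simp
    qed
    also have "\<dots> = \<epsilon>" using w by (simp only: mult_1 flip: sum_distrib_right)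
    finally show ?thesis using \<sigma> by (simp add: abs_mult mult_left_mono)
  qed
  have "bagavg R (Suc N) s t \<Phi> - v =
      (1 - \<sigma>) * (X - v) + \<sigma> * ((\<Sum>i<R. real (t i) / real S * Y i) - v)"
    by (simp add: X_def Y_def \<sigma>_def S_def algebra_simps)
  with X Y show ?case by (simp add: algebra_simps)
qed

text \<open>In the pattern, which is the first argument, \<open>None\<close> is a wildcard; in the
  list it is an empty position.\<close>

definition matches :: "'a option list \<Rightarrow> 'a option list \<Rightarrow> bool" where
  "matches = list_all2 (\<lambda>p v. p = None \<or> p = v)"

definition fills :: "'a option list \<Rightarrow> nat" where
  "fills pat = length (filter (\<lambda>p. p \<noteq> None) pat)"

lemma sum_count_fills:
  fixes R :: nat
  shows
  "(\<And>i. Some i \<in> set pat \<Longrightarrow> i < R) \<Longrightarrow> (\<Sum>i<R. count_list pat (Some i)) = fills pat"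
proof (induction pat)
  case (Cons p pat)
  show ?case
  proof (cases p)
    case None
    then show ?thesis using Cons by (simp add: fills_def)
  next
    case (Some k)
    then have "k < R" using Cons.prems by simp
    have "(\<Sum>i<R. count_list (p # pat) (Some i)) =
        (\<Sum>i<R. (if i = k then 1 else 0) + count_list pat (Some i))"
      using Some by (intro sum.cong) auto
    also have "\<dots> = 1 + fills pat" using Cons \<open>k < R\<close> by (simp add: sum.distrib)
    finally show ?thesis using Some by (simp add: fills_def)
  qed
qed (simp add: fills_def)

text \<open>Drawing \<open>i\<close> lowers one count by 1; the two ways of splitting a factor off a
  falling factorial turn this into the factor \<open>t i - a i\<close>. For \<open>t i = 0\<close>
  both sides vanish.\<close>

lemma draw_ff:
  fixes R :: nat
  assumes "i < R"
  shows "real (t i) * (\<Prod>j<R. ff (real ((t(i := t i - 1)) j)) (a j)) =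
    (\<Prod>j<R. ff (real (t j)) (a j)) * (real (t i) - real (a i))"
proof (cases "t i = 0")
  case True
  have "(\<Prod>j<R. ff (real (t j)) (a j)) = 0" if "a i > 0"
    using True that assms ff_eq_0[of "t i" "a i"] by (intro prod_zero bexI[of _ i]) auto
  then show ?thesis using True by auto
next
  case False
  let ?P = "\<Prod>j\<in>{..<R} - {i}. ff (real (t j)) (a j)"
  have "(\<Prod>j<R. ff (real ((t(i := t i - 1)) j)) (a j)) = ff (real (t i) - 1) (a i) * ?P"
    using assms False by (subst prod.remove[of _ i]) (auto intro!: prod.cong simp: of_nat_diff)
  moreover have "(\<Prod>j<R. ff (real (t j)) (a j)) = ff (real (t i)) (a i) * ?P"
    using assms by (subst prod.remove[of _ i]) auto
  ultimately show ?thesis using ff_shift[of "real (t i)" "a i"] by (simp add: ff_Suc mult_ac)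
qed

text \<open>Let \<open>a = fills pat\<close>, let \<open>N\<close> be the length and
  \<open>S\<close> the size of the bag. The \<open>a\<close> prescribed positions are all among the
  \<open>s\<close> chosen ones with probability \<open>ff s a / ff N a\<close>, and they then
  receive the prescribed items with probability product of the \<open>ff (t i) (c i)\<close> over
  \<open>ff S a\<close>, where \<open>c i\<close> counts the demands for \<open>i\<close>. What
  matters later is that \<open>s\<close> enters only through the polynomial
  \<open>ff s a\<close>.\<close>

lemma bagavg_matches:
  assumes "s \<le> length pat" "s \<le> sum t {..<R}" "\<And>i. Some i \<in> set pat \<Longrightarrow> i < R"
  shows "bagavg R (length pat) s t (\<lambda>l. of_bool (matches pat l)) =
    ff (real s) (fills pat) / (ff (real (sum t {..<R})) (fills pat) * ff (real (length pat)) (fills pat)) *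
    (\<Prod>i<R. ff (real (t i)) (count_list pat (Some i)))"
  using assms
proof (induction pat arbitrary: s t)
  case Nil
  then show ?case by (simp add: matches_def fills_def)
next
  case (Cons p pat)
  define N where "N = length pat"
  define S where "S = sum t {..<R}"
  define a where "a = fills pat"
  define c where "c = (\<lambda>i. count_list pat (Some i))"
  have "a \<le> N" by (simp add: a_def N_def fills_def)
  have ca: "(\<Sum>i<R. real (c i)) = real a"
    using Cons.prems(3) sum_count_fills[of pat R] by (simp add: a_def c_def flip: of_nat_sum)
  have IH: "bagavg R N s' t' (\<lambda>l. of_bool (matches pat l)) =
      ff s' a / (ff (sum t' {..<R}) a * ff N a) * (\<Prod>i<R. ff (t' i) (c i))"
    if "s' \<le> N" "s' \<le> sum t' {..<R}" for s' t'
    unfolding N_def a_def c_def using that Cons.prems(3) by (intro Cons.IH) (auto simp: N_def)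
  have draw: "real s * (real (t i) / S * bagavg R N (s - 1) (t(i := t i - 1)) (\<lambda>l. of_bool (matches pat l)))
     = real s * (ff (real s - 1) a / (real S * ff (real S - 1) a * ff N a) *
          ((\<Prod>j<R. ff (t j) (c j)) * (real (t i) - real (c i))))" if i: "i < R" for i
  proof (cases "t i = 0 \<or> s = 0")
    case True
    with draw_ff[OF i, of t c] show ?thesis by auto
  next
    case False
    then have 1: "Suc (sum (t(i := t i - 1)) {..<R}) = S"
      unfolding S_def using i by (intro sum_fun_upd_pred) auto
    then have 2: "real (sum (t(i := t i - 1)) {..<R}) = real S - 1" by linarith
    have "s - 1 \<le> N" "s - 1 \<le> sum (t(i := t i - 1)) {..<R}"
      using Cons.prems(1,2) 1 by (auto simp: N_def S_def)
    note IH' = IH[OF this, unfolded 2]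
    have 3: "real (s - 1) = real s - 1" using False by simp
    show ?thesis unfolding IH' draw_ff[OF i, of t c, symmetric] 3 by (simp add: mult_ac)
  qed
  \<comment> \<open>For \<open>s = Suc N\<close> the first factor is 0, so the induction hypothesis
    is called only with \<open>s \<le> N\<close>.\<close>
  have stop: "(1 - real s / real (Suc N)) * bagavg R N s t (\<lambda>l. of_bool (matches pat l)) =
      (1 - real s / real (Suc N)) * (ff s a / (ff S a * ff N a) * (\<Prod>i<R. ff (t i) (c i)))"
  proof (cases "s = Suc N")
    case False
    then show ?thesis using IH[of s t] Cons.prems(1,2) by (simp add: N_def S_def)
  qed simp
  show ?case
  proof (cases p)
    case None
    define P where "P = (\<Prod>i<R. ff (t i) (c i))"
    have "real s * (\<Sum>i<R. real (t i) / S * bagavg R N (s - 1) (t(i := t i - 1)) (\<lambda>l. of_bool (matches pat l)))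
      = (\<Sum>i<R. real s * (ff (real s - 1) a / (real S * ff (real S - 1) a * ff N a) *
          (P * (real (t i) - real (c i)))))"
      unfolding sum_distrib_left P_def using draw by (intro sum.cong) auto
    also have "\<dots> = real s * ff (real s - 1) a / (real S * ff (real S - 1) a * ff N a) *
          (P * (\<Sum>i<R. real (t i) - real (c i)))"
      by (simp add: sum_distrib_left sum_divide_distrib mult_ac)
    also have "(\<Sum>i<R. real (t i) - real (c i)) = real S - real a"
      by (simp add: sum_subtractf ca S_def)
    also have "real s * ff (real s - 1) a / (real S * ff (real S - 1) a * ff N a) * (P * (real S - real a))
      = ff s a * (real s - real a) / (ff S a * ff N a) * P"
      unfolding ff_shift ff_Suc
    \<comment> \<open>\<open>S - a\<close> cancels only if it is nonzero, which
      \<open>a < s \<le> S\<close> ensures; for \<open>a \<ge> s\<close> both sides are 0.\<close>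
    proof (cases "a < s")
      case True
      then have "a < S" using Cons.prems(2) by (simp add: S_def)
      then have "real S - real a \<noteq> 0" by simp
      then show "ff s a * (real s - real a) / (ff S a * (real S - real a) * ff N a) * (P * (real S - real a))
        = ff s a * (real s - real a) / (ff S a * ff N a) * P" by simp
    next
      case False
      then have "ff s a * (real s - real a) = 0"
        using ff_eq_0[of s a] by (cases "s = a") auto
      then show "ff s a * (real s - real a) / (ff S a * (real S - real a) * ff N a) * (P * (real S - real a))
        = ff s a * (real s - real a) / (ff S a * ff N a) * P" by simp
    qed
    finally have *: "real s * (\<Sum>i<R. real (t i) / S * bagavg R N (s - 1) (t(i := t i - 1)) (\<lambda>l. of_bool (matches pat l)))
      = ff s a * (real s - real a) / (ff S a * ff N a) * P" .
    have "bagavg R (Suc N) s t (\<lambda>l. of_bool (matches (p # pat) l)) =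
      (1 - real s / real (Suc N)) * (ff s a / (ff S a * ff N a) * P) +
      ff s a * (real s - real a) / (ff S a * ff N a) * P / real (Suc N)"
      unfolding *[symmetric] unfolding P_def stop[symmetric] using None by (simp add: matches_def S_def)
    also have "\<dots> = ff s a / ff S a * P * ((real (Suc N) - real a) / (real (Suc N) * ff N a))"
    proof -
      \<comment> \<open>\<open>y\<close> stands for \<open>ff S a\<close>, which is 0 if the pattern
        prescribes more items than the bag holds; by \<open>x / 0 = 0\<close> the identity
        survives.\<close>
      have "(1 - q / M) * (x / (y * z) * P) + x * (q - r) / (y * z) * P / M
          = x / y * P * ((M - r) / (M * z))"
        if "z \<noteq> 0" "M \<noteq> 0" for x y z q r M :: real
        using that by (cases "y = 0") (simp_all add: field_simps)
      from this[of "ff N a" "real (Suc N)"] show ?thesis using ff_pos[OF \<open>a \<le> N\<close>] by simp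
    qed
    also have "(real (Suc N) - real a) / (real (Suc N) * ff N a) = 1 / ff (real (Suc N)) a"
    proof -
      have "real (Suc N) * ff N a = ff (real (Suc N)) a * (real (Suc N) - real a)"
        using ff_shift[of "real (Suc N)" a] by (simp add: ff_Suc)
      then show ?thesis using \<open>a \<le> N\<close> by simp
    qed
    finally show ?thesis using None by (simp add: a_def N_def S_def P_def c_def fills_def)
  next
    case (Some k)
    then have k: "k < R" using Cons.prems(3) by auto
    have "bagavg R (Suc N) s t (\<lambda>l. of_bool (matches (p # pat) l)) =
      real s / real (Suc N) * (\<Sum>i<R. real (t i) / S *
        bagavg R N (s - 1) (t(i := t i - 1)) (\<lambda>l. of_bool (matches (p # pat) (Some i # l))))"
      using Some by (simp add: matches_def S_def)
    also have "(\<Sum>i<R. real (t i) / S *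
        bagavg R N (s - 1) (t(i := t i - 1)) (\<lambda>l. of_bool (matches (p # pat) (Some i # l)))) =
      (\<Sum>i<R. if i = k then real (t k) / S *
        bagavg R N (s - 1) (t(k := t k - 1)) (\<lambda>l. of_bool (matches pat l)) else 0)"
      using Some by (intro sum.cong) (auto simp: matches_def)
    also have "\<dots> = real (t k) / S * bagavg R N (s - 1) (t(k := t k - 1)) (\<lambda>l. of_bool (matches pat l))"
      using k by simp
    also have "real s / real (Suc N) * \<dots> = (real s * ff (real s - 1) a) /
        (real S * ff (real S - 1) a * (real (Suc N) * ff N a)) *
          ((\<Prod>j<R. ff (t j) (c j)) * (real (t k) - real (c k)))"
      using arg_cong[OF draw[OF k], of "\<lambda>x. x / real (Suc N)"] by (simp add: mult_ac)
    also have "real (Suc N) * ff N a = ff (Suc N) (Suc a)"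
      using ff_shift[of "real (Suc N)" a] by simp
    also have "(\<Prod>j<R. ff (t j) (c j)) * (real (t k) - real (c k)) =
        (\<Prod>j<R. ff (t j) (count_list (p # pat) (Some j)))"
    proof -
      have "(\<Prod>j<R. ff (t j) (count_list (p # pat) (Some j))) =
          (\<Prod>j<R. ff (t j) (c j) * (if j = k then real (t k) - real (c k) else 1))"
        using Some by (intro prod.cong) (auto simp: c_def ff_Suc)
      also have "\<dots> = (\<Prod>j<R. ff (t j) (c j)) * (real (t k) - real (c k))"
        using k by (simp add: prod.distrib)
      finally show ?thesis by simp
    qed
    finally show ?thesis using Some by (simp add: ff_shift a_def N_def S_def fills_def)
  qed
qed

lemma fills_update: "fills (pat[j := v]) \<le> Suc (fills pat)"
proof (induction pat arbitrary: j)
  case (Cons p pat)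
  then show ?case by (cases j) (auto simp: fills_def)
qed (simp add: fills_def)

text \<open>Two factors that ask for different items at one position make the monomial 0; otherwise
  the demands form a pattern, to which each factor adds at most one filled position.\<close>

lemma monomial_matches:
  fixes R :: nat
  assumes "set xs \<subseteq> {..<N} \<times> {..<R}"
  shows "(\<forall>l. length l = N \<longrightarrow> prod_list (map (\<lambda>(j, i). of_bool (l ! j = Some i)) xs) = (0::real)) \<or>
    (\<exists>pat. length pat = N \<and> fills pat \<le> length xs \<and> (\<forall>i. Some i \<in> set pat \<longrightarrow> i < R) \<and>
      (\<forall>l. length l = N \<longrightarrow>
        prod_list (map (\<lambda>(j, i). of_bool (l ! j = Some i)) xs) = (of_bool (matches pat l) :: real)))"
  using assms
proof (induction xs)
  case Nil
  define pat :: "nat option list" where "pat = replicate N None"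
  have "length pat = N" "fills pat = 0" "\<forall>i. Some i \<notin> set pat" "matches pat l" if "length l = N" for l
    using that by (auto simp: pat_def fills_def matches_def list_all2_conv_all_nth)
  then have "length pat = N" "fills pat = 0" "\<forall>i. Some i \<notin> set pat" "\<forall>l. length l = N \<longrightarrow> matches pat l"
    using Ex_list_of_length[of N] by blast+
  then show ?case by (intro disjI2 exI[of _ pat]) simp
next
  case (Cons ji xs)
  obtain j i where ji: "ji = (j, i)" "j < N" "i < R" using Cons.prems by auto
  have "(\<forall>l. length l = N \<longrightarrow> prod_list (map (\<lambda>(j, i). of_bool (l ! j = Some i)) xs) = (0::real)) \<or>
    (\<exists>pat. length pat = N \<and> fills pat \<le> length xs \<and> (\<forall>i. Some i \<in> set pat \<longrightarrow> i < R) \<and>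
      (\<forall>l. length l = N \<longrightarrow>
        prod_list (map (\<lambda>(j, i). of_bool (l ! j = Some i)) xs) = (of_bool (matches pat l) :: real)))"
    using Cons by simp
  then show ?case
  proof (elim disjE exE conjE)
    assume "\<forall>l. length l = N \<longrightarrow> prod_list (map (\<lambda>(j, i). of_bool (l ! j = Some i)) xs) = (0::real)"
    then show ?thesis by simp
  next
    fix pat :: "nat option list"
    assume pat: "length pat = N" "fills pat \<le> length xs" "\<forall>i. Some i \<in> set pat \<longrightarrow> i < R"
      "\<forall>l. length l = N \<longrightarrow>
        prod_list (map (\<lambda>(j, i). of_bool (l ! j = Some i)) xs) = (of_bool (matches pat l) :: real)"
    have prod: "prod_list (map (\<lambda>(j, i). of_bool (l ! j = Some i)) (ji # xs)) =
        (of_bool (l ! j = Some i \<and> matches pat l) :: real)" if "length l = N" for l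
      using pat(4) that ji(1) by (simp add: of_bool_conj)
    have match: "matches pat l \<Longrightarrow> pat ! j = None \<or> pat ! j = l ! j" if "length l = N" for l
      using ji(2) pat(1) that by (auto simp: matches_def list_all2_conv_all_nth)
    show ?thesis
    proof (cases "pat ! j")
      case None
      let ?pat = "pat[j := Some i]"
      have "matches ?pat l \<longleftrightarrow> l ! j = Some i \<and> matches pat l" if "length l = N" for l
        using ji(2) pat(1) that None
        unfolding matches_def list_all2_conv_all_nth by (auto simp: nth_list_update)
      moreover have "fills ?pat \<le> length (ji # xs)"
        using fills_update[of pat j "Some i"] pat(2) by simp
      moreover have "\<forall>i'. Some i' \<in> set ?pat \<longrightarrow> i' < R"
        using pat(3) ji(3) set_update_subset_insert[of pat j "Some i"] by auto
      ultimately show ?thesis using prod pat(1) by (intro disjI2 exI[of _ ?pat]) auto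
    next
      case (Some i')
      show ?thesis
      proof (cases "i' = i")
        case True
        then have "l ! j = Some i \<and> matches pat l \<longleftrightarrow> matches pat l" if "length l = N" for l
          using match[OF that] Some by auto
        then show ?thesis using prod pat by (intro disjI2 exI[of _ pat]) auto
      next
        case False
        then have "\<not> (l ! j = Some i \<and> matches pat l)" if "length l = N" for l
          using match[OF that] Some by auto
        then show ?thesis using prod by (intro disjI1) auto
      qed
    qed
  qed
qed

text \<open>For \<open>s\<close> equal to the size \<open>S\<close> of the bag, the average is \<open>Q t\<close>; this defines \<open>Q t\<close> also for bags with
  \<open>S > N\<close>, where \<open>h\<close> extrapolates to \<open>S\<close> the averages over smaller samples.\<close>

theorem symmetrization:
  assumes "polyfun ({..<N} \<times> {..<R}) D F"
  shows "\<exists>Q. polyfun {..<R} D Q \<and> (\<forall>t :: nat \<Rightarrow> nat. \<exists>h. degree h \<le> D \<and>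
    poly h (real (sum t {..<R})) = Q (\<lambda>i. real (t i)) \<and>
    (\<forall>s. s \<le> N \<and> s \<le> sum t {..<R} \<longrightarrow>
      poly h (real s) = bagavg R N s t (\<lambda>l. F (\<lambda>(j, i). of_bool (l ! j = Some i)))))"
  using assms
proof (induction rule: polyfun_monomial_induct)
  case (monomial c xs)
  let ?\<Phi> = "\<lambda>l. prod_list (map (\<lambda>(j, i). of_bool (l ! j = Some i)) xs) :: real"
  from monomial_matches[OF monomial(1)] show ?case
  proof (elim disjE exE conjE)
    assume "\<forall>l. length l = N \<longrightarrow> ?\<Phi> l = 0"
    then have "bagavg R N s t (\<lambda>l. c * ?\<Phi> l) = bagavg R N s t (\<lambda>l. 0)" for s t
      by (intro bagavg_cong) simp
    then show ?thesis
      by (intro exI[of _ "\<lambda>_. 0"] conjI polyfun.const allI exI[of _ 0]) auto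
  next
    fix pat :: "nat option list"
    assume pat: "length pat = N" "fills pat \<le> length xs" "\<forall>i. Some i \<in> set pat \<longrightarrow> i < R"
      "\<forall>l. length l = N \<longrightarrow> ?\<Phi> l = of_bool (matches pat l)"
    define a where "a = fills pat"
    define b where "b = (\<lambda>i. count_list pat (Some i))"
    have ab: "(\<Sum>i<R. b i) = a" unfolding a_def b_def using pat(3) by (intro sum_count_fills) auto
    have aN: "a \<le> N" using pat(1) by (auto simp: a_def fills_def)
    \<comment> \<open>The formula of \<open>bagavg_matches\<close> for \<open>s = S\<close>, with
      \<open>ff s a\<close> cancelled against \<open>ff S a\<close>.\<close>
    define Q where "Q = (\<lambda>t. c / ff N a * (\<Prod>i<R. ff (t i) (b i)))"
    have "polyfun {..<R} (Suc 0) (\<lambda>t. t i - real q)" if "i < R" for i q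
      using that by (intro polyfun_diff polyfun.const polyfun_var) simp
    then have "polyfun {..<R} (\<Sum>q<b i. Suc 0) (\<lambda>t. ff (t i) (b i))" if "i < R" for i
      unfolding ff_def using that by (intro polyfun_prod)
    then have "polyfun {..<R} (\<Sum>i<R. b i) (\<lambda>t. \<Prod>i<R. ff (t i) (b i))"
      by (intro polyfun_prod) simp
    then have 1: "polyfun {..<R} D Q"
      unfolding Q_def using ab pat(2) monomial(2)
      by (intro polyfun_cmult) (auto simp: a_def intro: polyfun_mono)
    have 2: "\<exists>h. degree h \<le> D \<and> poly h (real (sum t {..<R})) = Q (\<lambda>i. real (t i)) \<and>
      (\<forall>s. s \<le> N \<and> s \<le> sum t {..<R} \<longrightarrow> poly h (real s) = bagavg R N s t (\<lambda>l. c * ?\<Phi> l))"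
      for t :: "nat \<Rightarrow> nat"
    proof -
      let ?S = "sum t {..<R}"
      let ?P = "\<Prod>i<R. ff (t i) (b i)"
      \<comment> \<open>The same formula for a fixed bag, as a polynomial in
        \<open>s\<close>.\<close>
      define h where "h = smult (c * ?P / (ff ?S a * ff N a)) (\<Prod>q<a. [:- real q, 1:])"
      have poly_h: "poly h x = c * ?P / (ff ?S a * ff N a) * ff x a" for x
        unfolding h_def by (simp add: poly_prod ff_def)
      have "degree (\<Prod>q<a. [:- real q, 1:]) \<le> (\<Sum>q<a. degree [:- real q, 1:])"
        using degree_prod_sum_le[of "{..<a}" "\<lambda>q. [:- real q, 1:]"] by (simp add: comp_def)
      then have "degree h \<le> D"
        using pat(2) monomial(2) unfolding h_def a_def
        by (intro order.trans[OF degree_smult_le]) simp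
      moreover have "poly h ?S = Q (\<lambda>i. real (t i))"
      proof (cases "a \<le> ?S")
        case True
        then show ?thesis using ff_pos[of a ?S] by (simp add: poly_h Q_def)
      next
        case False
        \<comment> \<open>Here \<open>ff S a = 0\<close> and nothing cancels, but the pattern
          demands more copies of some item than the bag has, so both sides are 0.\<close>
        then have "\<exists>i<R. t i < b i" using ab sum_mono[of "{..<R}" b t] by (metis lessThan_iff not_less)
        then have "?P = 0" by (intro prod_zero) (auto intro: ff_eq_0)
        then show ?thesis by (simp add: poly_h Q_def)
      qed
      moreover have "poly h (real s) = bagavg R N s t (\<lambda>l. c * ?\<Phi> l)"
        if "s \<le> N" "s \<le> ?S" for s
      proof -
        have "bagavg R N s t (\<lambda>l. c * ?\<Phi> l) = c * bagavg R N s t (\<lambda>l. of_bool (matches pat l))"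
          unfolding bagavg_cmult using pat(4) by (auto intro!: arg_cong[where f = "(*) c"] bagavg_cong)
        also have "\<dots> = poly h s"
          using bagavg_matches[of s pat t R] that pat(1,3) by (simp add: poly_h a_def b_def)
        finally show ?thesis by simp
      qed
      ultimately show ?thesis by blast
    qed
    from 1 2 show ?thesis by blast
  qed
next
  case (add F G)
  then obtain Q1 Q2 where Q: "polyfun {..<R} D Q1" "polyfun {..<R} D Q2"
    and Q1: "\<forall>t :: nat \<Rightarrow> nat. \<exists>h. degree h \<le> D \<and>
      poly h (real (sum t {..<R})) = Q1 (\<lambda>i. real (t i)) \<and>
      (\<forall>s. s \<le> N \<and> s \<le> sum t {..<R} \<longrightarrow>
        poly h (real s) = bagavg R N s t (\<lambda>l. F (\<lambda>(j, i). of_bool (l ! j = Some i))))"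
    and Q2: "\<forall>t :: nat \<Rightarrow> nat. \<exists>h. degree h \<le> D \<and>
      poly h (real (sum t {..<R})) = Q2 (\<lambda>i. real (t i)) \<and>
      (\<forall>s. s \<le> N \<and> s \<le> sum t {..<R} \<longrightarrow>
        poly h (real s) = bagavg R N s t (\<lambda>l. G (\<lambda>(j, i). of_bool (l ! j = Some i))))"
    by blast
  show ?case
  proof (intro exI[of _ "\<lambda>x. Q1 x + Q2 x"] conjI allI)
    show "polyfun {..<R} D (\<lambda>x. Q1 x + Q2 x)" using Q by (rule polyfun.add)
    fix t :: "nat \<Rightarrow> nat"
    obtain h1 where h1: "degree h1 \<le> D" "poly h1 (real (sum t {..<R})) = Q1 (\<lambda>i. real (t i))"
      "\<forall>s. s \<le> N \<and> s \<le> sum t {..<R} \<longrightarrow>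
        poly h1 (real s) = bagavg R N s t (\<lambda>l. F (\<lambda>(j, i). of_bool (l ! j = Some i)))"
      using Q1 by blast
    obtain h2 where h2: "degree h2 \<le> D" "poly h2 (real (sum t {..<R})) = Q2 (\<lambda>i. real (t i))"
      "\<forall>s. s \<le> N \<and> s \<le> sum t {..<R} \<longrightarrow>
        poly h2 (real s) = bagavg R N s t (\<lambda>l. G (\<lambda>(j, i). of_bool (l ! j = Some i)))"
      using Q2 by blast
    show "\<exists>h. degree h \<le> D \<and>
      poly h (real (sum t {..<R})) = Q1 (\<lambda>i. real (t i)) + Q2 (\<lambda>i. real (t i)) \<and>
      (\<forall>s. s \<le> N \<and> s \<le> sum t {..<R} \<longrightarrow>
        poly h (real s) = bagavg R N s t (\<lambda>l. F (\<lambda>(j, i). of_bool (l ! j = Some i)) +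
          G (\<lambda>(j, i). of_bool (l ! j = Some i))))"
      using h1 h2 by (intro exI[of _ "h1 + h2"]) (simp add: bagavg_add degree_add_le)
  qed
qed


section \<open>Interpolation and growth of polynomials\<close>

text \<open>Both sides have degree less than \<open>card I\<close> and agree at the
  \<open>card I\<close> points \<open>\<nu> i\<close>.\<close>

lemma lagrange_interpolation:
  fixes p :: "real poly" and \<nu> :: "'a \<Rightarrow> real"
  assumes "finite I" "inj_on \<nu> I" "degree p < card I"
  shows "p = (\<Sum>i\<in>I. smult (poly p (\<nu> i) / (\<Prod>j\<in>I - {i}. \<nu> i - \<nu> j)) (\<Prod>j\<in>I - {i}. [:- \<nu> j, 1:]))"
    (is "p = ?L")
proof (rule poly_eqI_degree)
  show "card (\<nu> ` I) > degree p" using assms by (simp add: card_image)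
  have "degree (\<Prod>j\<in>I - {i}. [:- \<nu> j, 1:]) \<le> card I - 1" if "i \<in> I" for i
    using degree_prod_sum_le[of "I - {i}" "\<lambda>j. [:- \<nu> j, 1:]"] assms(1) that by (simp add: comp_def)
  then have "degree ?L \<le> card I - 1"
    using assms(1) by (intro degree_sum_le) (auto intro: order.trans[OF degree_smult_le])
  then show "card (\<nu> ` I) > degree ?L" using assms by (simp add: card_image)
  fix x assume "x \<in> \<nu> ` I"
  then obtain k where k: "k \<in> I" "x = \<nu> k" by blast
  have "poly ?L x = (\<Sum>i\<in>I. if i = k then poly p x else 0)"
    unfolding poly_sum poly_smult poly_prod
  proof (rule sum.cong)
    fix i assume i: "i \<in> I"
    show "poly p (\<nu> i) / (\<Prod>j\<in>I - {i}. \<nu> i - \<nu> j) * (\<Prod>j\<in>I - {i}. poly [:- \<nu> j, 1:] x) =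
      (if i = k then poly p x else 0)"
    proof (cases "i = k")
      case True
      have "(\<Prod>j\<in>I - {i}. \<nu> i - \<nu> j) \<noteq> 0"
        using assms(1,2) i by (auto simp: inj_on_def)
      then show ?thesis using True k by simp
    next
      case False
      then have "(\<Prod>j\<in>I - {i}. poly [:- \<nu> j, 1:] x) = 0"
        using assms(1) k by (intro prod_zero bexI[of _ k]) auto
      with False show ?thesis by simp
    qed
  qed simp
  then show "poly p x = poly ?L x" using assms(1) k(1) by simp
qed

text \<open>Compare the coefficients of degree \<open>card I - 1\<close> in Lagrange's formula:
  every basis product is monic of that degree, whereas \<open>p\<close> has smaller degree.\<close>

lemma divided_difference_zero:
  fixes p :: "real poly" and \<nu> :: "'a \<Rightarrow> real"
  assumes "finite I" "inj_on \<nu> I" "Suc (degree p) < card I"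
  shows "(\<Sum>i\<in>I. poly p (\<nu> i) / (\<Prod>j\<in>I - {i}. \<nu> i - \<nu> j)) = 0"
proof -
  have "coeff (\<Prod>j\<in>I - {i}. [:- \<nu> j, 1:]) (card I - 1) = 1" if "i \<in> I" for i
  proof -
    have "lead_coeff (\<Prod>j\<in>I - {i}. [:- \<nu> j, 1:]) = 1"
      by (simp add: lead_coeff_prod)
    moreover have "degree (\<Prod>j\<in>I - {i}. [:- \<nu> j, 1:]) = card I - 1"
      using assms(1) that by (subst degree_prod_eq_sum_degree) auto
    ultimately show ?thesis by simp
  qed
  then have "(\<Sum>i\<in>I. poly p (\<nu> i) / (\<Prod>j\<in>I - {i}. \<nu> i - \<nu> j)) =
    coeff (\<Sum>i\<in>I. smult (poly p (\<nu> i) / (\<Prod>j\<in>I - {i}. \<nu> i - \<nu> j)) (\<Prod>j\<in>I - {i}. [:- \<nu> j, 1:])) (card I - 1)"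
    by (simp add: coeff_sum)
  also have "\<dots> = coeff p (card I - 1)"
    using lagrange_interpolation[OF assms(1,2), of p] assms(3) by simp
  also have "\<dots> = 0" using assms(3) by (intro coeff_eq_0) simp
  finally show ?thesis .
qed

lemma prod_abs_diff_eq_fact:
  assumes "j \<le> D"
  shows "(\<Prod>i\<in>{..D} - {j}. \<bar>real j - real i\<bar>) = fact j * fact (D - j)"
proof -
  have split: "{..D} - {j} = {..<j} \<union> {j<..D}" using assms by auto
  have "(\<Prod>i\<in>{..D} - {j}. \<bar>real j - real i\<bar>) =
      (\<Prod>i<j. \<bar>real j - real i\<bar>) * (\<Prod>i\<in>{j<..D}. \<bar>real j - real i\<bar>)"
    unfolding split by (rule prod.union_disjoint) auto
  also have "(\<Prod>i<j. \<bar>real j - real i\<bar>) = (\<Prod>i\<in>{1..j}. real i)"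
    by (rule prod.reindex_bij_witness[of _ "\<lambda>i. j - i" "\<lambda>i. j - i"]) (auto simp: of_nat_diff)
  also have "(\<Prod>i\<in>{j<..D}. \<bar>real j - real i\<bar>) = (\<Prod>i\<in>{1..D - j}. real i)"
    by (rule prod.reindex_bij_witness[of _ "\<lambda>i. i + j" "\<lambda>i. i - j"]) (auto simp: of_nat_diff)
  finally show ?thesis by (simp add: fact_prod)
qed

lemma power_div_fact_le_exp: "(0::real) \<le> y \<Longrightarrow> y ^ n / fact n \<le> exp y"
proof -
  assume y: "0 \<le> y"
  have "(\<Sum>k\<in>{n}. inverse (fact k) * y ^ k) \<le> suminf (\<lambda>k. inverse (fact k) * y ^ k)"
    using y summable_exp[of y] by (intro sum_le_suminf) auto
  then show ?thesis by (simp add: exp_def divide_inverse mult.commute scaleR_conv_of_real)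
qed

text \<open>Interpolate at \<open>0, k, ..., D * k\<close>. To the right of these nodes each
  \<open>x - \<nu> i\<close> lies between 0 and \<open>x\<close>, and the reciprocals of the
  denominators \<open>k ^ D * j! * (D - j)!\<close> add up to
  \<open>2 ^ D / (k ^ D * D!)\<close>.\<close>

lemma poly_growth:
  fixes h :: "real poly"
  assumes "degree h \<le> D" "k > 0" "\<And>j. j \<le> D \<Longrightarrow> \<bar>poly h (real j * k)\<bar> \<le> B" "x \<ge> real D * k"
  shows "\<bar>poly h x\<bar> \<le> B * 4 ^ D * exp (x / (2 * k))"
proof -
  have B: "B \<ge> 0" using assms(3)[of 0] by linarith
  have x: "x \<ge> real i * k" if "i \<le> D" for i
    using assms(2,4) mult_right_mono[of "real i" "real D" k] that by linarith
  then have x0: "x \<ge> 0" using x[of 0] by simp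
  define \<nu> where "\<nu> = (\<lambda>j. real j * k)"
  have inj: "inj_on \<nu> {..D}" using assms(2) by (auto simp: inj_on_def \<nu>_def)
  have "poly h x = (\<Sum>j\<le>D. poly h (\<nu> j) / (\<Prod>i\<in>{..D} - {j}. \<nu> j - \<nu> i) * (\<Prod>i\<in>{..D} - {j}. x - \<nu> i))"
    using arg_cong[OF lagrange_interpolation[OF _ inj, of h], of "\<lambda>p. poly p x"] assms(1)
    by (simp add: poly_sum poly_prod)
  also have "\<bar>\<dots>\<bar> \<le> (\<Sum>j\<le>D. \<bar>poly h (\<nu> j) / (\<Prod>i\<in>{..D} - {j}. \<nu> j - \<nu> i) * (\<Prod>i\<in>{..D} - {j}. x - \<nu> i)\<bar>)"
    by (rule sum_abs)
  also have "\<dots> \<le> (\<Sum>j\<le>D. B * (x / k) ^ D * (real (D choose j) / fact D))"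
  proof (rule sum_mono)
    fix j assume "j \<in> {..D}"
    then have j: "j \<le> D" by simp
    have "\<bar>\<nu> j - \<nu> i\<bar> = k * \<bar>real j - real i\<bar>" for i
    proof -
      have "\<nu> j - \<nu> i = k * (real j - real i)" by (simp add: \<nu>_def algebra_simps)
      then show ?thesis using assms(2) by (simp add: abs_mult)
    qed
    then have "\<bar>\<Prod>i\<in>{..D} - {j}. \<nu> j - \<nu> i\<bar> = (\<Prod>i\<in>{..D} - {j}. k * \<bar>real j - real i\<bar>)"
      by (simp add: abs_prod)
    also have "\<dots> = k ^ D * (fact j * fact (D - j))"
      using j by (simp add: prod.distrib prod_abs_diff_eq_fact)
    finally have 1: "\<bar>\<Prod>i\<in>{..D} - {j}. \<nu> j - \<nu> i\<bar> = k ^ D * (fact j * fact (D - j))" .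
    have "(\<Prod>i\<in>{..D} - {j}. \<bar>x - \<nu> i\<bar>) \<le> (\<Prod>i\<in>{..D} - {j}. x)"
      using x assms(2) by (intro prod_mono) (auto simp: \<nu>_def)
    then have 2: "\<bar>\<Prod>i\<in>{..D} - {j}. x - \<nu> i\<bar> \<le> x ^ D" using j by (simp add: abs_prod)
    have "\<bar>poly h (\<nu> j) / (\<Prod>i\<in>{..D} - {j}. \<nu> j - \<nu> i) * (\<Prod>i\<in>{..D} - {j}. x - \<nu> i)\<bar> =
        \<bar>poly h (\<nu> j)\<bar> / (k ^ D * (fact j * fact (D - j))) * \<bar>\<Prod>i\<in>{..D} - {j}. x - \<nu> i\<bar>"
      by (simp add: abs_mult 1)
    also have "\<dots> \<le> B / (k ^ D * (fact j * fact (D - j))) * x ^ D"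
      using assms(2,3) j 2 B by (intro mult_mono divide_right_mono) (auto simp: \<nu>_def)
    also have "\<dots> = B * (x / k) ^ D * (real (D choose j) / fact D)"
      using j by (simp add: binomial_fact power_divide)
    finally show "\<bar>poly h (\<nu> j) / (\<Prod>i\<in>{..D} - {j}. \<nu> j - \<nu> i) * (\<Prod>i\<in>{..D} - {j}. x - \<nu> i)\<bar>
      \<le> B * (x / k) ^ D * (real (D choose j) / fact D)" .
  qed
  also have "\<dots> = B * (x / k) ^ D * (real (\<Sum>j\<le>D. D choose j) / fact D)"
    by (simp only: of_nat_sum sum_distrib_left sum_divide_distrib)
  \<comment> \<open>Writing \<open>2 ^ D\<close> as \<open>4 ^ D / 2 ^ D\<close> leaves the growth
    rate \<open>1 / (2 * k)\<close>, half of the rate \<open>1 / k\<close> of the exponential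
    moments in \<open>or_dist_exp\<close>; this gap yields the tail bound.\<close>
  also have "\<dots> = B * 4 ^ D * ((x / (2 * k)) ^ D / fact D)"
  proof -
    have "(4::real) ^ D = 2 ^ D * 2 ^ D" by (simp flip: power_mult_distrib)
    then show ?thesis unfolding choose_row_sum by (simp add: power_divide power_mult_distrib)
  qed
  also have "\<dots> \<le> B * 4 ^ D * exp (x / (2 * k))"
    using B x0 assms(2) by (intro mult_left_mono power_div_fact_le_exp) auto
  finally show ?thesis .
qed

section \<open>Estimates for the node weights\<close>

lemma sum_inverse_squares_le:
  assumes "K \<ge> 1"
  shows "(\<Sum>m=1..K. 1 / real m ^ 2) \<le> 2 - 1 / real K"
  using assms
proof (induction K rule: dec_induct)
  case (step K)
  have "1 / real (Suc K) ^ 2 \<le> 1 / real K - 1 / real (Suc K)"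
  proof -
    have "1 / (real K + 1) ^ 2 \<le> 1 / (real K * (real K + 1))"
      using step by (intro divide_left_mono) (auto simp: power2_eq_square)
    also have "\<dots> = 1 / real K - 1 / (real K + 1)"
      using step by (simp add: field_simps)
    finally show ?thesis by (simp add: add.commute)
  qed
  with step show ?case by simp
qed simp

text \<open>These are the partial products of Wallis's product for \<open>\<pi> / 2\<close>. The
  slack \<open>1 / (K + 1)\<close> makes the bound inductive.\<close>

lemma wallis_product_le: "(\<Prod>m=1..K. 4 * real m ^ 2 / (4 * real m ^ 2 - 1)) \<le> 2 - 1 / (real K + 1)"
proof (induction K)
  case (Suc K)
  have pos: "(2::real) - 1 / (real K + 1) \<ge> 0" "4 * real (Suc K) ^ 2 / (4 * real (Suc K) ^ 2 - 1) \<ge> 0"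
    by (auto simp: field_simps power2_eq_square)
  have "(\<Prod>m=1..Suc K. 4 * real m ^ 2 / (4 * real m ^ 2 - 1)) \<le>
     (2 - 1 / (real K + 1)) * (4 * real (Suc K) ^ 2 / (4 * real (Suc K) ^ 2 - 1))"
    using mult_right_mono[OF Suc pos(2)] by simp
  also have "\<dots> = 4 * (real K + 1) / (2 * real K + 3)"
  proof -
    have "4 * real (Suc K) ^ 2 - 1 = (2 * real K + 1) * (2 * real K + 3)"
      by (simp add: power2_eq_square algebra_simps)
    moreover have "2 - 1 / (real K + 1) = (2 * real K + 1) / (real K + 1)" by (simp add: field_simps)
    ultimately show ?thesis by (simp add: power2_eq_square add.commute)
  qed
  also have "\<dots> \<le> (2 * real K + 3) / (real K + 2)"
    by (subst frac_le_eq) (auto simp: algebra_simps divide_nonpos_pos)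
  also have "\<dots> = 2 - 1 / (real (Suc K) + 1)" by (simp add: field_simps)
  finally show ?case .
qed simp

text \<open>Strengthened for the induction in the same way. It starts at \<open>K = 1\<close>, where
  equality holds; for \<open>K = 0\<close> the right side would be 0.\<close>

lemma shifted_wallis_product_le:
  assumes "K \<ge> 1"
  shows "(\<Prod>m=1..K. 4 * real m ^ 2 / (4 * real m ^ 2 - 2)) \<le> 4 - 4 / (real K + 1)"
  using assms
proof (induction K rule: dec_induct)
  case (step K)
  have pos: "(4::real) - 4 / (real K + 1) \<ge> 0" "4 * real (Suc K) ^ 2 / (4 * real (Suc K) ^ 2 - 2) \<ge> 0"
    by (auto simp: field_simps power2_eq_square)
  have "(\<Prod>m=1..Suc K. 4 * real m ^ 2 / (4 * real m ^ 2 - 2)) \<le>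
     (4 - 4 / (real K + 1)) * (4 * real (Suc K) ^ 2 / (4 * real (Suc K) ^ 2 - 2))"
    using mult_right_mono[OF step.IH pos(2)] by simp
  also have "\<dots> = 8 * real K * (real K + 1) / (2 * (real K + 1) ^ 2 - 1)"
  proof -
    have 1: "4 * real (Suc K) ^ 2 - 2 = 2 * (2 * (real K + 1) ^ 2 - 1)" by (simp add: add.commute)
    have 2: "4 * real (Suc K) ^ 2 = 4 * (real K + 1) ^ 2" by (simp add: add.commute)
    have 3: "4 - 4 / (real K + 1) = 4 * real K / (real K + 1)" by (simp add: field_simps)
    have "4 * x / y * (4 * y ^ 2 / (2 * z)) = 8 * x * y / z" if "y \<noteq> 0" for x y z :: real
      using that by (simp add: power2_eq_square)
    note * = this
    show ?thesis unfolding 1 unfolding 2 3 by (rule *) simp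
  qed
  also have "\<dots> \<le> 4 * (real K + 1) / (real K + 2)"
  proof -
    have "2 * real K * (real K + 2) \<le> 2 * (real K + 1) ^ 2 - 1"
      by (simp add: power2_eq_square algebra_simps)
    moreover have "2 * (real K + 1) ^ 2 - 1 > 0"
      by (simp add: power2_eq_square algebra_simps add_pos_nonneg)
    ultimately have "2 * real K / (2 * (real K + 1) ^ 2 - 1) \<le> 1 / (real K + 2)"
      by (simp add: pos_divide_le_eq pos_le_divide_eq mult.commute)
    then have "4 * (real K + 1) * (2 * real K / (2 * (real K + 1) ^ 2 - 1)) \<le> 4 * (real K + 1) * (1 / (real K + 2))"
      by (intro mult_left_mono) auto
    then show ?thesis by (simp add: mult_ac)
  qed
  also have "\<dots> = 4 - 4 / (real (Suc K) + 1)" by (simp add: field_simps)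
  finally show ?case .
qed simp

lemma fact_square_le: "m \<le> K \<Longrightarrow> (fact K :: real) ^ 2 \<le> fact (K - m) * fact (K + m)"
proof (induction m)
  case 0
  then show ?case by (simp add: power2_eq_square)
next
  case (Suc m)
  then have "(fact K :: real) ^ 2 \<le> fact (K - m) * fact (K + m)" by simp
  also have "\<dots> = fact (K - Suc m) * fact (K + m) * real (K - m)"
    using Suc.prems fact_reduce[of "K - m", where 'a = real] by (simp add: Suc_diff_Suc)
  also have "\<dots> \<le> fact (K - Suc m) * fact (K + m) * real (Suc (K + m))"
    by (intro mult_left_mono) auto
  also have "\<dots> = fact (K - Suc m) * fact (K + Suc m)" by (simp add: algebra_simps)
  finally show ?case .
qed

text \<open>Factoring \<open>m ^ 2 - i ^ 2\<close> as \<open>(m - i) * (m + i)\<close> shows that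
  the product on the right is \<open>(K - m)! * (K + m)! / (2 * m ^ 2)\<close>. The one on the left
  is \<open>(K!) ^ 2 / m ^ 2\<close>, and \<open>fact_square_le\<close> compares them.\<close>

lemma prod_square_diff_ge:
  assumes "1 \<le> m" "m \<le> K"
  shows "(\<Prod>i\<in>{1..K} - {m}. real i ^ 2) \<le> 2 * (\<Prod>i\<in>{1..K} - {m}. \<bar>real m ^ 2 - real i ^ 2\<bar>)"
proof -
  let ?I = "{1..K} - {m}"
  have I: "{..K} - {m} = insert 0 ?I" "0 \<notin> ?I" using assms by auto
  have 1: "(\<Prod>i\<in>?I. \<bar>real m - real i\<bar>) * m = fact m * fact (K - m)"
    using prod_abs_diff_eq_fact[of m K] assms(2) unfolding I(1) by (simp add: mult.commute)
  have "(\<Prod>i\<in>{1..K}. real m + real i) = (\<Prod>i\<in>{m+1..m+K}. real i)"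
    by (rule prod.reindex_bij_witness[of _ "\<lambda>i. i - m" "\<lambda>i. i + m"]) auto
  moreover have "fact m * (\<Prod>i\<in>{m+1..m+K}. real i) = fact (m + K)"
  proof -
    have "{1..m+K} = {1..m} \<union> {m+1..m+K}" by auto
    then show ?thesis by (simp add: fact_prod prod.union_disjoint)
  qed
  moreover have "(\<Prod>i\<in>{1..K}. real m + real i) = (real m + real m) * (\<Prod>i\<in>?I. real m + real i)"
    using assms by (intro prod.remove) auto
  ultimately have 2: "fact m * (2 * real m * (\<Prod>i\<in>?I. real m + real i)) = fact (K + m)"
    by (simp add: add.commute)
  have 3: "(\<Prod>i\<in>?I. real i ^ 2) * real m ^ 2 = fact K ^ 2"
  proof -
    have "(\<Prod>i\<in>{1..K}. real i ^ 2) = real m ^ 2 * (\<Prod>i\<in>?I. real i ^ 2)"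
      using assms by (intro prod.remove) auto
    moreover have "(\<Prod>i\<in>{1..K}. real i ^ 2) = fact K ^ 2"
      by (simp add: fact_prod prod_power_distrib)
    ultimately show ?thesis by (simp add: mult.commute)
  qed
  have "(\<Prod>i\<in>?I. \<bar>real m ^ 2 - real i ^ 2\<bar>) = (\<Prod>i\<in>?I. \<bar>real m - real i\<bar> * (real m + real i))"
    by (intro prod.cong) (auto simp: power2_eq_square square_diff_square_factored abs_mult mult.commute)
  also have "\<dots> = (\<Prod>i\<in>?I. \<bar>real m - real i\<bar>) * (\<Prod>i\<in>?I. real m + real i)"
    by (rule prod.distrib)
  finally have "fact m * (2 * (\<Prod>i\<in>?I. \<bar>real m ^ 2 - real i ^ 2\<bar>) * real m ^ 2) =
     ((\<Prod>i\<in>?I. \<bar>real m - real i\<bar>) * m) * (fact m * (2 * real m * (\<Prod>i\<in>?I. real m + real i)))"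
    by (simp add: power2_eq_square)
  also have "\<dots> = fact m * (fact (K - m) * fact (K + m))" unfolding 1 2 by simp
  finally have "2 * (\<Prod>i\<in>?I. \<bar>real m ^ 2 - real i ^ 2\<bar>) * real m ^ 2 = fact (K - m) * fact (K + m)" by simp
  with 3 fact_square_le[OF assms(2)]
  have "(\<Prod>i\<in>?I. real i ^ 2) * real m ^ 2 \<le> 2 * (\<Prod>i\<in>?I. \<bar>real m ^ 2 - real i ^ 2\<bar>) * real m ^ 2" by simp
  then show ?thesis using assms(1) by simp
qed


section \<open>A pair of distributions with matching moments\<close>

text \<open>The divided difference at these nodes annihilates all polynomials of degree at most \<open>K + 1\<close>. The
  nodes \<open>4 m\<^sup>2\<close> alone would give weights that do not decay; the extra nodes 1 and 2 improve them to
  \<open>O(m\<^sup>-\<^sup>4)\<close>, which makes the mean bounded.\<close>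

definition nodes :: "nat \<Rightarrow> nat set" where
  "nodes K = {0, 1, 2} \<union> (\<lambda>m. 4 * m ^ 2) ` {1..K}"

text \<open>The constant factor normalizes the weight at 0 to 1.\<close>

definition node_weight :: "nat \<Rightarrow> nat \<Rightarrow> real" where
  "node_weight K s = (\<Prod>j\<in>nodes K - {0}. real j) * (\<Prod>j\<in>nodes K - {0}. -1) /
    (\<Prod>j\<in>nodes K - {s}. real s - real j)"

lemma finite_nodes [simp]: "finite (nodes K)"
  by (simp add: nodes_def)

lemma inj_nodes: "inj_on (\<lambda>m. 4 * m ^ 2 :: nat) I"
  by (auto simp: inj_on_def)

lemma nodes_disjoint: "{0, 1, 2} \<inter> (\<lambda>m. 4 * m ^ 2 :: nat) ` {1..K} = {}"
proof -
  have "4 * m ^ 2 > (2::nat)" if "m \<ge> 1" for m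
    using that one_le_power[of m 2] by linarith
  then show ?thesis by fastforce
qed

lemma card_nodes: "card (nodes K) = K + 3"
  unfolding nodes_def using nodes_disjoint[of K]
  by (subst card_Un_disjoint) (auto simp: card_image inj_nodes)

lemma nodes_le: "K \<ge> 1 \<Longrightarrow> s \<in> nodes K \<Longrightarrow> s \<le> 4 * K ^ 2"
proof -
  assume K: "K \<ge> 1" and s: "s \<in> nodes K"
  have "4 * K ^ 2 \<ge> 4" using K one_le_power[of K 2] by linarith
  then show ?thesis using s by (auto simp: nodes_def intro: power_mono)
qed

lemma sum_nodes:
  fixes f :: "nat \<Rightarrow> real"
  shows "sum f (nodes K) = f 0 + f 1 + f 2 + (\<Sum>m=1..K. f (4 * m ^ 2))"
  unfolding nodes_def using nodes_disjoint[of K]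
  by (subst sum.union_disjoint) (auto simp: sum.reindex inj_nodes)

lemma prod_nodes:
  fixes f :: "nat \<Rightarrow> real"
  assumes "I \<subseteq> {0, 1, 2}" "J \<subseteq> {1..K}"
  shows "prod f (I \<union> (\<lambda>m. 4 * m ^ 2) ` J) = prod f I * (\<Prod>m\<in>J. f (4 * m ^ 2))"
proof -
  have "finite I" "finite J" using assms by (auto intro: finite_subset)
  moreover have "I \<inter> (\<lambda>m. 4 * m ^ 2) ` J = {}" using nodes_disjoint[of K] assms by blast
  ultimately show ?thesis by (subst prod.union_disjoint) (auto simp: prod.reindex inj_nodes)
qed

lemma node_weight_moment:
  assumes "a \<le> K + 1"
  shows "(\<Sum>s\<in>nodes K. node_weight K s * real s ^ a) = 0"
proof -
  have "(\<Sum>s\<in>nodes K. poly (monom 1 a) (real s) / (\<Prod>j\<in>nodes K - {s}. real s - real j)) = 0"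
    using assms by (intro divided_difference_zero) (auto simp: card_nodes degree_monom_eq)
  then have "(\<Prod>j\<in>nodes K - {0}. real j) * (\<Prod>j\<in>nodes K - {0}. -1) *
     (\<Sum>s\<in>nodes K. real s ^ a / (\<Prod>j\<in>nodes K - {s}. real s - real j)) = 0"
    by (simp add: poly_monom)
  then show ?thesis unfolding node_weight_def sum_distrib_left by (simp add: mult_ac)
qed

lemma node_weight_0: "node_weight K 0 = 1"
proof -
  have "(\<Prod>j\<in>nodes K - {0}. real 0 - real j) = (\<Prod>j\<in>nodes K - {0}. real j * (-1))"
    by (intro prod.cong) auto
  also have "\<dots> = (\<Prod>j\<in>nodes K - {0}. real j) * (\<Prod>j\<in>nodes K - {0}. -1)"
    by (rule prod.distrib)
  moreover have "(\<Prod>j\<in>nodes K - {0}. real j) \<noteq> 0" by auto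
  ultimately show ?thesis by (simp add: node_weight_def)
qed

text \<open>The numerator is the product of the nonzero nodes, to which 1 and 2 contribute the
  factor 2.\<close>

lemma abs_node_weight:
  "\<bar>node_weight K s\<bar> = 2 * (\<Prod>m=1..K. 4 * real m ^ 2) / (\<Prod>j\<in>nodes K - {s}. \<bar>real s - real j\<bar>)"
proof -
  have *: "nodes K - {0} = {1, 2} \<union> (\<lambda>m. 4 * m ^ 2) ` {1..K}"
    using nodes_disjoint[of K] by (auto simp: nodes_def)
  have "(\<Prod>j\<in>nodes K - {0}. real j) = 2 * (\<Prod>m=1..K. 4 * real m ^ 2)"
    unfolding * by (subst prod_nodes[of _ _ K]) auto
  then show ?thesis by (simp add: node_weight_def abs_mult abs_prod prod_nonneg)
qed

lemma abs_node_weight_1: "\<bar>node_weight K 1\<bar> \<le> 4"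
proof -
  have *: "nodes K - {1} = {0, 2} \<union> (\<lambda>m. 4 * m ^ 2) ` {1..K}"
    using nodes_disjoint[of K] by (auto simp: nodes_def)
  have "(\<Prod>j\<in>nodes K - {1}. \<bar>real 1 - real j\<bar>) = (\<Prod>m=1..K. \<bar>1 - 4 * real m ^ 2\<bar>)"
    unfolding * by (subst prod_nodes[of _ _ K]) auto
  also have "\<dots> = (\<Prod>m=1..K. 4 * real m ^ 2 - 1)"
  proof (rule prod.cong)
    fix m assume "m \<in> {1..K}"
    then have "real m ^ 2 \<ge> 1" by simp
    then show "\<bar>1 - 4 * real m ^ 2\<bar> = 4 * real m ^ 2 - 1" by simp
  qed simp
  finally have "\<bar>node_weight K 1\<bar> = 2 * (\<Prod>m=1..K. 4 * real m ^ 2 / (4 * real m ^ 2 - 1))"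
    by (simp add: abs_node_weight prod_dividef)
  also have "\<dots> \<le> 2 * (2 - 1 / (real K + 1))"
    using wallis_product_le[of K] by (intro mult_left_mono) auto
  also have "\<dots> \<le> 4" by simp
  finally show ?thesis .
qed

lemma abs_node_weight_2:
  assumes "K \<ge> 1"
  shows "\<bar>node_weight K 2\<bar> \<le> 4"
proof -
  have *: "nodes K - {2} = {0, 1} \<union> (\<lambda>m. 4 * m ^ 2) ` {1..K}"
    using nodes_disjoint[of K] by (auto simp: nodes_def)
  have "(\<Prod>j\<in>nodes K - {2}. \<bar>real 2 - real j\<bar>) = 2 * (\<Prod>m=1..K. \<bar>2 - 4 * real m ^ 2\<bar>)"
    unfolding * by (subst prod_nodes[of _ _ K]) auto
  also have "(\<Prod>m=1..K. \<bar>2 - 4 * real m ^ 2\<bar>) = (\<Prod>m=1..K. 4 * real m ^ 2 - 2)"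
  proof (rule prod.cong)
    fix m assume "m \<in> {1..K}"
    then have "real m ^ 2 \<ge> 1" by simp
    then show "\<bar>2 - 4 * real m ^ 2\<bar> = 4 * real m ^ 2 - 2" by simp
  qed simp
  finally have "\<bar>node_weight K 2\<bar> = (\<Prod>m=1..K. 4 * real m ^ 2 / (4 * real m ^ 2 - 2))"
    by (simp add: abs_node_weight prod_dividef)
  also have "\<dots> \<le> 4 - 4 / (real K + 1)"
    using shifted_wallis_product_le[OF assms] .
  also have "\<dots> \<le> 4" by simp
  finally show ?thesis .
qed

text \<open>The other squares cancel up to the factor 2 of \<open>prod_square_diff_ge\<close>, and
  the distance \<open>4 * y\<close> to the node 0 cancels against the node itself. The distances to
  1 and 2 remain and give the order \<open>1 / m ^ 4\<close>.\<close>

lemma abs_node_weight_square: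
  assumes "1 \<le> m" "m \<le> K"
  shows "\<bar>node_weight K (4 * m ^ 2)\<bar> \<le> 2 / 3 / real m ^ 4"
proof -
  let ?I = "{1..K} - {m}"
  define y where "y = real m ^ 2"
  have y: "y \<ge> 1" using assms(1) by (simp add: y_def)
  define P where "P = (\<Prod>i\<in>?I. \<bar>real m ^ 2 - real i ^ 2\<bar>)"
  have P: "P > 0" unfolding P_def using assms
    by (intro prod_pos) (auto simp: power2_eq_iff)
  have *: "nodes K - {4 * m ^ 2} = {0, 1, 2} \<union> (\<lambda>m. 4 * m ^ 2) ` ?I"
  proof -
    have "4 * m ^ 2 \<in> (\<lambda>m. 4 * m ^ 2) ` {1..K}" using assms by auto
    then have "4 * m ^ 2 \<notin> {0, 1, 2}" using nodes_disjoint[of K] by (meson disjoint_iff)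
    moreover have "(\<lambda>m. 4 * m ^ 2) ` {1..K} - {4 * m ^ 2} = (\<lambda>m. 4 * m ^ 2 :: nat) ` ?I"
      by (auto simp: power2_eq_iff)
    moreover have "A - {x} = A" if "x \<notin> A" for A and x :: nat using that by blast
    ultimately show ?thesis unfolding nodes_def by (metis Un_Diff)
  qed
  have "(\<Prod>j\<in>nodes K - {4 * m ^ 2}. \<bar>real (4 * m ^ 2) - real j\<bar>) =
      4 * y * (4 * y - 1) * (4 * y - 2) * (\<Prod>i\<in>?I. 4 * \<bar>real m ^ 2 - real i ^ 2\<bar>)"
  proof -
    have my: "real (4 * m ^ 2) = 4 * y" by (simp add: y_def)
    have "\<bar>real (4 * m ^ 2) - real (4 * i ^ 2)\<bar> = 4 * \<bar>real m ^ 2 - real i ^ 2\<bar>" for i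
    proof -
      have "real (4 * m ^ 2) - real (4 * i ^ 2) = 4 * (real m ^ 2 - real i ^ 2)" by simp
      then show ?thesis by (simp only: abs_mult abs_numeral)
    qed
    moreover have "(\<Prod>j\<in>{0, 1, 2}. \<bar>real (4 * m ^ 2) - real j\<bar>) = 4 * y * (4 * y - 1) * (4 * y - 2)"
      unfolding my using y by simp
    ultimately show ?thesis unfolding * by (subst prod_nodes[of _ _ K]) auto
  qed
  also have "\<dots> = 4 ^ card ?I * P * (4 * y * (4 * y - 1) * (4 * y - 2))"
    by (simp add: P_def prod.distrib)
  finally have 1: "(\<Prod>j\<in>nodes K - {4 * m ^ 2}. \<bar>real (4 * m ^ 2) - real j\<bar>) =
      4 ^ card ?I * P * (4 * y * (4 * y - 1) * (4 * y - 2))" .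
  have "(\<Prod>i=1..K. 4 * real i ^ 2) = 4 * y * (\<Prod>i\<in>?I. 4 * real i ^ 2)"
    unfolding y_def using assms by (intro prod.remove) auto
  also have "\<dots> = 4 * y * (4 ^ card ?I * (\<Prod>i\<in>?I. real i ^ 2))"
    by (simp add: prod.distrib)
  also have "\<dots> \<le> 4 * y * (4 ^ card ?I * (2 * P))"
    unfolding P_def using y by (intro mult_left_mono prod_square_diff_ge assms) auto
  finally have 2: "(\<Prod>i=1..K. 4 * real i ^ 2) \<le> 4 * y * (4 ^ card ?I * (2 * P))" .
  have "\<bar>node_weight K (4 * m ^ 2)\<bar> \<le> 2 * (4 * y * (4 ^ card ?I * (2 * P))) /
      (4 ^ card ?I * P * (4 * y * (4 * y - 1) * (4 * y - 2)))"
    unfolding abs_node_weight 1 using 2 P y by (intro divide_right_mono mult_left_mono) auto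
  also have "\<dots> = 4 / ((4 * y - 1) * (4 * y - 2))"
  proof -
    have "2 * (4 * y * (q * (2 * P))) / (q * P * (4 * y * u * v)) = 4 / (u * v)" if "q \<noteq> 0" for q u v
      using that P y by simp
    then show ?thesis by simp
  qed
  also have "\<dots> \<le> 4 / ((3 * y) * (2 * y))"
    using y by (intro divide_left_mono mult_mono mult_pos_pos) auto
  also have "\<dots> = 2 / 3 / real m ^ 4"
    by (simp add: y_def flip: power_add)
  finally show ?thesis .
qed

lemma sum_abs_node_weight:
  assumes "K \<ge> 1"
  shows "(\<Sum>s\<in>nodes K. \<bar>node_weight K s\<bar>) \<le> 11"
    and "(\<Sum>s\<in>nodes K. \<bar>node_weight K s\<bar> * real s) \<le> 18"
proof -
  have sq: "(\<Sum>m=1..K. 1 / real m ^ 2) \<le> 2"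
    using sum_inverse_squares_le[OF assms] by (rule order.trans) simp
  have "(\<Sum>m=1..K. \<bar>node_weight K (4 * m ^ 2)\<bar>) \<le> (\<Sum>m=1..K. 2 / 3 * (1 / real m ^ 2))"
  proof (rule sum_mono)
    fix m assume m: "m \<in> {1..K}"
    then have "\<bar>node_weight K (4 * m ^ 2)\<bar> \<le> 2 / 3 / real m ^ 4"
      by (intro abs_node_weight_square) auto
    also have "\<dots> \<le> 2 / 3 / real m ^ 2"
      using m by (intro divide_left_mono power_increasing) auto
    finally show "\<bar>node_weight K (4 * m ^ 2)\<bar> \<le> 2 / 3 * (1 / real m ^ 2)" by simp
  qed
  also have "\<dots> \<le> 2 / 3 * 2"
    unfolding sum_distrib_left[symmetric] using sq by (intro mult_left_mono) auto
  \<comment> \<open>The nodes 0, 1 and 2 contribute at most 1, 4 and 4, the squares at most 4 /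
    3.\<close>
  finally show "(\<Sum>s\<in>nodes K. \<bar>node_weight K s\<bar>) \<le> 11"
    using abs_node_weight_1[of K] abs_node_weight_2[OF assms] by (simp add: sum_nodes node_weight_0)
  have "(\<Sum>m=1..K. \<bar>node_weight K (4 * m ^ 2)\<bar> * real (4 * m ^ 2)) \<le> (\<Sum>m=1..K. 8 / 3 * (1 / real m ^ 2))"
  proof (rule sum_mono)
    fix m assume m: "m \<in> {1..K}"
    then have "\<bar>node_weight K (4 * m ^ 2)\<bar> * real (4 * m ^ 2) \<le> 2 / 3 / real m ^ 4 * real (4 * m ^ 2)"
      by (intro mult_right_mono abs_node_weight_square) auto
    also have "\<dots> = 8 / 3 * (1 / real m ^ 2)"
      using m by (simp add: field_simps flip: power_add)
    finally show "\<bar>node_weight K (4 * m ^ 2)\<bar> * real (4 * m ^ 2) \<le> 8 / 3 * (1 / real m ^ 2)" .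
  qed
  also have "\<dots> \<le> 8 / 3 * 2"
    unfolding sum_distrib_left[symmetric] using sq by (intro mult_left_mono) auto
  \<comment> \<open>The nodes 0, 1 and 2 contribute at most 0, 4 and 8, the squares at most 16 /
    3.\<close>
  finally show "(\<Sum>s\<in>nodes K. \<bar>node_weight K s\<bar> * real s) \<le> 18"
    using abs_node_weight_1[of K] abs_node_weight_2[OF assms] by (simp add: sum_nodes node_weight_0)
qed

text \<open>Positive and negative part of the weights, normalized; they have the same total mass because the
  weights add up to 0.\<close>

definition or_dist :: "nat \<Rightarrow> bool \<Rightarrow> nat \<Rightarrow> real" where
  "or_dist K b t = (if t \<in> nodes K then max 0 (if b then - node_weight K t else node_weight K t) else 0) /
    (\<Sum>s\<in>nodes K. max 0 (node_weight K s))"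

lemma or_dist_nonneg: "or_dist K b t \<ge> 0"
  by (auto simp: or_dist_def intro!: divide_nonneg_nonneg sum_nonneg)

lemma sum_or_dist:
  assumes "K \<ge> 1"
  shows "(\<Sum>t\<le>4 * K ^ 2. or_dist K b t * f t) =
    (\<Sum>s\<in>nodes K. max 0 (if b then - node_weight K s else node_weight K s) * f s) /
      (\<Sum>s\<in>nodes K. max 0 (node_weight K s))"
proof -
  have "(\<Sum>t\<le>4 * K ^ 2. or_dist K b t * f t) = (\<Sum>t\<in>nodes K. or_dist K b t * f t)"
    using nodes_le[OF assms] by (intro sum.mono_neutral_right) (auto simp: or_dist_def)
  then show ?thesis by (simp add: or_dist_def sum_divide_distrib)
qed

lemma or_dist_norm_ge: "(\<Sum>s\<in>nodes K. max 0 (node_weight K s)) \<ge> 1"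
proof -
  have "max 0 (node_weight K 0) \<le> (\<Sum>s\<in>nodes K. max 0 (node_weight K s))"
    by (rule member_le_sum) (auto simp: nodes_def)
  then show ?thesis by (simp add: node_weight_0)
qed

lemma or_dist_moments_eq:
  assumes "K \<ge> 1" "a \<le> K + 1"
  shows "(\<Sum>t\<le>4 * K ^ 2. or_dist K True t * real t ^ a) = (\<Sum>t\<le>4 * K ^ 2. or_dist K False t * real t ^ a)"
proof -
  have "(\<Sum>s\<in>nodes K. max 0 (node_weight K s) * real s ^ a) - (\<Sum>s\<in>nodes K. max 0 (- node_weight K s) * real s ^ a)
    = (\<Sum>s\<in>nodes K. node_weight K s * real s ^ a)"
    unfolding sum_subtractf[symmetric] by (intro sum.cong) (auto simp: max_def)
  then show ?thesis using node_weight_moment[OF assms(2)] by (simp add: sum_or_dist[OF assms(1)])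
qed

lemma or_dist_sum_1:
  assumes "K \<ge> 1"
  shows "(\<Sum>t\<le>4 * K ^ 2. or_dist K b t) = 1"
proof -
  have "(\<Sum>t\<le>4 * K ^ 2. or_dist K False t) = 1"
    using sum_or_dist[OF assms, of False "\<lambda>_. 1"] or_dist_norm_ge[of K] by simp
  then show ?thesis using or_dist_moments_eq[OF assms, of 0] by (cases b) auto
qed

text \<open>The positive and the negative part agree in this moment and add up to the absolute
  moment, so each is half of it.\<close>

lemma or_dist_abs_moment:
  assumes "K \<ge> 1" "a \<le> K + 1"
  shows "2 * (\<Sum>s\<in>nodes K. max 0 (if b then - node_weight K s else node_weight K s) * real s ^ a) =
    (\<Sum>s\<in>nodes K. \<bar>node_weight K s\<bar> * real s ^ a)"
proof -
  have "(\<Sum>s\<in>nodes K. \<bar>node_weight K s\<bar> * real s ^ a) + (\<Sum>s\<in>nodes K. node_weight K s * real s ^ a) =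
     (\<Sum>s\<in>nodes K. 2 * (max 0 (node_weight K s) * real s ^ a))"
    unfolding sum.distrib[symmetric] by (intro sum.cong) (auto simp: max_def)
  moreover have "(\<Sum>s\<in>nodes K. \<bar>node_weight K s\<bar> * real s ^ a) - (\<Sum>s\<in>nodes K. node_weight K s * real s ^ a) =
     (\<Sum>s\<in>nodes K. 2 * (max 0 (- node_weight K s) * real s ^ a))"
    unfolding sum_subtractf[symmetric] by (intro sum.cong) (auto simp: max_def)
  ultimately show ?thesis
    using node_weight_moment[OF assms(2)] by (cases b) (simp_all flip: sum_distrib_left)
qed

lemma or_dist_mean:
  assumes "K \<ge> 1"
  shows "(\<Sum>t\<le>4 * K ^ 2. or_dist K b t * real t) \<le> 9"
proof -
  have "2 * (\<Sum>s\<in>nodes K. max 0 (if b then - node_weight K s else node_weight K s) * real s) \<le> 18"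
    using or_dist_abs_moment[OF assms, of 1 b] sum_abs_node_weight(2)[OF assms] by simp
  then have "(\<Sum>s\<in>nodes K. max 0 (if b then - node_weight K s else node_weight K s) * real s) \<le>
      9 * (\<Sum>s\<in>nodes K. max 0 (node_weight K s))"
    using or_dist_norm_ge[of K] by linarith
  then show ?thesis
    using or_dist_norm_ge[of K] by (simp add: sum_or_dist[OF assms] pos_divide_le_eq)
qed

lemma or_dist_True_0: "or_dist K True 0 = 0"
  by (simp add: or_dist_def node_weight_0)

text \<open>The mass at 0 is the reciprocal of the normalizing sum, which is at most 11 / 2.\<close>

lemma or_dist_False_0:
  assumes "K \<ge> 1"
  shows "or_dist K False 0 \<ge> 1 / 6"
proof -
  have "2 * (\<Sum>s\<in>nodes K. max 0 (node_weight K s)) \<le> 11"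
    using or_dist_abs_moment[OF assms, of 0 False] sum_abs_node_weight(1)[OF assms] by simp
  then have "1 / 6 \<le> 1 / (\<Sum>s\<in>nodes K. max 0 (node_weight K s))"
    using or_dist_norm_ge[of K] by (intro divide_left_mono) auto
  then show ?thesis by (simp add: or_dist_def node_weight_0 nodes_def)
qed


section \<open>Averaging over random counts\<close>

lemma block_index_less:
  fixes i l n r :: nat
  assumes "i < n" "l < r"
  shows "i * r + l < n * r"
proof -
  have "i * r + l < Suc i * r" using assms(2) by simp
  also have "\<dots> \<le> n * r" using assms(1) by (intro mult_le_mono1) simp
  finally show ?thesis .
qed

text \<open>Expectation of \<open>G\<close> over independent coordinates \<open>t q \<le> k\<close>
  with densities \<open>\<mu> q\<close>.\<close>

definition pexp :: "nat \<Rightarrow> nat \<Rightarrow> (nat \<Rightarrow> nat \<Rightarrow> real) \<Rightarrow> ((nat \<Rightarrow> nat) \<Rightarrow> real) \<Rightarrow> real" where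
  "pexp R k \<mu> G = (\<Sum>t\<in>{..<R} \<rightarrow>\<^sub>E {..k}. (\<Prod>q<R. \<mu> q (t q)) * G t)"

lemma pexp_add: "pexp R k \<mu> (\<lambda>t. F t + G t) = pexp R k \<mu> F + pexp R k \<mu> G"
  by (simp add: pexp_def distrib_left sum.distrib)

lemma pexp_cmult: "pexp R k \<mu> (\<lambda>t. c * F t) = c * pexp R k \<mu> F"
  by (simp add: pexp_def sum_distrib_left mult_ac)

lemma pexp_sum: "pexp R k \<mu> (\<lambda>t. \<Sum>a\<in>A. F a t) = (\<Sum>a\<in>A. pexp R k \<mu> (F a))"
  unfolding pexp_def sum_distrib_left by (rule sum.swap)

lemma pexp_prod:
  "pexp R k \<mu> (\<lambda>t. \<Prod>q<R. \<phi> q (t q)) = (\<Prod>q<R. \<Sum>v\<le>k. \<mu> q v * \<phi> q v)"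
  unfolding pexp_def by (subst prod_sum_PiE) (auto simp: prod.distrib)

lemma pexp_const:
  assumes "\<And>q. q < R \<Longrightarrow> (\<Sum>v\<le>k. \<mu> q v) = 1"
  shows "pexp R k \<mu> (\<lambda>t. c) = c"
  using pexp_cmult[of R k \<mu> c "\<lambda>t. 1"] pexp_prod[of R k \<mu> "\<lambda>q v. 1"] assms by simp

text \<open>Comparing only on the support lets \<open>or_dist_True_0\<close> exclude zero counts for
  true bits.\<close>

lemma pexp_mono:
  assumes "\<And>q v. \<mu> q v \<ge> 0"
    and "\<And>t. t \<in> {..<R} \<rightarrow>\<^sub>E {..k} \<Longrightarrow> (\<And>q. q < R \<Longrightarrow> \<mu> q (t q) \<noteq> 0) \<Longrightarrow> F t \<le> G t"
  shows "pexp R k \<mu> F \<le> pexp R k \<mu> G"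
  unfolding pexp_def
proof (rule sum_mono)
  fix t assume t: "t \<in> {..<R} \<rightarrow>\<^sub>E {..k}"
  show "(\<Prod>q<R. \<mu> q (t q)) * F t \<le> (\<Prod>q<R. \<mu> q (t q)) * G t"
  proof (cases "\<exists>q<R. \<mu> q (t q) = 0")
    case True
    then have zero: "(\<Prod>q<R. \<mu> q (t q)) = 0" by (intro prod_zero) auto
    show ?thesis unfolding zero by simp
  next
    case False
    then show ?thesis using assms t by (intro mult_left_mono prod_nonneg) auto
  qed
qed

lemma pexp_close:
  assumes "\<And>q v. \<mu> q v \<ge> 0" "\<And>q. q < R \<Longrightarrow> (\<Sum>v\<le>k. \<mu> q v) = 1"
    and "\<And>t. t \<in> {..<R} \<rightarrow>\<^sub>E {..k} \<Longrightarrow> (\<And>q. q < R \<Longrightarrow> \<mu> q (t q) \<noteq> 0) \<Longrightarrow> \<bar>F t - c\<bar> \<le> G t"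
  shows "\<bar>pexp R k \<mu> F - c\<bar> \<le> pexp R k \<mu> G"
proof -
  have "F t + (-1) * c \<le> G t \<and> (-1) * F t + c \<le> G t"
    if "t \<in> {..<R} \<rightarrow>\<^sub>E {..k}" "\<And>q. q < R \<Longrightarrow> \<mu> q (t q) \<noteq> 0" for t
    using assms(3)[OF that] by (auto simp: abs_le_iff)
  then have "pexp R k \<mu> (\<lambda>t. F t + (-1) * c) \<le> pexp R k \<mu> G"
    "pexp R k \<mu> (\<lambda>t. (-1) * F t + c) \<le> pexp R k \<mu> G"
    by (auto intro!: pexp_mono assms(1))
  then show ?thesis
    unfolding pexp_add pexp_cmult using pexp_const[of R \<mu> k c, OF assms(2)] by (simp add: abs_le_iff)
qed

text \<open>By independence the expectation of a monomial is a product of moments. Those of order up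
  to \<open>K + 1\<close> agree for both distributions and are constant in \<open>x\<close>. A
  monomial of degree \<open>D\<close> has at most \<open>D div (K + 2)\<close> variables of higher
  order, and each contributes one affine factor.\<close>

lemma pexp_polyfun:
  assumes K: "K \<ge> 1" and Q: "polyfun {..<n * r} D Q"
  shows "\<exists>G. polyfun {..<n} (D div (K + 2)) G \<and> (\<forall>x\<in>cube n. G x =
    pexp (n * r) (4 * K ^ 2) (\<lambda>q. or_dist K (x (q div r) = -1)) (\<lambda>t. Q (\<lambda>q. real (t q))))"
  using Q
proof (induction rule: polyfun_monomial_induct)
  case (monomial c xs)
  define m where "m = (\<lambda>b a. \<Sum>v\<le>4 * K ^ 2. or_dist K b v * real v ^ a)"
  have m_eq: "m True a = m False a" if "a \<le> K + 1" for a
    unfolding m_def by (rule or_dist_moments_eq[OF K that])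
  define a where "a = count_list xs"
  have suma: "(\<Sum>q<n * r. a q) = length xs"
    unfolding a_def using monomial by (intro sum_count_set) auto
  \<comment> \<open>The affine factor is \<open>m False\<close> at the input value 1 and
    \<open>m True\<close> at -1.\<close>
  define G where "G = (\<lambda>x. c * (\<Prod>q<n * r.
      if a q \<le> K + 1 then m True (a q)
      else (m False (a q) + m True (a q)) / 2 + (m False (a q) - m True (a q)) / 2 * x (q div r)))"
  have "polyfun {..<n} (\<Sum>q<n * r. if a q \<le> K + 1 then 0 else Suc 0) G"
    unfolding G_def
  proof (intro polyfun_cmult polyfun_prod)
    fix q assume "q \<in> {..<n * r}"
    then have "q div r < n" by (simp add: less_mult_imp_div_less)
    then show "polyfun {..<n} (if a q \<le> K + 1 then 0 else Suc 0) (\<lambda>x. if a q \<le> K + 1 then m True (a q)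
      else (m False (a q) + m True (a q)) / 2 + (m False (a q) - m True (a q)) / 2 * x (q div r))"
      by (cases "a q \<le> K + 1")
        (auto simp del: times_divide_eq_left intro!: polyfun.const polyfun.add polyfun_cmult polyfun_var)
  qed
  moreover have "(\<Sum>q<n * r. if a q \<le> K + 1 then 0 else Suc 0) \<le> D div (K + 2)"
  proof -
    have "(K + 2) * (\<Sum>q<n * r. if a q \<le> K + 1 then 0 else Suc 0) \<le> (\<Sum>q<n * r. a q)"
      unfolding sum_distrib_left by (intro sum_mono) auto
    then show ?thesis using suma monomial(2) by (simp add: less_eq_div_iff_mult_less_eq mult.commute)
  qed
  ultimately have "polyfun {..<n} (D div (K + 2)) G" by (rule polyfun_mono)
  moreover have "G x = pexp (n * r) (4 * K ^ 2) (\<lambda>q. or_dist K (x (q div r) = -1))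
      (\<lambda>t. c * prod_list (map (\<lambda>q. real (t q)) xs))" if x: "x \<in> cube n" for x
  proof -
    have "pexp (n * r) (4 * K ^ 2) (\<lambda>q. or_dist K (x (q div r) = -1)) (\<lambda>t. prod_list (map (\<lambda>q. real (t q)) xs))
      = (\<Prod>q<n * r. m (x (q div r) = -1) (a q))"
      unfolding m_def using pexp_prod[of "n * r" "4 * K ^ 2" "\<lambda>q. or_dist K (x (q div r) = -1)" "\<lambda>q v. real v ^ a q"] monomial
      by (simp add: prod_list_count_list[of "{..<n * r}"] a_def)
    also have "\<dots> = (\<Prod>q<n * r. if a q \<le> K + 1 then m True (a q)
      else (m False (a q) + m True (a q)) / 2 + (m False (a q) - m True (a q)) / 2 * x (q div r))"
    proof (rule prod.cong)
      fix q assume "q \<in> {..<n * r}"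
      then have "q div r < n" by (simp add: less_mult_imp_div_less)
      then have "x (q div r) = 1 \<or> x (q div r) = -1" using cube_cases x by blast
      then show "m (x (q div r) = -1) (a q) = (if a q \<le> K + 1 then m True (a q)
        else (m False (a q) + m True (a q)) / 2 + (m False (a q) - m True (a q)) / 2 * x (q div r))"
        using m_eq[of "a q"] by (auto simp: field_simps)
    qed simp
    finally show ?thesis by (simp add: G_def pexp_cmult)
  qed
  ultimately show ?case by blast
next
  case (add F F')
  then obtain G G' where "polyfun {..<n} (D div (K + 2)) G" "polyfun {..<n} (D div (K + 2)) G'"
    "\<forall>x\<in>cube n. G x =
      pexp (n * r) (4 * K ^ 2) (\<lambda>q. or_dist K (x (q div r) = -1)) (\<lambda>t. F (\<lambda>q. real (t q)))"
    "\<forall>x\<in>cube n. G' x =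
      pexp (n * r) (4 * K ^ 2) (\<lambda>q. or_dist K (x (q div r) = -1)) (\<lambda>t. F' (\<lambda>q. real (t q)))"
    by blast
  then show ?case
    by (intro exI[of _ "\<lambda>x. G x + G' x"]) (auto simp: pexp_add intro: polyfun.add)
qed

section \<open>Approximating \<open>f\<close> by the averaged polynomial\<close>

definition gadget :: "nat \<Rightarrow> nat \<Rightarrow> (nat \<Rightarrow> bool) \<Rightarrow> nat \<Rightarrow> real" where
  "gadget n r P = (\<lambda>i\<in>{..<n}. of_truth (\<forall>l<r. P (i * r + l)))"

text \<open>The restriction to \<open>{..<n}\<close> in \<open>gadget\<close> is needed here because
  points of the cube are extensional functions.\<close>

lemma gadget_in_cube: "gadget n r P \<in> cube n"
  by (auto simp: gadget_def cube_def of_truth_def)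

lemma boolean_abs: "boolean_function n f \<Longrightarrow> x \<in> cube n \<Longrightarrow> f x = 1 \<or> f x = -1"
  unfolding boolean_function_def by (auto simp: Pi_iff)

text \<open>On \<open>[0, 1]\<close>, \<open>exp y \<le> 1 + y + y ^ 2 \<le> 1 + 2 * y\<close>, so
  the mean, which is at most 9, controls the exponential moment. The scale \<open>4 * K ^ 2\<close>
  bounds all counts and brings them into this interval.\<close>

lemma or_dist_exp:
  assumes "K \<ge> 1"
  shows "(\<Sum>v\<le>4 * K ^ 2. or_dist K b v * exp (real v / real (4 * K ^ 2))) \<le> exp (18 / real (4 * K ^ 2))"
proof -
  let ?k = "real (4 * K ^ 2)"
  have k: "?k > 0" using assms by simp
  have "(\<Sum>v\<le>4 * K ^ 2. or_dist K b v * exp (real v / ?k)) \<le>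
      (\<Sum>v\<le>4 * K ^ 2. or_dist K b v * (1 + 2 * (real v / ?k)))"
  proof (intro sum_mono mult_left_mono or_dist_nonneg)
    fix v assume "v \<in> {..4 * K ^ 2}"
    then have "real v \<le> ?k" by (simp only: atMost_iff of_nat_le_iff)
    then have x: "0 \<le> real v / ?k" "real v / ?k \<le> 1" using k by (auto simp only: divide_le_eq_1 zero_le_divide_iff of_nat_0_le_iff)
    then have "exp (real v / ?k) \<le> 1 + real v / ?k + (real v / ?k) ^ 2" by (rule exp_bound)
    also have "(real v / ?k) ^ 2 \<le> real v / ?k"
      using mult_left_mono[OF x(2) x(1)] by (simp only: power2_eq_square mult_1_right)
    finally show "exp (real v / ?k) \<le> 1 + 2 * (real v / ?k)" by simp
  qed
  also have "\<dots> = (\<Sum>v\<le>4 * K ^ 2. or_dist K b v) + 2 / ?k * (\<Sum>v\<le>4 * K ^ 2. or_dist K b v * real v)"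
    by (simp add: distrib_left sum.distrib sum_distrib_left mult_ac)
  also have "\<dots> \<le> 1 + 2 / ?k * 9"
    using or_dist_mean[OF assms, of b] or_dist_sum_1[OF assms, of b]
    by (intro add_mono mult_left_mono) auto
  also have "\<dots> \<le> exp (18 / ?k)" using exp_ge_add_one_self[of "18 / ?k"] by simp
  finally show ?thesis .
qed

lemma or_dist_positive_prob:
  assumes "K \<ge> 1"
  shows "(\<Sum>v\<le>4 * K ^ 2. or_dist K False v * of_bool (v > 0)) \<le> 5 / 6"
proof -
  have "(\<Sum>v\<le>4 * K ^ 2. or_dist K False v) = or_dist K False 0 + (\<Sum>v\<in>{..4 * K ^ 2} - {0}. or_dist K False v)"
    by (intro sum.remove) auto
  moreover have "(\<Sum>v\<in>{..4 * K ^ 2} - {0}. or_dist K False v) =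
      (\<Sum>v\<le>4 * K ^ 2. or_dist K False v * of_bool (v > 0))"
    by (intro sum.mono_neutral_cong_left) auto
  ultimately show ?thesis using or_dist_sum_1[OF assms, of False] or_dist_False_0[OF assms] by linarith
qed

text \<open>The approximation of \<open>f\<close> is the expectation of \<open>Q\<close> under
  \<open>or_dist\<close>. Its error has three sources: \<open>near\<close> for bags with at most
  \<open>N\<close> items, \<open>noise\<close> for blocks that read true at a false bit, and
  \<open>tail\<close> for larger bags.\<close>

lemma approx_degree_transfer:
  fixes n r K D N :: nat
  defines "k \<equiv> real (4 * K ^ 2)"
  assumes K: "K \<ge> 1" and f: "boolean_function n f" and Q: "polyfun {..<n * r} D Q"
    and near: "\<And>t :: nat \<Rightarrow> nat. sum t {..<n * r} \<le> N \<Longrightarrow>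
      \<bar>Q (\<lambda>q. real (t q)) - f (gadget n r (\<lambda>q. t q > 0))\<bar> \<le> 1 / 5"
    and far: "\<And>t :: nat \<Rightarrow> nat. \<exists>h. degree h \<le> D \<and> poly h (real (sum t {..<n * r})) = Q (\<lambda>q. real (t q)) \<and>
      (\<forall>s. s \<le> N \<and> s \<le> sum t {..<n * r} \<longrightarrow> \<bar>poly h (real s)\<bar> \<le> 6 / 5)"
    and DN: "D * (4 * K ^ 2) \<le> N"
    and noise: "2 * real n * (5 / 6) ^ r \<le> 1 / 32"
    and tail: "4 ^ D * exp (18 * real (n * r) / k) * exp (- real N / (2 * k)) \<le> 1 / 25"
  shows "approx_degree n f \<le> D div (K + 2)"
proof -
  let ?R = "n * r"
  obtain G where G: "polyfun {..<n} (D div (K + 2)) G"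
    "\<And>x. x \<in> cube n \<Longrightarrow> G x = pexp ?R (4 * K ^ 2) (\<lambda>q. or_dist K (x (q div r) = -1)) (\<lambda>t. Q (\<lambda>q. real (t q)))"
    using pexp_polyfun[OF K Q] by blast
  have k: "k > 0" using K by (simp add: k_def)
  have "\<bar>G x - f x\<bar> \<le> 1 / 3" if x: "x \<in> cube n" for x
  proof -
    define \<mu> where "\<mu> = (\<lambda>q. or_dist K (x (q div r) = -1))"
    \<comment> \<open>11 / 5 adds the bound 6 / 5 on the samples of \<open>h\<close> and the bound 1
      on \<open>f x\<close>.\<close>
    define B where "B = 11 / 5 * 4 ^ D * exp (- real N / (2 * k))"
    \<comment> \<open>Block \<open>i\<close> reads true although the bit is false. The opposite
      error has probability 0.\<close>
    define bad where "bad = (\<lambda>i t. of_bool (x i = 1 \<and> (\<forall>l<r. t (i * r + l) > (0::nat))) :: real)"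
    have "\<bar>pexp ?R (4 * K ^ 2) \<mu> (\<lambda>t. Q (\<lambda>q. real (t q))) - f x\<bar> \<le>
      pexp ?R (4 * K ^ 2) \<mu> (\<lambda>t. (1 / 5 + 2 * (\<Sum>i<n. bad i t)) + B * (\<Prod>q<?R. exp (real (t q) / k)))"
    proof (rule pexp_close)
      show "\<mu> q v \<ge> 0" for q v by (simp add: \<mu>_def or_dist_nonneg)
      show "(\<Sum>v\<le>4 * K ^ 2. \<mu> q v) = 1" for q by (simp add: \<mu>_def or_dist_sum_1[OF K])
      fix t assume t: "\<And>q. q < ?R \<Longrightarrow> \<mu> q (t q) \<noteq> 0"
      define S where "S = sum t {..<?R}"
      have expS: "(\<Prod>q<?R. exp (real (t q) / k)) = exp (real S / k)"
        by (simp add: S_def exp_sum sum_divide_distrib)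
      have bad0: "(\<Sum>i<n. bad i t) \<ge> 0" unfolding bad_def by (intro sum_nonneg) auto
      have B0: "B \<ge> 0" by (simp add: B_def)
      show "\<bar>Q (\<lambda>q. real (t q)) - f x\<bar> \<le>
        (1 / 5 + 2 * (\<Sum>i<n. bad i t)) + B * (\<Prod>q<?R. exp (real (t q) / k))"
      proof (cases "S \<le> N")
        case True
        let ?y = "gadget n r (\<lambda>q. t q > 0)"
        have 1: "\<bar>Q (\<lambda>q. real (t q)) - f ?y\<bar> \<le> 1 / 5" using near[of t] True by (simp add: S_def)
        have 2: "\<bar>f ?y - f x\<bar> \<le> 2 * (\<Sum>i<n. bad i t)"
        proof (cases "?y = x")
          case True
          then show ?thesis using bad0 by simp
        next
          case False
          have "\<exists>i<n. bad i t = 1"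
          proof (rule ccontr)
            assume none: "\<not> ?thesis"
            have "?y i = x i" if i: "i < n" for i
            proof (cases "x i = -1")
              case True
              have "t (i * r + l) > 0" if l: "l < r" for l
              proof (rule ccontr)
                assume "\<not> ?thesis"
                moreover have "i * r + l < ?R"
                  using block_index_less i l .
                ultimately show False using t[of "i * r + l"] l True by (simp add: \<mu>_def or_dist_True_0)
              qed
              then show ?thesis using True i by (simp add: gadget_def of_truth_def)
            next
              case False
              then have "x i = 1" using cube_cases[OF x i] by simp
              then have "\<not> (\<forall>l<r. t (i * r + l) > 0)" using none i by (auto simp: bad_def)
              then show ?thesis using \<open>x i = 1\<close> i by (simp add: gadget_def of_truth_def)
            qed
            then have "?y = x" using x gadget_in_cube[of n r "\<lambda>q. t q > 0"]
              unfolding cube_def by (intro PiE_ext[of _ "{..<n}" "\<lambda>_. {-1, 1}"]) auto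
            with False show False by simp
          qed
          then obtain i where "i < n" "bad i t = 1" by blast
          then have "1 \<le> (\<Sum>i<n. bad i t)"
            using member_le_sum[of i "{..<n}" "\<lambda>i. bad i t"] by (auto simp: bad_def)
          moreover have "\<bar>f ?y - f x\<bar> \<le> 2"
            using boolean_abs[OF f x] boolean_abs[OF f gadget_in_cube[of n r "\<lambda>q. t q > 0"]] by auto
          ultimately show ?thesis by linarith
        qed
        have "B * (\<Prod>q<?R. exp (real (t q) / k)) \<ge> 0" using B0 by (simp add: prod_nonneg)
        with 1 2 show ?thesis by linarith
      next
        case False
        obtain h where h: "degree h \<le> D" "poly h (real S) = Q (\<lambda>q. real (t q))"
          "\<And>s. s \<le> N \<Longrightarrow> s \<le> S \<Longrightarrow> \<bar>poly h (real s)\<bar> \<le> 6 / 5"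
          using far[of t] unfolding S_def by blast
        \<comment> \<open>By \<open>DN\<close> the interpolation nodes
          \<open>j * (4 * K ^ 2)\<close> with \<open>j \<le> D\<close> are admissible sample sizes,
          at which \<open>h\<close> is bounded.\<close>
        have "\<bar>poly h (real S)\<bar> \<le> 6 / 5 * 4 ^ D * exp (real S / (2 * k))"
        proof (rule poly_growth[OF h(1) k])
          fix j assume "j \<le> D"
          then have "j * (4 * K ^ 2) \<le> N" using DN mult_le_mono1[of j D "4 * K ^ 2"] by linarith
          then have "\<bar>poly h (real (j * (4 * K ^ 2)))\<bar> \<le> 6 / 5" using False by (intro h(3)) auto
          then show "\<bar>poly h (real j * k)\<bar> \<le> 6 / 5" unfolding k_def by (simp only: of_nat_mult)
        next
          have "real (D * (4 * K ^ 2)) \<le> real S" using DN False by (simp only: of_nat_le_iff)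
          then show "real D * k \<le> real S" unfolding k_def by (simp only: of_nat_mult)
        qed
        moreover have "\<bar>f x\<bar> \<le> 4 ^ D * exp (real S / (2 * k))"
        proof -
          have "(1::real) * 1 \<le> 4 ^ D * exp (real S / (2 * k))"
            using k by (intro mult_mono) auto
          then show ?thesis using boolean_abs[OF f x] by auto
        qed
        ultimately have "\<bar>Q (\<lambda>q. real (t q)) - f x\<bar> \<le> 11 / 5 * 4 ^ D * exp (real S / (2 * k))"
          unfolding h(2) by linarith
        \<comment> \<open>A Chernoff bound: for \<open>S > N\<close> the extra factor
          \<open>exp ((S - N) / (2 * k))\<close> is at least 1. The resulting
          \<open>exp (S / k)\<close> is a product over the coordinates, so its expectation
          factorizes.\<close>
        also have "\<dots> \<le> 11 / 5 * 4 ^ D * exp (- real N / (2 * k) + real S / k)"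
        proof -
          have "real N / (2 * k) \<le> real S / (2 * k)"
            using False k by (intro divide_right_mono) auto
          moreover have "real S / k = real S / (2 * k) + real S / (2 * k)" by simp
          ultimately have "real S / (2 * k) \<le> - real N / (2 * k) + real S / k" by simp
          then show ?thesis by (intro mult_left_mono) auto
        qed
        also have "\<dots> = B * exp (real S / k)" by (simp only: B_def exp_add mult.assoc)
        finally show ?thesis unfolding expS using bad0 by linarith
      qed
    qed
    also have "\<dots> = 1 / 5 + 2 * (\<Sum>i<n. pexp ?R (4 * K ^ 2) \<mu> (bad i)) +
        B * (\<Prod>q<?R. \<Sum>v\<le>4 * K ^ 2. \<mu> q v * exp (real v / k))"
      unfolding pexp_add pexp_cmult pexp_sum pexp_prod[of _ _ _ "\<lambda>q v. exp (real v / k)"]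
      by (subst pexp_const) (simp_all add: \<mu>_def or_dist_sum_1[OF K])
    also have "\<dots> \<le> 1 / 5 + 2 * (\<Sum>i<n. (5 / 6) ^ r) + B * (\<Prod>q<?R. exp (18 / k))"
    proof (intro add_mono mult_left_mono sum_mono order.refl prod_mono conjI)
      fix i assume "i \<in> {..<n}"
      then have i: "i < n" by simp
      show "pexp ?R (4 * K ^ 2) \<mu> (bad i) \<le> (5 / 6) ^ r"
      proof (cases "x i = 1")
        case False
        then have "bad i = (\<lambda>t. 0 * 0)" by (auto simp: bad_def)
        then show ?thesis using pexp_cmult[of _ _ _ 0] by simp
      next
        case True
        \<comment> \<open>The bad event in product form, for \<open>pexp_prod\<close>; only the
          coordinates of block \<open>i\<close> are constrained.\<close>
        define \<phi> where "\<phi> = (\<lambda>q v. if q div r = i then of_bool (v > (0::nat)) else 1 :: real)"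
        define J where "J = {i * r..<i * r + r}"
        have J: "J \<subseteq> {..<?R}"
        proof -
          have "i * r + r \<le> n * r" using i by (metis Suc_leI add.commute mult_Suc mult_le_mono1)
          then show ?thesis by (auto simp: J_def)
        qed
        have div: "q div r = i \<longleftrightarrow> q \<in> J" if "q < ?R" for q
        proof -
          have "r > 0" using that by (cases r) auto
          then have "i * r \<le> q \<and> q < i * r + r" if "q div r = i"
          proof -
            have "i * r + q mod r = q" using div_mult_mod_eq[of q r] that by simp
            with mod_less_divisor[OF \<open>r > 0\<close>, of q] show ?thesis by (intro conjI; linarith)
          qed
          moreover have "q div r = i" if "i * r \<le> q" "q < i * r + r"
            using that by (intro div_nat_eqI) (simp_all add: mult.commute)
          ultimately show ?thesis by (auto simp: J_def)
        qed
        have "pexp ?R (4 * K ^ 2) \<mu> (bad i) \<le> pexp ?R (4 * K ^ 2) \<mu> (\<lambda>t. \<Prod>q<?R. \<phi> q (t q))"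
        proof (rule pexp_mono)
          fix t :: "nat \<Rightarrow> nat"
          have "\<phi> q (t q) = 1" if "q < ?R" "\<forall>l<r. t (i * r + l) > 0" for q
          proof -
            have "t q > 0" if "q \<in> J" using that \<open>\<forall>l<r. t (i * r + l) > 0\<close>[rule_format, of "q - i * r"]
              by (auto simp: J_def)
            then show ?thesis using div[OF that(1)] by (auto simp: \<phi>_def)
          qed
          then have "(\<Prod>q<?R. \<phi> q (t q)) = 1" if "\<forall>l<r. t (i * r + l) > 0" using that by simp
          moreover have "(\<Prod>q<?R. \<phi> q (t q)) \<ge> 0" by (intro prod_nonneg) (auto simp: \<phi>_def)
          ultimately show "bad i t \<le> (\<Prod>q<?R. \<phi> q (t q))" by (auto simp: bad_def)
        qed (simp add: \<mu>_def or_dist_nonneg)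
        also have "\<dots> = (\<Prod>q<?R. \<Sum>v\<le>4 * K ^ 2. \<mu> q v * \<phi> q v)" by (rule pexp_prod)
        also have "\<dots> \<le> (\<Prod>q<?R. if q \<in> J then 5 / 6 else 1)"
        proof (intro prod_mono conjI)
          fix q assume "q \<in> {..<?R}"
          then have q: "q < ?R" by simp
          show "0 \<le> (\<Sum>v\<le>4 * K ^ 2. \<mu> q v * \<phi> q v)"
            by (intro sum_nonneg mult_nonneg_nonneg) (auto simp: \<mu>_def \<phi>_def or_dist_nonneg)
          show "(\<Sum>v\<le>4 * K ^ 2. \<mu> q v * \<phi> q v) \<le> (if q \<in> J then 5 / 6 else 1)"
            using div[OF q] True or_dist_positive_prob[OF K] or_dist_sum_1[OF K]
            by (auto simp: \<mu>_def \<phi>_def)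
        qed
        also have "\<dots> = (\<Prod>q\<in>J. 5 / 6)"
          using J by (simp add: prod.If_cases Int_absorb1)
        also have "\<dots> = (5 / 6) ^ r" by (simp add: J_def)
        finally show ?thesis .
      qed
    next
      fix q
      show "0 \<le> (\<Sum>v\<le>4 * K ^ 2. \<mu> q v * exp (real v / k))"
        by (intro sum_nonneg mult_nonneg_nonneg) (auto simp: \<mu>_def or_dist_nonneg)
      show "(\<Sum>v\<le>4 * K ^ 2. \<mu> q v * exp (real v / k)) \<le> exp (18 / k)"
        unfolding \<mu>_def k_def by (rule or_dist_exp[OF K])
    qed (auto simp: B_def)
    also have "\<dots> = 1 / 5 + 2 * real n * (5 / 6) ^ r +
        11 / 5 * (4 ^ D * exp (18 * real ?R / k) * exp (- real N / (2 * k)))"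
    proof -
      have "(\<Prod>q<?R. exp (18 / k)) = exp (18 * real ?R / k)"
        by (simp add: mult.commute flip: exp_of_nat_mult)
      then show ?thesis by (simp add: B_def)
    qed
    \<comment> \<open>The three errors are at most 1 / 5, 1 / 32 and 11 / 125.\<close>
    also have "\<dots> \<le> 1 / 3" using noise tail by linarith
    finally show ?thesis using G(2)[OF x] by (simp add: \<mu>_def)
  qed
  then show ?thesis using G(1) by (rule approx_degree_le[rotated])
qed


section \<open>The lifted function\<close>

text \<open>Entry \<open>j\<close> of the list occupies \<open>2 b\<close> variables: two for each digit \<open>\<beta>\<close>, one for each value of the digit.
  The entry is \<open>q\<close> if the variables that agree with the digits of \<open>q\<close> are true.\<close>

definition bit_var :: "nat \<Rightarrow> nat \<Rightarrow> nat \<Rightarrow> bool \<Rightarrow> nat" where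
  "bit_var b j \<beta> v = j * (2 * b) + (2 * \<beta> + of_bool v)"

text \<open>Only the truth of variables is tested, which keeps the condition monotone. An entry in
  which both variables of a digit are true may count as several numbers.\<close>

definition listed :: "nat \<Rightarrow> nat \<Rightarrow> (nat \<Rightarrow> real) \<Rightarrow> nat \<Rightarrow> bool" where
  "listed N b u q \<longleftrightarrow> (\<exists>j<N. \<forall>\<beta><b. u (bit_var b j \<beta> (bit q \<beta>)) = -1)"

definition lifted :: "nat \<Rightarrow> nat \<Rightarrow> nat \<Rightarrow> nat \<Rightarrow> ((nat \<Rightarrow> real) \<Rightarrow> real) \<Rightarrow> (nat \<Rightarrow> real) \<Rightarrow> real" where
  "lifted n r N b f u = f (gadget n r (listed N b u))"

lemma boolean_lifted:
  assumes "boolean_function n f"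
  shows "boolean_function m (lifted n r N b f)"
  using boolean_abs[OF assms gadget_in_cube] unfolding boolean_function_def lifted_def by blast

lemma bit_var_less: "j < N \<Longrightarrow> \<beta> < b \<Longrightarrow> bit_var b j \<beta> v < N * (2 * b)"
  unfolding bit_var_def by (rule block_index_less) auto

lemma bit_var_inverse:
  assumes "\<beta> < b"
  shows "bit_var b j \<beta> v div (2 * b) = j" "bit_var b j \<beta> v mod (2 * b) div 2 = \<beta>" "odd (bit_var b j \<beta> v) = v"
proof -
  have "2 * \<beta> + of_bool v < 2 * b" using assms by auto
  then show "bit_var b j \<beta> v div (2 * b) = j" "bit_var b j \<beta> v mod (2 * b) div 2 = \<beta>"
    using assms by (auto simp: bit_var_def)
qed (simp add: bit_var_def)

text \<open>Variable \<open>a\<close> of the encoding as a linear function of the indicators \<open>y (j, i)\<close> of "entry \<open>j\<close> is \<open>i\<close>".\<close>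

definition code_bit :: "nat \<Rightarrow> nat \<Rightarrow> nat \<Rightarrow> (nat \<times> nat \<Rightarrow> real) \<Rightarrow> real" where
  "code_bit R b a y = 1 - 2 * (\<Sum>i\<in>{i. i < R \<and> bit i (a mod (2 * b) div 2) = odd a}. y (a div (2 * b), i))"

lemma polyfun_code_bit:
  assumes "a < N * (2 * b)"
  shows "polyfun ({..<N} \<times> {..<R}) (Suc 0) (code_bit R b a)"
proof -
  have "a div (2 * b) < N" using assms by (simp add: less_mult_imp_div_less)
  then show ?thesis unfolding code_bit_def
    by (intro polyfun_diff polyfun.const polyfun_cmult polyfun_sum polyfun_var) auto
qed

text \<open>A position holds at most one number, so the sum of its indicators is 0 or 1.\<close>

lemma code_bit_list:
  "code_bit R b a (\<lambda>(j, i). of_bool (l ! j = Some i)) =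
    of_truth (\<exists>i<R. bit i (a mod (2 * b) div 2) = odd a \<and> l ! (a div (2 * b)) = Some i)"
proof -
  let ?I = "{i. i < R \<and> bit i (a mod (2 * b) div 2) = odd a}"
  have "(\<Sum>i\<in>?I. of_bool (l ! (a div (2 * b)) = Some i)) =
      (of_bool (\<exists>i\<in>?I. l ! (a div (2 * b)) = Some i) :: real)"
  proof (cases "\<exists>i\<in>?I. l ! (a div (2 * b)) = Some i")
    case True
    then obtain k where k: "k \<in> ?I" "l ! (a div (2 * b)) = Some k" by blast
    then have "(\<Sum>i\<in>?I. of_bool (l ! (a div (2 * b)) = Some i)) = (\<Sum>i\<in>?I. if i = k then 1 else 0 :: real)"
      by (intro sum.cong) auto
    with k show ?thesis by auto
  next
    case False
    then have "(\<Sum>i\<in>?I. of_bool (l ! (a div (2 * b)) = Some i)) = (\<Sum>i\<in>?I. 0 :: real)"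
      by (intro sum.cong) auto
    with False show ?thesis by auto
  qed
  then show ?thesis by (auto simp: code_bit_def of_truth_def)
qed

lemma bits_eq_imp_eq:
  fixes p q :: nat
  assumes "p < 2 ^ b" "q < 2 ^ b" "\<And>\<beta>. \<beta> < b \<Longrightarrow> bit p \<beta> = bit q \<beta>"
  shows "p = q"
proof -
  have "take_bit b p = take_bit b q"
    using assms(3) by (intro bit_eqI) (auto simp: bit_take_bit_iff)
  then show ?thesis using assms(1,2) by (simp add: take_bit_nat_eq_self)
qed

text \<open>The encoding is faithful because numbers below \<open>2 ^ b\<close> are determined by
  their digits and an empty position has all its variables false.\<close>

lemma lifted_code:
  assumes "b \<ge> 1" "n * r \<le> 2 ^ b" "length l = N" "\<And>i. Some i \<in> set l \<Longrightarrow> i < n * r"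
  defines "u \<equiv> (\<lambda>a\<in>{..<N * (2 * b)}. code_bit (n * r) b a (\<lambda>(j, i). of_bool (l ! j = Some i)))"
  shows "u \<in> cube (N * (2 * b))" "lifted n r N b f u = f (gadget n r (\<lambda>q. Some q \<in> set l))"
proof -
  show "u \<in> cube (N * (2 * b))"
    by (auto simp: u_def cube_def code_bit_list of_truth_def)
  have "listed N b u q \<longleftrightarrow> Some q \<in> set l" if q: "q < n * r" for q
  proof -
    have u: "u (bit_var b j \<beta> (bit q \<beta>)) = -1 \<longleftrightarrow> (\<exists>i<n * r. bit i \<beta> = bit q \<beta> \<and> l ! j = Some i)"
      if "j < N" "\<beta> < b" for j \<beta>
      using bit_var_less[OF that] that bit_var_inverse[of \<beta> b]
      by (simp add: u_def code_bit_list of_truth_def)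
    have "(\<forall>\<beta><b. u (bit_var b j \<beta> (bit q \<beta>)) = -1) \<longleftrightarrow> l ! j = Some q" if j: "j < N" for j
    proof
      assume *: "\<forall>\<beta><b. u (bit_var b j \<beta> (bit q \<beta>)) = -1"
      \<comment> \<open>\<open>b \<ge> 1\<close> provides digit 0, which shows that the position is
        not empty; without digits the condition would hold vacuously.\<close>
      then obtain i where i: "i < n * r" "l ! j = Some i" using u[OF j, of 0] assms(1) by auto
      have "bit i \<beta> = bit q \<beta>" if "\<beta> < b" for \<beta> using * u[OF j that] that i by auto
      then have "i = q" using i q assms(2) by (intro bits_eq_imp_eq[of i b q]) auto
      with i show "l ! j = Some q" by simp
    qed (use u j q in auto)
    then show ?thesis unfolding listed_def using assms(3) by (auto simp: in_set_conv_nth)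
  qed
  then have "gadget n r (listed N b u) = gadget n r (\<lambda>q. Some q \<in> set l)"
    using block_index_less unfolding gadget_def
    by (intro restrict_ext arg_cong[of _ _ of_truth]) auto
  then show "lifted n r N b f u = f (gadget n r (\<lambda>q. Some q \<in> set l))" by (simp add: lifted_def)
qed

text \<open>The cubic fixes 1 and -1 and has derivative 0 there, so an error \<open>e\<close>
  shrinks to \<open>e ^ 2 * (3 + e) / 2\<close>, at most 5 / 27. This leaves room below 1 / 3 for
  the other errors, at the price of a factor 3 in the degree.\<close>

lemma cubic_amplification:
  fixes y s :: real
  assumes "s = 1 \<or> s = -1" "\<bar>y - s\<bar> \<le> 1 / 3"
  shows "\<bar>(3 / 2 * y - 1 / 2 * y ^ 3) - s\<bar> \<le> 1 / 5"
proof -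
  define e where "e = s * y - 1"
  have e: "\<bar>e\<bar> \<le> 1 / 3" using assms by (auto simp: e_def abs_if split: if_splits)
  have "y = s * (1 + e)" using assms(1) by (auto simp: e_def)
  then have "(3 / 2 * y - 1 / 2 * y ^ 3) - s = - s * (e ^ 2 * ((3 + e) / 2))"
    using assms(1) by (auto simp: power2_eq_square power3_eq_cube field_simps)
  then have "\<bar>(3 / 2 * y - 1 / 2 * y ^ 3) - s\<bar> = e ^ 2 * (\<bar>3 + e\<bar> / 2)"
    using assms(1) by (auto simp: abs_mult)
  also have "\<dots> \<le> (1 / 3) ^ 2 * ((10 / 3) / 2)"
  proof -
    have "\<bar>3 + e\<bar> \<le> 10 / 3" using e by linarith
    moreover have "e ^ 2 \<le> (1 / 3) ^ 2" using e abs_le_square_iff[of e "1 / 3"] by simp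
    ultimately show ?thesis by (intro mult_mono divide_right_mono) auto
  qed
  also have "\<dots> \<le> 1 / 5" by (simp add: power2_eq_square)
  finally show ?thesis .
qed

text \<open>An optimal approximation is amplified, the linear forms \<open>code_bit\<close> are
  substituted, and the symmetrized result goes into \<open>approx_degree_transfer\<close>. The
  factor 3 in \<open>D\<close> comes from the cubic.\<close>

lemma approx_degree_lifted:
  fixes n r K N b :: nat and f :: "(nat \<Rightarrow> real) \<Rightarrow> real"
  defines "k \<equiv> real (4 * K ^ 2)"
  defines "D \<equiv> 3 * approx_degree (N * (2 * b)) (lifted n r N b f)"
  assumes K: "K \<ge> 1" and f: "boolean_function n f" and b: "b \<ge> 1" "n * r \<le> 2 ^ b"
    and DN: "D * (4 * K ^ 2) \<le> N"
    and noise: "2 * real n * (5 / 6) ^ r \<le> 1 / 32"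
    and tail: "4 ^ D * exp (18 * real (n * r) / k) * exp (- real N / (2 * k)) \<le> 1 / 25"
  shows "approx_degree n f \<le> D div (K + 2)"
proof -
  let ?m = "N * (2 * b)" and ?g = "lifted n r N b f" and ?R = "n * r"
  obtain F where F: "polyfun {..<?m} (approx_degree ?m ?g) F" "\<And>x. x \<in> cube ?m \<Longrightarrow> \<bar>F x - ?g x\<bar> \<le> 1 / 3"
    using approx_degree_attained by blast
  define F1 where "F1 = (\<lambda>x. 3 / 2 * F x - 1 / 2 * F x ^ 3)"
  have F1: "polyfun {..<?m} D F1" unfolding F1_def D_def
    by (intro polyfun_diff polyfun_cmult polyfun_power) (auto intro: F(1) polyfun_mono)
  have F1g: "\<bar>F1 x - ?g x\<bar> \<le> 1 / 5" if "x \<in> cube ?m" for x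
    unfolding F1_def using F(2)[OF that] boolean_abs[OF boolean_lifted[OF f] that]
    by (intro cubic_amplification) auto
  define F2 where "F2 = (\<lambda>y. F1 (\<lambda>a. code_bit ?R b a y))"
  have "polyfun ({..<N} \<times> {..<?R}) D F2"
    unfolding F2_def using F1 by (rule polyfun_subst) (simp add: polyfun_code_bit)
  from symmetrization[OF this] obtain Q where Q: "polyfun {..<?R} D Q"
    and h: "\<And>t :: nat \<Rightarrow> nat. \<exists>h. degree h \<le> D \<and> poly h (real (sum t {..<?R})) = Q (\<lambda>i. real (t i)) \<and>
    (\<forall>s. s \<le> N \<and> s \<le> sum t {..<?R} \<longrightarrow>
      poly h (real s) = bagavg ?R N s t (\<lambda>l. F2 (\<lambda>(j, i). of_bool (l ! j = Some i))))"
    by blast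
  have F2l: "\<bar>F2 (\<lambda>(j, i). of_bool (l ! j = Some i)) - f (gadget n r (\<lambda>q. Some q \<in> set l))\<bar> \<le> 1 / 5"
    if l: "length l = N" "\<And>i. Some i \<in> set l \<Longrightarrow> i < ?R" for l
  proof -
    let ?u = "\<lambda>a\<in>{..<?m}. code_bit ?R b a (\<lambda>(j, i). of_bool (l ! j = Some i))"
    \<comment> \<open>\<open>?u\<close> is the restriction that lies in the cube; a polynomial in
      the variables below \<open>?m\<close> does not see the difference.\<close>
    have "F2 (\<lambda>(j, i). of_bool (l ! j = Some i)) = F1 ?u"
      unfolding F2_def using F1 by (rule polyfun_cong) auto
    moreover have "\<bar>F1 ?u - ?g ?u\<bar> \<le> 1 / 5"
      using lifted_code(1)[OF b l] by (rule F1g)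
    ultimately show ?thesis using lifted_code(2)[OF b l] by simp
  qed
  show ?thesis
    unfolding k_def[symmetric]
  proof (rule approx_degree_transfer[OF K f Q _ _ DN noise tail[unfolded k_def]])
    fix t :: "nat \<Rightarrow> nat"
    obtain h where h: "degree h \<le> D" "poly h (real (sum t {..<?R})) = Q (\<lambda>i. real (t i))"
      "\<And>s. s \<le> N \<Longrightarrow> s \<le> sum t {..<?R} \<Longrightarrow>
        poly h (real s) = bagavg ?R N s t (\<lambda>l. F2 (\<lambda>(j, i). of_bool (l ! j = Some i)))"
      using h[of t] by blast
    show "\<exists>h. degree h \<le> D \<and> poly h (real (sum t {..<?R})) = Q (\<lambda>i. real (t i)) \<and>
      (\<forall>s. s \<le> N \<and> s \<le> sum t {..<?R} \<longrightarrow> \<bar>poly h (real s)\<bar> \<le> 6 / 5)"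
    proof (intro exI[of _ h] conjI allI impI h(1,2))
      fix s assume s: "s \<le> N \<and> s \<le> sum t {..<?R}"
      \<comment> \<open>On each list the value is within 1 / 5 of 1 or -1, whence 6 / 5.\<close>
      have "\<bar>bagavg ?R N s t (\<lambda>l. F2 (\<lambda>(j, i). of_bool (l ! j = Some i))) - 0\<bar> \<le> 6 / 5"
      proof (rule bagavg_close)
        fix l :: "nat option list" assume "length l = N" "\<And>i. Some i \<in> set l \<Longrightarrow> i < ?R"
        from F2l[OF this] show "\<bar>F2 (\<lambda>(j, i). of_bool (l ! j = Some i)) - 0\<bar> \<le> 6 / 5"
          using boolean_abs[OF f gadget_in_cube[of n r "\<lambda>q. Some q \<in> set l"]]
          by (elim disjE) linarith+
      qed (use s in auto)
      then show "\<bar>poly h (real s)\<bar> \<le> 6 / 5" using h(3) s by simp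
    qed
    assume S: "sum t {..<?R} \<le> N"
    have "\<bar>bagavg ?R N (sum t {..<?R}) t (\<lambda>l. F2 (\<lambda>(j, i). of_bool (l ! j = Some i))) -
        f (gadget n r (\<lambda>q. t q > 0))\<bar> \<le> 1 / 5"
    proof (rule bagavg_close)
      fix l :: "nat option list"
      assume l: "length l = N" "\<And>i. Some i \<in> set l \<Longrightarrow> i < ?R" "\<And>i. count_list l (Some i) \<le> t i"
        "length (filter (\<lambda>v. v \<noteq> None) l) = sum t {..<?R}"
      \<comment> \<open>A sample as large as the bag exhausts it, so the counts in the list are
        exactly \<open>t\<close>.\<close>
      have "(\<Sum>i<?R. count_list l (Some i)) = sum t {..<?R}"
        using sum_count_fills[of l ?R] l(2,4) by (simp add: fills_def)
      then have "count_list l (Some q) = t q" if "q < ?R" for q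
        using sum_mono_inv[of "\<lambda>i. count_list l (Some i)" "{..<?R}" t] l(3) that by auto
      then have "Some q \<in> set l \<longleftrightarrow> t q > 0" if "q < ?R" for q
        using that by (metis count_list_0_iff gr0I less_numeral_extra(3))
      then have "gadget n r (\<lambda>q. Some q \<in> set l) = gadget n r (\<lambda>q. t q > 0)"
        using block_index_less unfolding gadget_def
        by (intro restrict_ext arg_cong[of _ _ of_truth]) auto
      then show "\<bar>F2 (\<lambda>(j, i). of_bool (l ! j = Some i)) - f (gadget n r (\<lambda>q. t q > 0))\<bar> \<le> 1 / 5"
        using F2l[OF l(1,2)] by simp
    qed (use S in auto)
    then show "\<bar>Q (\<lambda>q. real (t q)) - f (gadget n r (\<lambda>q. t q > 0))\<bar> \<le> 1 / 5"
      using h(2) h(3)[OF S] by simp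
  qed
qed


section \<open>Circuits\<close>

lemma run_gates_Nil [simp]: "run_gates h [] = []"
  by (simp add: run_gates_def)

lemma run_gates_snoc: "run_gates h (gs @ [g]) = run_gates h gs @ [h (run_gates h gs) g]"
  by (simp add: run_gates_def)

lemma length_run_gates [simp]: "length (run_gates h gs) = length gs"
  by (induction gs rule: rev_induct) (simp_all add: run_gates_snoc)

definition gate_ok :: "nat \<Rightarrow> nat \<Rightarrow> gate \<Rightarrow> bool" where
  "gate_ok n l g \<longleftrightarrow> (\<forall>u\<in>gate_inputs g. node_ok n l u)"

lemma node_value_append: "node_ok n (length vs) u \<Longrightarrow> node_value x (vs @ ws) u = node_value x vs u"
  by (cases u) (auto simp: nth_append)

lemma node_depth_append: "node_ok n (length ds) u \<Longrightarrow> node_depth (ds @ ws) u = node_depth ds u"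
  by (cases u) (auto simp: nth_append)

lemma gate_value_append: "gate_ok n (length vs) g \<Longrightarrow> gate_value x (vs @ ws) g = gate_value x vs g"
  by (cases g) (auto simp: gate_ok_def node_value_append[of n vs])

lemma gate_depth_append: "gate_ok n (length ds) g \<Longrightarrow> gate_depth (ds @ ws) g = gate_depth ds g"
  by (cases g) (auto simp: gate_ok_def node_depth_append[of n ds] cong: image_cong_simp)

text \<open>Gates that refer only to \<open>gs\<close> do not notice values appended behind it, so
  the whole layer is evaluated in parallel.\<close>

lemma run_gates_layer:
  assumes "\<And>g ws. g \<in> set L \<Longrightarrow> h (run_gates h gs @ ws) g = h (run_gates h gs) g"
  shows "run_gates h (gs @ L) = run_gates h gs @ map (h (run_gates h gs)) L"
  using assms
proof (induction L rule: rev_induct)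
  case (snoc g L)
  then have IH: "run_gates h (gs @ L) = run_gates h gs @ map (h (run_gates h gs)) L" by simp
  have "run_gates h ((gs @ L) @ [g]) = run_gates h (gs @ L) @ [h (run_gates h gs) g]"
    unfolding run_gates_snoc IH using snoc.prems by simp
  with IH show ?case by simp
qed simp

section \<open>Substituting nodes for the inputs of a circuit\<close>

fun redirect :: "(nat \<Rightarrow> node list) \<Rightarrow> nat \<Rightarrow> node \<Rightarrow> node list" where
  "redirect ins off (Input i) = ins i"
| "redirect ins off (Gate j) = [Gate (off + j)]"

text \<open>An AND gate may receive several nodes in place of one input and thus absorbs their
  conjunction at no cost in depth. A NOT gate takes the head of a list that is meant to be a
  singleton.\<close>

fun redirect_gate :: "(nat \<Rightarrow> node list) \<Rightarrow> nat \<Rightarrow> gate \<Rightarrow> gate" where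
  "redirect_gate ins off (And_gate us) = And_gate (concat (map (redirect ins off) us))"
| "redirect_gate ins off (Or_gate us) = Or_gate (concat (map (redirect ins off) us))"
| "redirect_gate ins off (Not_gate u) = Not_gate (hd (redirect ins off u))"

text \<open>Replacing an input by several nodes preserves the meaning of a gate only if the gate is an
  AND gate; all other gates must be fed by inputs that are replaced by a single node.\<close>

definition redirectable :: "(nat \<Rightarrow> node list) \<Rightarrow> gate \<Rightarrow> bool" where
  "redirectable ins g \<longleftrightarrow> (\<exists>us. g = And_gate us) \<or> (\<forall>i. Input i \<in> gate_inputs g \<longrightarrow> (\<exists>w. ins i = [w]))"

lemma redirect_all:
  assumes "node_ok n (length vs) v"
    and "\<And>i. i < n \<Longrightarrow> x i = -1 \<longleftrightarrow> (\<forall>w\<in>set (ins i). node_value u ps w)"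
    and "\<And>i w. i < n \<Longrightarrow> w \<in> set (ins i) \<Longrightarrow> node_ok m (length ps) w"
  shows "(\<forall>w\<in>set (redirect ins (length ps) v). node_value u (ps @ vs) w) \<longleftrightarrow> node_value x vs v"
proof (cases v)
  case (Input i)
  then show ?thesis using assms node_value_append[of m ps _ u vs] by auto
qed (simp add: nth_append)

lemma redirect_gate_value:
  assumes ok: "gate_ok n (length vs) g" "redirectable ins g"
    and ins: "\<And>i. i < n \<Longrightarrow> x i = -1 \<longleftrightarrow> (\<forall>w\<in>set (ins i). node_value u ps w)"
      "\<And>i w. i < n \<Longrightarrow> w \<in> set (ins i) \<Longrightarrow> node_ok m (length ps) w"
  shows "gate_value u (ps @ vs) (redirect_gate ins (length ps) g) = gate_value x vs g"
proof -
  have all: "(\<forall>w\<in>set (redirect ins (length ps) v). node_value u (ps @ vs) w) \<longleftrightarrow> node_value x vs v"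
    if "v \<in> gate_inputs g" for v
    using ok(1) that ins by (intro redirect_all) (auto simp: gate_ok_def)
  \<comment> \<open>Outside AND gates the replacement is one node, for which the universal statement
    \<open>all\<close> and its existential version coincide.\<close>
  have single: "\<exists>w. redirect ins (length ps) v = [w]" if "v \<in> gate_inputs g" "\<nexists>us. g = And_gate us" for v
    using ok(2) that by (cases v) (auto simp: redirectable_def)
  show ?thesis
  proof (cases g)
    case (And_gate us)
    then show ?thesis using all by auto
  next
    case (Or_gate us)
    have "(\<exists>w\<in>set (redirect ins (length ps) v). node_value u (ps @ vs) w) \<longleftrightarrow> node_value x vs v"
      if "v \<in> set us" for v
      using all[of v] single[of v] that Or_gate by auto
    then show ?thesis using Or_gate by auto
  next
    case (Not_gate v)
    then show ?thesis using all[of v] single[of v] by auto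
  qed
qed

lemma redirect_gates_value:
  assumes "\<And>j. j < length gs \<Longrightarrow> gate_ok n j (gs ! j)" "\<And>g. g \<in> set gs \<Longrightarrow> redirectable ins g"
    and "\<And>i. i < n \<Longrightarrow> x i = -1 \<longleftrightarrow> (\<forall>w\<in>set (ins i). node_value u (run_gates (gate_value u) pre) w)"
    and "\<And>i w. i < n \<Longrightarrow> w \<in> set (ins i) \<Longrightarrow> node_ok m (length pre) w"
  shows "run_gates (gate_value u) (pre @ map (redirect_gate ins (length pre)) gs) =
    run_gates (gate_value u) pre @ run_gates (gate_value x) gs"
  using assms(1,2)
proof (induction gs rule: rev_induct)
  case (snoc g gs)
  have ok: "gate_ok n j (gs ! j)" if "j < length gs" for j
    using snoc.prems(1)[of j] that by (simp add: nth_append)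
  have IH: "run_gates (gate_value u) (pre @ map (redirect_gate ins (length pre)) gs) =
    run_gates (gate_value u) pre @ run_gates (gate_value x) gs"
    using ok snoc.prems(2) by (intro snoc.IH) auto
  have "gate_ok n (length gs) g" using snoc.prems(1)[of "length gs"] by simp
  then have "gate_value u (run_gates (gate_value u) pre @ run_gates (gate_value x) gs)
     (redirect_gate ins (length pre) g) = gate_value x (run_gates (gate_value x) gs) g"
    using redirect_gate_value[of n "run_gates (gate_value x) gs" g ins x u "run_gates (gate_value u) pre" m]
      snoc.prems(2) assms(3,4) by simp
  then show ?case
    using IH run_gates_snoc[of "gate_value u" "pre @ map (redirect_gate ins (length pre)) gs"]
    by (simp add: run_gates_snoc)
qed simp

lemma redirect_depth:
  assumes "node_ok n (length ds) v" "length ds' = length ds"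
    and "\<And>j. j < length ds \<Longrightarrow> ds' ! j \<le> ds ! j + e"
    and "\<And>i w. i < n \<Longrightarrow> w \<in> set (ins i) \<Longrightarrow> node_ok m (length ps) w \<and> node_depth ps w \<le> e"
    and "w \<in> set (redirect ins (length ps) v)"
  shows "node_depth (ps @ ds') w \<le> node_depth ds v + e"
proof (cases v)
  case (Input i)
  then show ?thesis using assms node_depth_append[of m ps w ds'] by auto
next
  case (Gate j)
  then show ?thesis using assms by (auto simp: nth_append)
qed

lemma redirect_gate_depth:
  assumes ok: "gate_ok n (length ds) g" "redirectable ins g" and ds: "length ds' = length ds"
    "\<And>j. j < length ds \<Longrightarrow> ds' ! j \<le> ds ! j + e"
    and ins: "\<And>i w. i < n \<Longrightarrow> w \<in> set (ins i) \<Longrightarrow> node_ok m (length ps) w \<and> node_depth ps w \<le> e"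
  shows "gate_depth (ps @ ds') (redirect_gate ins (length ps) g) \<le> gate_depth ds g + e"
proof -
  have le: "node_depth (ps @ ds') w \<le> node_depth ds v + e"
    if "v \<in> gate_inputs g" "w \<in> set (redirect ins (length ps) v)" for v w
    using ok(1) that by (intro redirect_depth[OF _ ds ins]) (auto simp: gate_ok_def)
  have Max: "Suc (Max (insert 0 (node_depth (ps @ ds') ` set (concat (map (redirect ins (length ps)) us)))))
    \<le> Suc (Max (insert 0 (node_depth ds ` set us))) + e" if us: "set us = gate_inputs g" for us
  proof -
    have "node_depth (ps @ ds') w \<le> Max (insert 0 (node_depth ds ` set us)) + e"
      if v: "v \<in> set us" and w: "w \<in> set (redirect ins (length ps) v)" for v w
    proof -
      have "node_depth ds v \<le> Max (insert 0 (node_depth ds ` set us))" using v by (intro Max_ge) auto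
      with le[of v w] v w us show ?thesis by simp
    qed
    then show ?thesis by auto
  qed
  show ?thesis
  proof (cases g)
    case (Not_gate v)
    then have "\<exists>w. redirect ins (length ps) v = [w]"
      using ok(2) by (cases v) (auto simp: redirectable_def)
    then show ?thesis using le[of v] Not_gate by auto
  qed (use Max in auto)
qed

text \<open>The depths \<open>ds'\<close> are only bounded because the replacement nodes may have
  any depth up to \<open>e\<close>.\<close>

lemma redirect_gates_depth:
  assumes "\<And>j. j < length gs \<Longrightarrow> gate_ok n j (gs ! j)" "\<And>g. g \<in> set gs \<Longrightarrow> redirectable ins g"
    and "\<And>i w. i < n \<Longrightarrow> w \<in> set (ins i) \<Longrightarrow>
      node_ok m (length pre) w \<and> node_depth (run_gates gate_depth pre) w \<le> e"
  shows "\<exists>ds'. run_gates gate_depth (pre @ map (redirect_gate ins (length pre)) gs) =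
      run_gates gate_depth pre @ ds' \<and> length ds' = length gs \<and>
      (\<forall>j<length gs. ds' ! j \<le> run_gates gate_depth gs ! j + e)"
  using assms(1,2)
proof (induction gs rule: rev_induct)
  case (snoc g gs)
  have ok: "gate_ok n j (gs ! j)" if "j < length gs" for j
    using snoc.prems(1)[of j] that by (simp add: nth_append)
  have "\<exists>ds'. run_gates gate_depth (pre @ map (redirect_gate ins (length pre)) gs) =
      run_gates gate_depth pre @ ds' \<and> length ds' = length gs \<and>
      (\<forall>j<length gs. ds' ! j \<le> run_gates gate_depth gs ! j + e)"
    using ok snoc.prems(2) by (intro snoc.IH) auto
  then obtain ds' where ds': "run_gates gate_depth (pre @ map (redirect_gate ins (length pre)) gs) =
      run_gates gate_depth pre @ ds'" "length ds' = length gs"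
      "\<forall>j<length gs. ds' ! j \<le> run_gates gate_depth gs ! j + e" by blast
  define d where "d = gate_depth (run_gates gate_depth pre @ ds') (redirect_gate ins (length pre) g)"
  have "gate_ok n (length gs) g" using snoc.prems(1)[of "length gs"] by simp
  then have "d \<le> gate_depth (run_gates gate_depth gs) g + e"
    unfolding d_def using redirect_gate_depth[of n "run_gates gate_depth gs" g ins ds' e m "run_gates gate_depth pre"]
      snoc.prems(2) assms(3) ds' by simp
  moreover have "run_gates gate_depth (pre @ map (redirect_gate ins (length pre)) (gs @ [g])) =
      run_gates gate_depth pre @ (ds' @ [d])"
    using ds'(1) run_gates_snoc[of gate_depth "pre @ map (redirect_gate ins (length pre)) gs"]
    by (simp add: d_def)
  ultimately show ?case using ds'(2,3)
    by (intro exI[of _ "ds' @ [d]"]) (auto simp: run_gates_snoc nth_append less_Suc_eq)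
qed simp

lemma node_ok_mono: "node_ok m l w \<Longrightarrow> l \<le> l' \<Longrightarrow> node_ok m l' w"
  by (cases w) auto

lemma redirect_gate_inputs:
  assumes "redirectable ins g" "w \<in> gate_inputs (redirect_gate ins off g)"
  shows "\<exists>v\<in>gate_inputs g. w \<in> set (redirect ins off v)"
proof (cases g)
  case (Not_gate v)
  then have "\<exists>w. redirect ins off v = [w]"
    using assms(1) by (cases v) (auto simp: redirectable_def)
  then show ?thesis using assms(2) Not_gate by auto
qed (use assms in auto)

text \<open>Composition of circuits: \<open>pre\<close> provides nodes whose conjunctions are the
  bits of \<open>X u\<close>, and \<open>A\<close> runs on top of them.\<close>

lemma redirect_circuit:
  fixes ins :: "nat \<Rightarrow> node list"
  assumes A: "circuit_computes n A f"
    and red: "\<And>g. g \<in> set (gates A) \<Longrightarrow> redirectable ins g" "\<And>i. out_node A = Input i \<Longrightarrow> \<exists>w. ins i = [w]"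
    and pre: "\<And>j. j < length pre \<Longrightarrow> gate_ok m j (pre ! j)"
    and ins: "\<And>i w. i < n \<Longrightarrow> w \<in> set (ins i) \<Longrightarrow>
      node_ok m (length pre) w \<and> node_depth (run_gates gate_depth pre) w \<le> e"
    and X: "\<And>u. u \<in> cube m \<Longrightarrow> X u \<in> cube n"
      "\<And>u i. u \<in> cube m \<Longrightarrow> i < n \<Longrightarrow>
        X u i = -1 \<longleftrightarrow> (\<forall>w\<in>set (ins i). node_value u (run_gates (gate_value u) pre) w)"
  defines "B \<equiv> Circuit (pre @ map (redirect_gate ins (length pre)) (gates A))
    (hd (redirect ins (length pre) (out_node A)))"
  shows "circuit_computes m B (\<lambda>u. f (X u)) \<and> circuit_depth B \<le> circuit_depth A + e \<and>
    circuit_size B = length pre + circuit_size A"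
proof -
  let ?off = "length pre"
  have okA: "\<And>j. j < length (gates A) \<Longrightarrow> gate_ok n j (gates A ! j)"
    and out: "node_ok n (length (gates A)) (out_node A)"
    using A by (auto simp: circuit_computes_def wf_circuit_def gate_ok_def)
  obtain w where w: "redirect ins ?off (out_node A) = [w]"
    using red(2) by (cases "out_node A") auto
  have ok: "node_ok m (?off + l) v'" if "node_ok n l v" "v' \<in> set (redirect ins ?off v)" for l v v'
    using that ins node_ok_mono[of m ?off v' "?off + l"] by (cases v) auto
  have "wf_circuit m B"
    unfolding wf_circuit_def
  proof (intro conjI allI impI ballI)
    fix j v' assume j: "j < length (gates B)" and v': "v' \<in> gate_inputs (gates B ! j)"
    show "node_ok m j v'"
    proof (cases "j < ?off")
      case True
      then show ?thesis using pre[OF True] v' by (simp add: B_def nth_append gate_ok_def)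
    next
      case False
      define j' where "j' = j - ?off"
      have j': "j' < length (gates A)" "j = ?off + j'" using j False by (auto simp: B_def j'_def)
      then have "v' \<in> gate_inputs (redirect_gate ins ?off (gates A ! j'))"
        using v' by (simp add: B_def nth_append)
      then obtain v where "v \<in> gate_inputs (gates A ! j')" "v' \<in> set (redirect ins ?off v)"
        using redirect_gate_inputs red(1) j' by (metis nth_mem)
      then show ?thesis using ok okA[OF j'(1)] j'(2) by (auto simp: gate_ok_def)
    qed
  next
    show "node_ok m (length (gates B)) (out_node B)"
      using ok[OF out, of w] w by (simp add: B_def)
  qed
  moreover have "f (X u) = of_truth (circuit_value B u)" if u: "u \<in> cube m" for u
  proof -
    let ?ps = "run_gates (gate_value u) pre" and ?vs = "run_gates (gate_value (X u)) (gates A)"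
    have "run_gates (gate_value u) (gates B) = ?ps @ ?vs"
      unfolding B_def circuit.sel
      by (rule redirect_gates_value[OF okA red(1) X(2)[OF u]]) (use ins in auto)
    moreover have "(\<forall>w\<in>set (redirect ins (length ?ps) (out_node A)). node_value u (?ps @ ?vs) w) \<longleftrightarrow>
        node_value (X u) ?vs (out_node A)"
      using out X(2)[OF u] ins by (intro redirect_all[of n _ _ _ _ _ _ m]) auto
    ultimately have "circuit_value B u = circuit_value A (X u)"
      using w by (simp add: circuit_value_def B_def)
    then show ?thesis using A X(1)[OF u] by (simp add: circuit_computes_def)
  qed
  ultimately have "circuit_computes m B (\<lambda>u. f (X u))" by (simp add: circuit_computes_def)
  moreover
  obtain ds' where ds': "run_gates gate_depth (gates B) = run_gates gate_depth pre @ ds'"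
    "length ds' = length (gates A)" "\<And>j. j < length (gates A) \<Longrightarrow> ds' ! j \<le> run_gates gate_depth (gates A) ! j + e"
  proof -
    have "\<exists>ds'. run_gates gate_depth (gates B) = run_gates gate_depth pre @ ds' \<and>
        length ds' = length (gates A) \<and>
        (\<forall>j<length (gates A). ds' ! j \<le> run_gates gate_depth (gates A) ! j + e)"
      unfolding B_def circuit.sel
      by (rule redirect_gates_depth[OF okA red(1)]) (use ins in auto)
    then show ?thesis using that by blast
  qed
  have "node_depth (run_gates gate_depth pre @ ds') w \<le> node_depth (run_gates gate_depth (gates A)) (out_node A) + e"
    using out ds' ins w by (intro redirect_depth[of n _ _ _ _ ins m]) auto
  then have "circuit_depth B \<le> circuit_depth A + e"
    using ds'(1) w by (simp add: circuit_depth_def B_def)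
  ultimately show ?thesis by (simp add: circuit_size_def B_def)
qed


section \<open>Circuits for the lifted function\<close>

lemma run_layer_value:
  assumes "\<And>g. g \<in> set L \<Longrightarrow> gate_ok m (length gs) g"
  shows "run_gates (gate_value u) (gs @ L) =
    run_gates (gate_value u) gs @ map (gate_value u (run_gates (gate_value u) gs)) L"
  using assms by (intro run_gates_layer gate_value_append[of m]) simp

lemma run_layer_depth:
  assumes L: "\<And>g. g \<in> set L \<Longrightarrow> gate_ok m (length gs) g"
    and gs: "\<And>d. d \<in> set (run_gates gate_depth gs) \<Longrightarrow> d \<le> e"
    and d: "d \<in> set (run_gates gate_depth (gs @ L))"
  shows "d \<le> Suc e"
proof -
  have "run_gates gate_depth (gs @ L) =
      run_gates gate_depth gs @ map (gate_depth (run_gates gate_depth gs)) L"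
    using L by (intro run_gates_layer gate_depth_append[of m]) simp
  moreover have "gate_depth (run_gates gate_depth gs) g \<le> Suc e" if g: "g \<in> set L" for g
  proof -
    have "node_depth (run_gates gate_depth gs) w \<le> e" if "w \<in> gate_inputs g" for w
      using L[OF g] that gs by (cases w) (auto simp: gate_ok_def)
    then show ?thesis by (cases g) auto
  qed
  ultimately show ?thesis using gs d by (auto intro: le_SucI)
qed

lemma gate_ok_layer:
  assumes "\<And>j. j < length gs \<Longrightarrow> gate_ok m j (gs ! j)" "\<And>g. g \<in> set L \<Longrightarrow> gate_ok m (length gs) g"
    and "j < length (gs @ L)"
  shows "gate_ok m j ((gs @ L) ! j)"
proof (cases "j < length gs")
  case False
  then have "gate_ok m (length gs) ((gs @ L) ! j)"
    using assms(2,3) by (simp add: nth_append)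
  then show ?thesis using False node_ok_mono[of m "length gs" _ j] by (auto simp: gate_ok_def)
qed (use assms in \<open>auto simp: nth_append\<close>)

text \<open>Gate \<open>q * N + j\<close> tests whether entry \<open>j\<close> is \<open>q\<close>,
  so \<open>a mod N\<close> is the entry and \<open>a div N\<close> the number.\<close>

definition code_layer :: "nat \<Rightarrow> nat \<Rightarrow> nat \<Rightarrow> gate list" where
  "code_layer b N R =
    map (\<lambda>a. And_gate (map (\<lambda>\<beta>. Input (bit_var b (a mod N) \<beta> (bit (a div N) \<beta>))) [0..<b])) [0..<R * N]"

definition list_layer :: "nat \<Rightarrow> nat \<Rightarrow> gate list" where
  "list_layer N R = map (\<lambda>q. Or_gate (map (\<lambda>j. Gate (q * N + j)) [0..<N])) [0..<R]"

text \<open>\<open>off\<close> is the number of gates in front of the list layer.\<close>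

definition block_nodes :: "nat \<Rightarrow> nat \<Rightarrow> nat \<Rightarrow> node list" where
  "block_nodes off r i = map (\<lambda>l. Gate (off + (i * r + l))) [0..<r]"

lemma length_layers [simp]: "length (code_layer b N R) = R * N" "length (list_layer N R) = R"
  by (simp_all add: code_layer_def list_layer_def)

lemma code_layer_ok:
  assumes "g \<in> set (code_layer b N R)"
  shows "gate_ok (N * (2 * b)) 0 g"
proof -
  obtain a where a: "a < R * N"
    "g = And_gate (map (\<lambda>\<beta>. Input (bit_var b (a mod N) \<beta> (bit (a div N) \<beta>))) [0..<b])"
    using assms by (auto simp: code_layer_def)
  then have "N > 0" by (cases N) auto
  with a show ?thesis by (auto simp: gate_ok_def intro!: bit_var_less)
qed

lemma list_layer_ok:
  "g \<in> set (list_layer N R) \<Longrightarrow> gate_ok m (R * N) g"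
  by (auto simp: gate_ok_def list_layer_def intro!: block_index_less)

lemma code_list_layers_ok:
  "j < R * N + R \<Longrightarrow> gate_ok (N * (2 * b)) j ((code_layer b N R @ list_layer N R) ! j)"
proof (rule gate_ok_layer)
  fix j assume j: "j < length (code_layer b N R)"
  have "gate_ok (N * (2 * b)) 0 (code_layer b N R ! j)" using j by (intro code_layer_ok[of _ b N R] nth_mem)
  then show "gate_ok (N * (2 * b)) j (code_layer b N R ! j)"
    using node_ok_mono[of "N * (2 * b)" 0 _ j] by (auto simp: gate_ok_def)
qed (auto intro: list_layer_ok)

lemma code_list_layers_value:
  "run_gates (gate_value u) (code_layer b N R @ list_layer N R) =
    map (\<lambda>a. \<forall>\<beta><b. u (bit_var b (a mod N) \<beta> (bit (a div N) \<beta>)) = -1) [0..<R * N] @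
    map (listed N b u) [0..<R]"
proof -
  let ?V = "map (\<lambda>a. \<forall>\<beta><b. u (bit_var b (a mod N) \<beta> (bit (a div N) \<beta>)) = -1) [0..<R * N]"
  have V: "run_gates (gate_value u) (code_layer b N R) = ?V"
    using run_layer_value[of "code_layer b N R" "N * (2 * b)" "[]" u] code_layer_ok
    by (auto simp: code_layer_def)
  have "map (gate_value u ?V) (list_layer N R) = map (listed N b u) [0..<R]"
    unfolding list_layer_def map_map
  proof (rule map_cong)
    fix q assume "q \<in> set [0..<R]"
    then have q: "q < R" by simp
    have "?V ! (q * N + j) \<longleftrightarrow> (\<forall>\<beta><b. u (bit_var b j \<beta> (bit q \<beta>)) = -1)" if j: "j < N" for j
      using block_index_less[OF q j] j by simp
    then show "(gate_value u ?V \<circ> (\<lambda>q. Or_gate (map (\<lambda>j. Gate (q * N + j)) [0..<N]))) q = listed N b u q"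
      by (auto simp: listed_def)
  qed simp
  then show ?thesis
    using run_layer_value[of "list_layer N R" m "code_layer b N R" u] list_layer_ok by (simp add: V)
qed

lemma code_list_layers_depth:
  assumes "d \<in> set (run_gates gate_depth (code_layer b N R @ list_layer N R))"
  shows "d \<le> 2"
proof -
  have "d' \<le> Suc 0" if "d' \<in> set (run_gates gate_depth ([] @ code_layer b N R))" for d'
    using that by (rule run_layer_depth[rotated -1]) (auto intro: code_layer_ok)
  then have "d \<le> Suc (Suc 0)"
    using assms by (intro run_layer_depth[of "list_layer N R" 0 "code_layer b N R" "Suc 0" d]) (auto intro: list_layer_ok)
  then show ?thesis by simp
qed

lemma gadget_eq_iff: "i < n \<Longrightarrow> gadget n r P i = -1 \<longleftrightarrow> (\<forall>l<r. P (i * r + l))"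
  by (simp add: gadget_def of_truth_def)

lemma block_nodes_value:
  assumes "i < n" "length vs = off"
  shows "(\<forall>w\<in>set (block_nodes off r i). node_value u (vs @ map (listed N b u) [0..<n * r]) w) \<longleftrightarrow>
    gadget n r (listed N b u) i = -1"
  using assms block_index_less[OF assms(1)] by (auto simp: block_nodes_def gadget_eq_iff nth_append)

text \<open>Three layers go below \<open>A\<close>: AND for the code tests, OR over the entries, AND
  over each block. Every bit of the gadget is then a single node, as an arbitrary \<open>A\<close>
  requires.\<close>

lemma lifted_circuit:
  assumes "circuit_computes n A f"
  shows "\<exists>B. circuit_computes (N * (2 * b)) B (lifted n r N b f) \<and>
    circuit_depth B \<le> circuit_depth A + 3 \<and> circuit_size B = n * r * N + n * r + n + circuit_size A"
proof -
  let ?R = "n * r" and ?m = "N * (2 * b)"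
  define pre where "pre = code_layer b N ?R @ list_layer N ?R"
  define top where "top = map (\<lambda>i. And_gate (block_nodes (?R * N) r i)) [0..<n]"
  define ins where "ins = (\<lambda>i. [Gate (?R * N + ?R + i)])"
  have len: "length pre = ?R * N + ?R" "length top = n" by (simp_all add: pre_def top_def)
  have top: "gate_ok ?m (length pre) g" if "g \<in> set top" for g
    using that block_index_less by (auto simp: top_def gate_ok_def block_nodes_def len)
  have val: "run_gates (gate_value u) (pre @ top) = run_gates (gate_value u) pre @
      map (\<lambda>i. gadget n r (listed N b u) i = -1) [0..<n]" for u
  proof -
    have "map (gate_value u (run_gates (gate_value u) pre)) top =
        map (\<lambda>i. gadget n r (listed N b u) i = -1) [0..<n]"
      unfolding top_def map_map pre_def code_list_layers_value
      by (rule map_cong) (auto simp: block_nodes_value)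
    with run_layer_value[OF top] show ?thesis by simp
  qed
  define B where "B = Circuit ((pre @ top) @ map (redirect_gate ins (length (pre @ top))) (gates A))
    (hd (redirect ins (length (pre @ top)) (out_node A)))"
  note * = redirect_circuit[of n A f ins "pre @ top" ?m 3 "\<lambda>u. gadget n r (listed N b u)", folded B_def]
  have "circuit_computes ?m B (\<lambda>u. f (gadget n r (listed N b u))) \<and>
      circuit_depth B \<le> circuit_depth A + 3 \<and> circuit_size B = length (pre @ top) + circuit_size A"
  proof (rule *)
    fix j assume "j < length (pre @ top)"
    then show "gate_ok ?m j ((pre @ top) ! j)"
      using top by (intro gate_ok_layer) (auto simp: pre_def code_list_layers_ok)
  next
    fix i w assume i: "i < n" and w: "w \<in> set (ins i)"
    have "run_gates gate_depth (pre @ top) ! (?R * N + ?R + i) \<in> set (run_gates gate_depth (pre @ top))"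
      using i len by (intro nth_mem) simp
    then have "run_gates gate_depth (pre @ top) ! (?R * N + ?R + i) \<le> Suc 2"
      by (rule run_layer_depth[rotated -1]) (use top code_list_layers_depth in \<open>auto simp: pre_def\<close>)
    then show "node_ok ?m (length (pre @ top)) w \<and> node_depth (run_gates gate_depth (pre @ top)) w \<le> 3"
      using i w len by (simp add: ins_def)
  next
    fix u i assume "i < n"
    then show "gadget n r (listed N b u) i = -1 \<longleftrightarrow>
        (\<forall>w\<in>set (ins i). node_value u (run_gates (gate_value u) (pre @ top)) w)"
      unfolding val by (simp add: ins_def nth_append len)
  qed (use assms in \<open>auto simp: redirectable_def ins_def gadget_in_cube\<close>)
  then show ?thesis unfolding lifted_def[abs_def] len length_append by blast
qed

text \<open>The inputs of \<open>A\<close> feed only AND gates, which take over the conjunctions of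
  the blocks and save the third layer. The new inputs are read only by the AND gates of
  \<open>code_layer\<close>.\<close>

lemma lifted_monotone_circuit:
  assumes A: "circuit_computes n A f" "monotone_circuit A" "and_bottom A"
  shows "\<exists>B. circuit_computes (N * (2 * b)) B (lifted n r N b f) \<and> monotone_circuit B \<and> and_bottom B \<and>
    circuit_depth B \<le> circuit_depth A + 2 \<and> circuit_size B = n * r * N + n * r + circuit_size A"
proof -
  let ?R = "n * r" and ?m = "N * (2 * b)"
  define pre where "pre = code_layer b N ?R @ list_layer N ?R"
  define ins where "ins = block_nodes (?R * N) r"
  have len: "length pre = ?R * N + ?R" by (simp add: pre_def)
  have red: "redirectable ins g" if "g \<in> set (gates A)" for g
    using A(3) that by (auto simp: and_bottom_def redirectable_def)
  define B where "B = Circuit (pre @ map (redirect_gate ins (length pre)) (gates A))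
    (hd (redirect ins (length pre) (out_node A)))"
  note * = redirect_circuit[of n A f ins pre ?m 2 "\<lambda>u. gadget n r (listed N b u)", folded B_def]
  have "circuit_computes ?m B (\<lambda>u. f (gadget n r (listed N b u))) \<and>
      circuit_depth B \<le> circuit_depth A + 2 \<and> circuit_size B = length pre + circuit_size A"
  proof (rule *)
    fix j assume "j < length pre"
    then show "gate_ok ?m j (pre ! j)" by (simp add: pre_def code_list_layers_ok)
  next
    fix i w assume i: "i < n" and w: "w \<in> set (ins i)"
    then obtain l where l: "l < r" "w = Gate (?R * N + (i * r + l))" by (auto simp: ins_def block_nodes_def)
    have "run_gates gate_depth pre ! (?R * N + (i * r + l)) \<in> set (run_gates gate_depth pre)"
      using block_index_less[OF i l(1)] len by (intro nth_mem) simp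
    then have "run_gates gate_depth pre ! (?R * N + (i * r + l)) \<le> 2"
      unfolding pre_def by (rule code_list_layers_depth)
    then show "node_ok ?m (length pre) w \<and> node_depth (run_gates gate_depth pre) w \<le> 2"
      using block_index_less[OF i l(1)] l len by simp
  next
    fix u i assume "i < n"
    then show "gadget n r (listed N b u) i = -1 \<longleftrightarrow>
        (\<forall>w\<in>set (ins i). node_value u (run_gates (gate_value u) pre) w)"
      unfolding pre_def code_list_layers_value ins_def using block_nodes_value[of i n _ "?R * N" r u N b] by simp
  qed (use A red in \<open>auto simp: and_bottom_def gadget_in_cube\<close>)
  moreover have "monotone_circuit B"
  proof -
    have "\<nexists>u. redirect_gate ins (length pre) g = Not_gate u" if "g \<in> set (gates A)" for g
      using A(2) that by (cases g) (auto simp: monotone_circuit_def)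
    moreover have "\<nexists>u. g = Not_gate u" if "g \<in> set pre" for g
      using that by (auto simp: pre_def code_layer_def list_layer_def)
    ultimately show ?thesis unfolding monotone_circuit_def B_def circuit.sel set_append set_map by (metis UnE imageE)
  qed
  moreover have "and_bottom B"
  proof -
    have no_input: "Input i \<notin> set (redirect ins off v)" for i off v
      by (cases v) (auto simp: ins_def block_nodes_def)
    have "Input i \<notin> gate_inputs (redirect_gate ins (length pre) g)" if "g \<in> set (gates A)" for g i
      using redirect_gate_inputs[OF red[OF that]] no_input by blast
    moreover have "Input i \<notin> gate_inputs g" if "g \<in> set (list_layer N ?R)" for g i
      using that by (auto simp: list_layer_def)
    moreover have "\<exists>us. g = And_gate us" if "g \<in> set (code_layer b N ?R)" for g
      using that by (auto simp: code_layer_def)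
    moreover have "\<exists>j. out_node A = Gate j"
      using A(3) by (cases "out_node A") (auto simp: and_bottom_def)
    ultimately show ?thesis by (auto simp: and_bottom_def B_def pre_def)
  qed
  ultimately show ?thesis unfolding lifted_def[abs_def] len length_append by blast
qed

section \<open>DNFs for the lifted function\<close>

lemma finite_dnf:
  assumes "wf_dnf n D"
  shows "finite D" "T \<in> D \<Longrightarrow> finite T"
proof -
  have "l \<in> Pos ` {..<n} \<union> Neg ` {..<n}" if "T \<in> D" "l \<in> T" for T l
  proof -
    have "literal_var l < n" using assms that by (simp add: wf_dnf_def)
    then show ?thesis by (cases l) auto
  qed
  then have D: "D \<subseteq> Pow (Pos ` {..<n} \<union> Neg ` {..<n})" by blast
  then show "finite D" by (rule finite_subset) simp
  show "finite T" if "T \<in> D"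
    using D that by (intro finite_subset[of T "Pos ` {..<n} \<union> Neg ` {..<n}"]) auto
qed

text \<open>By distributivity: a clause \<open>T\<close> requires all numbers in
  \<open>blocks T\<close>, and \<open>J\<close> guesses an entry for each of them. The clause for
  \<open>J\<close> concerns at most \<open>card T * r\<close> numbers and has at most
  \<open>b\<close> literals for each.\<close>

lemma lifted_dnf:
  assumes D: "dnf_computes n D f" "monotone_dnf D"
  shows "\<exists>E. dnf_computes (N * (2 * b)) E (lifted n r N b f) \<and> monotone_dnf E \<and>
    dnf_width E \<le> dnf_width D * r * b"
proof -
  have wf: "wf_dnf n D" using D(1) by (simp add: dnf_computes_def)
  define blocks where "blocks = (\<lambda>T. {i * r + l | i l. Pos i \<in> T \<and> l < r})"
  define clause where "clause = (\<lambda>T J. (\<lambda>(q, \<beta>). Pos (bit_var b (J q) \<beta> (bit q \<beta>))) ` (blocks T \<times> {..<b}))"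
  define E where "E = (\<Union>T\<in>D. clause T ` (blocks T \<rightarrow>\<^sub>E {..<N}))"
  have wfE: "wf_dnf (N * (2 * b)) E"
    by (auto simp: wf_dnf_def E_def clause_def PiE_iff intro!: bit_var_less)
  have "dnf_value E u \<longleftrightarrow> dnf_value D (gadget n r (listed N b u))" for u
  proof -
    have "(\<exists>J\<in>blocks T \<rightarrow>\<^sub>E {..<N}. \<forall>l\<in>clause T J. literal_value u l) \<longleftrightarrow>
        (\<forall>l\<in>T. literal_value (gadget n r (listed N b u)) l)" if T: "T \<in> D" for T
    proof -
      have "(\<exists>J\<in>blocks T \<rightarrow>\<^sub>E {..<N}. \<forall>l\<in>clause T J. literal_value u l) \<longleftrightarrow>
          (\<exists>J\<in>blocks T \<rightarrow>\<^sub>E {..<N}. \<forall>q\<in>blocks T. \<forall>\<beta><b. u (bit_var b (J q) \<beta> (bit q \<beta>)) = -1)"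
        by (auto simp: clause_def)
      also have "\<dots> \<longleftrightarrow> (\<forall>q\<in>blocks T. listed N b u q)"
      proof
        assume *: "\<forall>q\<in>blocks T. listed N b u q"
        define J where "J = (\<lambda>q\<in>blocks T. SOME j. j < N \<and> (\<forall>\<beta><b. u (bit_var b j \<beta> (bit q \<beta>)) = -1))"
        have "J q < N \<and> (\<forall>\<beta><b. u (bit_var b (J q) \<beta> (bit q \<beta>)) = -1)" if "q \<in> blocks T" for q
        proof -
          have "\<exists>j. j < N \<and> (\<forall>\<beta><b. u (bit_var b j \<beta> (bit q \<beta>)) = -1)"
            using * that by (auto simp: listed_def)
          from someI_ex[OF this] show ?thesis using that by (simp add: J_def)
        qed
        moreover have "J \<in> extensional (blocks T)" by (simp add: J_def)
        ultimately show "\<exists>J\<in>blocks T \<rightarrow>\<^sub>E {..<N}. \<forall>q\<in>blocks T. \<forall>\<beta><b. u (bit_var b (J q) \<beta> (bit q \<beta>)) = -1"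
          by (intro bexI[of _ J]) (auto simp: PiE_iff)
      qed (auto simp: listed_def PiE_iff)
      also have "\<dots> \<longleftrightarrow> (\<forall>i. Pos i \<in> T \<longrightarrow> gadget n r (listed N b u) i = -1)"
      proof -
        have "i < n" if "Pos i \<in> T" for i using wf T that by (force simp: wf_dnf_def)
        then show ?thesis by (auto simp: blocks_def gadget_eq_iff)
      qed
      also have "\<dots> \<longleftrightarrow> (\<forall>l\<in>T. literal_value (gadget n r (listed N b u)) l)"
        using D(2) T by (fastforce simp: monotone_dnf_def)
      finally show ?thesis .
    qed
    then have "(\<exists>T\<in>D. \<exists>J\<in>blocks T \<rightarrow>\<^sub>E {..<N}. \<forall>l\<in>clause T J. literal_value u l) \<longleftrightarrow>
        (\<exists>T\<in>D. \<forall>l\<in>T. literal_value (gadget n r (listed N b u)) l)" by (rule bex_cong[OF refl])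
    then show ?thesis unfolding dnf_value_def E_def by simp
  qed
  then have "dnf_computes (N * (2 * b)) E (lifted n r N b f)"
    using wfE D(1) gadget_in_cube by (simp add: dnf_computes_def lifted_def)
  moreover have "monotone_dnf E" by (auto simp: monotone_dnf_def E_def clause_def)
  moreover have "dnf_width E \<le> dnf_width D * r * b"
  proof -
    have "card (clause T J) \<le> dnf_width D * r * b" if T: "T \<in> D" for T J
    proof -
      have finT: "finite T" by (rule finite_dnf(2)[OF wf T])
      have fin: "finite {i. Pos i \<in> T}" and le: "card {i. Pos i \<in> T} \<le> card T"
      proof -
        have inj: "inj_on Pos {i. Pos i \<in> T}" and sub: "Pos ` {i. Pos i \<in> T} \<subseteq> T" by (auto simp: inj_on_def)
        show "finite {i. Pos i \<in> T}" using finite_imageD[OF finite_subset[OF sub finT] inj] .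
        show "card {i. Pos i \<in> T} \<le> card T" using card_inj_on_le[OF inj sub finT] .
      qed
      have blocks: "blocks T = (\<lambda>(i, l). i * r + l) ` ({i. Pos i \<in> T} \<times> {..<r})"
        by (auto simp: blocks_def)
      have "card (blocks T) \<le> card {i. Pos i \<in> T} * r"
        unfolding blocks using fin card_image_le[of "{i. Pos i \<in> T} \<times> {..<r}"] by (simp add: card_cartesian_product)
      also have "\<dots> \<le> card T * r" using le by simp
      also have "card T \<le> dnf_width D"
        unfolding dnf_width_def using finite_dnf(1)[OF wf] T by (intro Max_ge) auto
      finally have "card (blocks T) \<le> dnf_width D * r" by simp
      moreover have "card (clause T J) \<le> card (blocks T) * b"
        unfolding clause_def using fin card_image_le[of "blocks T \<times> {..<b}"] by (simp add: card_cartesian_product blocks)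
      ultimately show ?thesis using mult_le_mono1 order.trans by blast
    qed
    moreover have "finite E" by (rule finite_dnf(1)[OF wfE])
    ultimately show ?thesis unfolding dnf_width_def[of E] by (auto simp: E_def)
  qed
  ultimately show ?thesis by blast
qed


section \<open>Choice of the parameters\<close>

lemma poly_nat_mono: "x \<le> y \<Longrightarrow> poly p x \<le> poly p (y :: nat)"
  by (induction p) (auto intro: mult_le_mono add_mono)

text \<open>Suppose the degree is below \<open>Y / 4\<close> and let \<open>K\<close> be about
  \<open>x = L * (n / d) powr (1 / 3)\<close>. Then \<open>x * d = Y\<close> and
  \<open>x ^ 2 * Y = n * L ^ 3\<close>. The second equation makes \<open>N\<close> large enough for
  \<open>approx_degree_lifted\<close>, whose conclusion \<open>d * (K + 2) \<le> 3 * D\<close>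
  contradicts the first.\<close>

lemma lifted_lower_bound:
  fixes n l d :: nat and f :: "(nat \<Rightarrow> real) \<Rightarrow> real"
  assumes n: "n \<ge> 2" and f: "boolean_function n f" and d: "d = approx_degree n f" "d \<ge> 1"
    and l: "log 2 (real n) \<le> real l"
  defines "N \<equiv> 5000 * n * l ^ 3" and "r \<equiv> 28 * l" and "b \<equiv> 2 * l + 5"
  shows "1 / 4 * (real n powr (1 / 3) * real d powr (2 / 3) * log 2 (real n)) \<le>
    real (approx_degree (N * (2 * b)) (lifted n r N b f))"
proof (rule ccontr)
  define L where "L = log 2 (real n)"
  define Y where "Y = real n powr (1 / 3) * real d powr (2 / 3) * L"
  define D where "D = approx_degree (N * (2 * b)) (lifted n r N b f)"
  assume "\<not> ?thesis"
  then have DY: "real D < Y / 4" by (simp add: Y_def D_def L_def)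
  have L1: "L \<ge> 1" using n by (simp add: L_def)
  have lL: "L \<le> real l" using l by (simp add: L_def)
  have l1: "l \<ge> 1" using L1 lL by linarith
  have nR: "real n \<le> 2 ^ l"
  proof -
    have "real n = 2 powr L" using n by (simp add: L_def)
    also have "\<dots> \<le> 2 powr real l" using lL by simp
    also have "\<dots> = 2 ^ l" by (simp add: powr_realpow)
    finally show ?thesis .
  qed
  have n2l: "n \<le> 2 ^ l"
  proof -
    have "real n \<le> real (2 ^ l)" using nR by simp
    then show ?thesis by (simp only: of_nat_le_iff)
  qed
  define A where "A = real n powr (1 / 3)"
  define B where "B = real d powr (1 / 3)"
  have dn: "d \<le> n" unfolding d(1) by (rule approx_degree_le_arity)
  have A3: "A ^ 3 = real n" using n by (simp add: A_def powr_power)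
  have B3: "B ^ 3 = real d" using d(2) by (simp add: B_def powr_power)
  have B2: "real d powr (2 / 3) = B ^ 2" using d(2) by (simp add: B_def powr_power)
  have AB: "A \<ge> B" "B \<ge> 1" "A \<ge> 1"
    using d(2) dn n by (auto simp: A_def B_def ge_one_powr_ge_zero intro: powr_mono2)
  define x where "x = L * A / B"
  have x1: "x \<ge> 1"
  proof -
    have "1 * B \<le> L * A" using L1 AB by (intro mult_mono) auto
    then show ?thesis using AB by (simp add: x_def)
  qed
  have Y: "Y = A * B ^ 2 * L" by (simp add: Y_def A_def B2)
  have xd: "x * real d = Y"
    unfolding x_def B3[symmetric] Y
    using AB by (simp add: power2_eq_square power3_eq_cube)
  have xY: "x ^ 2 * Y = real n * L ^ 3"
    unfolding x_def A3[symmetric] Y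
    using AB by (simp add: power2_eq_square power3_eq_cube)
  have Y1: "Y \<ge> 1"
  proof -
    have "1 * 1 \<le> x * real d" using x1 d(2) by (intro mult_mono) auto
    then show ?thesis by (simp add: xd)
  qed
  \<comment> \<open>Rounding up at most doubles \<open>x\<close> because
    \<open>x \<ge> 1\<close>.\<close>
  define K where "K = nat \<lceil>x\<rceil>"
  have K: "x \<le> real K" "real K \<le> 2 * x" using x1 unfolding K_def by linarith+
  then have K1: "K \<ge> 1" using x1 by linarith
  define k where "k = real (4 * K ^ 2)"
  have k: "k > 0" using K1 by (simp add: k_def)
  define M where "M = real n * real l ^ 3"
  have M0: "M \<ge> 0" by (simp add: M_def)
  have N: "real N = 5000 * M" by (simp add: N_def M_def)
  have kY: "k * Y \<le> 16 * M"
  proof -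
    have "real K ^ 2 \<le> (2 * x) ^ 2" using K by (intro power_mono) auto
    then have "k * Y \<le> (16 * x ^ 2) * Y"
      unfolding k_def using Y1 by (intro mult_right_mono) (auto simp: power_mult_distrib)
    also have "\<dots> = 16 * (real n * L ^ 3)" using xY by simp
    also have "\<dots> \<le> 16 * M" unfolding M_def using lL L1
      by (intro mult_left_mono power_mono) auto
    finally show ?thesis .
  qed
  have YM: "Y \<le> 16 * (M / k)" using kY k by (simp add: field_simps)
  have "approx_degree n f \<le> (3 * D) div (K + 2)"
    unfolding D_def
  proof (rule approx_degree_lifted[OF K1 f])
    show "b \<ge> 1" by (simp add: b_def)
    \<comment> \<open>In \<open>b = 2 * l + 5\<close> the 5 covers 28, and the two \<open>l\<close>
      cover \<open>n\<close> and \<open>l\<close>, both at most \<open>2 ^ l\<close>.\<close>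
    have "n * r = 28 * (n * l)" by (simp add: r_def)
    also have "\<dots> \<le> 32 * (2 ^ l * 2 ^ l)"
      using n2l less_exp[of l] by (intro mult_le_mono) auto
    also have "\<dots> = 2 ^ b"
    proof -
      have "b = 5 + (l + l)" by (simp add: b_def)
      then show ?thesis by (simp only: power_add) simp
    qed
    finally show "n * r \<le> 2 ^ b" .
    have "real (3 * D * (4 * K ^ 2)) = 3 * (real D * k)" by (simp add: k_def)
    also have "\<dots> \<le> 3 * (Y * k)" using DY Y1 k by (intro mult_left_mono mult_right_mono) auto
    also have "\<dots> \<le> real N" using kY M0 by (simp add: N mult.commute)
    finally show "3 * approx_degree (N * (2 * b)) (lifted n r N b f) * (4 * K ^ 2) \<le> N"
      unfolding D_def by (simp only: of_nat_le_iff)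
    have "(5 / 6 :: real) ^ r = ((5 / 6) ^ 28) ^ l" by (simp add: r_def power_mult)
    \<comment> \<open>The 28 in \<open>r\<close> ensures \<open>(5 / 6) ^ 28 \<le> 1 / 128\<close>,
      which outweighs \<open>n \<le> 2 ^ l\<close>.\<close>
    also have "\<dots> \<le> (1 / 128) ^ l" by (intro power_mono) (simp_all add: power_divide)
    finally have "2 * real n * (5 / 6) ^ r \<le> 2 * 2 ^ l * (1 / 128) ^ l"
      using nR by (intro mult_mono) auto
    also have "\<dots> = 2 * (1 / 64) ^ l" by (simp flip: power_mult_distrib)
    also have "\<dots> \<le> 2 * (1 / 64) ^ 1" using l1 by (intro mult_left_mono power_decreasing) auto
    finally show "2 * real n * (5 / 6) ^ r \<le> 1 / 32" by simp
    have "(4::real) ^ (3 * D) \<le> exp (2 * real (3 * D))"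
    proof -
      have "(4::real) \<le> exp 1 * exp 1"
        using exp_ge_add_one_self[of "1 :: real"] mult_mono[of 2 "exp 1" 2 "exp (1::real)"] by simp
      then have "(4::real) \<le> exp 2" by (simp flip: exp_add)
      then have "(4::real) ^ (3 * D) \<le> exp 2 ^ (3 * D)" by (rule power_mono) simp
      then show ?thesis by (simp add: mult.commute flip: exp_of_nat_mult)
    qed
    then have "4 ^ (3 * D) * exp (18 * real (n * r) / k) * exp (- real N / (2 * k)) \<le>
        exp (2 * real (3 * D)) * exp (18 * real (n * r) / k) * exp (- real N / (2 * k))"
      by (intro mult_right_mono) auto
    also have "\<dots> = exp (6 * real D + 18 * real (n * r) / k - real N / (2 * k))"
      unfolding exp_add[symmetric] by simp
    \<comment> \<open>In units of \<open>M / k\<close> the exponent is at most 24 + 504 - 2500, and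
      \<open>M / k \<ge> 1 / 16\<close> because \<open>Y \<ge> 1\<close>. The 5000 in
      \<open>N\<close> provides the negative term.\<close>
    also have "\<dots> \<le> exp (- 4)"
    proof -
      have "real (n * r) \<le> 28 * M"
      proof -
        have "real l \<le> real l ^ 3" using l1 by (intro self_le_power) auto
        then have "real n * real l \<le> M" unfolding M_def by (intro mult_left_mono) auto
        then show ?thesis by (simp add: r_def)
      qed
      then have "18 * real (n * r) / k \<le> 504 * (M / k)" using k by (simp add: divide_right_mono)
      moreover have "real N / (2 * k) = 2500 * (M / k)" by (simp add: N)
      ultimately show ?thesis using DY YM Y1 by simp
    qed
    also have "\<dots> \<le> 1 / 25"
    proof -
      have "5 \<le> exp (2::real)" using exp_lower_Taylor_quadratic[of "2::real"] by simp
      then have "(5::real) * 5 \<le> exp 2 * exp 2" by (intro mult_mono) auto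
      then have "(25::real) \<le> exp 4" by (simp flip: exp_add)
      then show ?thesis by (simp add: exp_minus field_simps)
    qed
    finally show "4 ^ (3 * approx_degree (N * (2 * b)) (lifted n r N b f)) *
      exp (18 * real (n * r) / real (4 * K ^ 2)) * exp (- real N / (2 * real (4 * K ^ 2))) \<le> 1 / 25"
      unfolding D_def k_def .
  qed
  then have "d * (K + 2) \<le> 3 * D"
    unfolding d(1)[symmetric] by (simp add: less_eq_div_iff_mult_less_eq)
  then have "real (d * (K + 2)) \<le> real (3 * D)" by (simp only: of_nat_le_iff)
  then have "real d * real K + 2 * real d \<le> 3 * real D" by (simp add: algebra_simps)
  moreover have "Y \<le> real d * real K"
    unfolding xd[symmetric] using mult_right_mono[OF K(1), of "real d"] by (simp add: mult.commute)
  ultimately show False using DY Y1 by linarith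
qed

theorem theorem1p5:
  "\<exists>(C1::real) (c::real) (C2::real) (Q :: nat poly \<Rightarrow> nat poly). C1 > 0 \<and> c > 0 \<and> C2 > 0 \<and>
    (\<forall>(n::nat) (f :: (nat \<Rightarrow> real) \<Rightarrow> real) (d::nat).
      n \<ge> 1 \<and> boolean_function n f \<and> approx_degree n f = d \<longrightarrow>
      (\<exists>(m::nat) (g :: (nat \<Rightarrow> real) \<Rightarrow> real).
        boolean_function m g \<and>
        real m \<le> C1 * (real n * log 2 (real n) ^ 4) \<and>
        real (approx_degree m g) \<ge>
          c * (real n powr (1 / 3) * real d powr (2 / 3) * log 2 (real n)) \<and>
        (\<forall>(k::nat) (p :: nat poly).
          (\<exists>A. circuit_computes n A f \<and> circuit_depth A \<le> k \<and> circuit_size A \<le> poly p n) \<longrightarrow>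
          (\<exists>B. circuit_computes m B g \<and> circuit_depth B \<le> k + 3 \<and>
               circuit_size B \<le> poly (Q p) m)) \<and>
        (\<forall>(k::nat) (p :: nat poly).
          (\<exists>A. circuit_computes n A f \<and> monotone_circuit A \<and> and_bottom A \<and>
               circuit_depth A \<le> k \<and> circuit_size A \<le> poly p n) \<longrightarrow>
          (\<exists>B. circuit_computes m B g \<and> monotone_circuit B \<and> and_bottom B \<and>
               circuit_depth B \<le> k + 2 \<and> circuit_size B \<le> poly (Q p) m)) \<and>
        (\<forall>w::nat.
          (\<exists>D. dnf_computes n D f \<and> monotone_dnf D \<and> dnf_width D = w) \<longrightarrow>
          (\<exists>E. dnf_computes m E g \<and> monotone_dnf E \<and>
               real (dnf_width E) \<le> C2 * (real w * log 2 (real n) ^ 2)))))"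
proof -
  \<comment> \<open>The added polynomial is \<open>(m + 1) ^ 2\<close>; it bounds the number
    \<open>n * r * N + n * r + n\<close> of new gates, since \<open>n\<close>, \<open>n * r\<close>
    and \<open>N\<close> are at most \<open>m\<close>.\<close>
  define Q :: "nat poly \<Rightarrow> nat poly" where "Q = (\<lambda>p. p + [:1, 2, 1:])"
  have poly_Q: "poly (Q p) m = poly p m + (1 + 2 * m + m * m)" for p m
    by (simp add: Q_def algebra_simps)
  show ?thesis
  \<comment> \<open>With \<open>b \<le> 7 * l\<close> and \<open>l \<le> 2 * L\<close>, the
    constants are \<open>1120000 = 5000 * 2 * 7 * 2 ^ 4\<close> and
    \<open>784 = 28 * 7 * 2 ^ 2\<close>.\<close>
  proof (rule exI[of _ "1120000 :: real"], rule exI[of _ "1 / 4 :: real"], rule exI[of _ "784 :: real"],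
      rule exI[of _ Q], intro conjI allI impI)
    fix n :: nat and f :: "(nat \<Rightarrow> real) \<Rightarrow> real" and d :: nat
    assume *: "n \<ge> 1 \<and> boolean_function n f \<and> approx_degree n f = d"
    then have n1: "n \<ge> 1" and f: "boolean_function n f" and d: "d = approx_degree n f" by auto
    show "\<exists>m g. boolean_function m g \<and>
        real m \<le> 1120000 * (real n * log 2 (real n) ^ 4) \<and>
        real (approx_degree m g) \<ge>
          1 / 4 * (real n powr (1 / 3) * real d powr (2 / 3) * log 2 (real n)) \<and>
        (\<forall>(k::nat) (p :: nat poly).
          (\<exists>A. circuit_computes n A f \<and> circuit_depth A \<le> k \<and> circuit_size A \<le> poly p n) \<longrightarrow>
          (\<exists>B. circuit_computes m B g \<and> circuit_depth B \<le> k + 3 \<and>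
               circuit_size B \<le> poly (Q p) m)) \<and>
        (\<forall>(k::nat) (p :: nat poly).
          (\<exists>A. circuit_computes n A f \<and> monotone_circuit A \<and> and_bottom A \<and>
               circuit_depth A \<le> k \<and> circuit_size A \<le> poly p n) \<longrightarrow>
          (\<exists>B. circuit_computes m B g \<and> monotone_circuit B \<and> and_bottom B \<and>
               circuit_depth B \<le> k + 2 \<and> circuit_size B \<le> poly (Q p) m)) \<and>
        (\<forall>w::nat.
          (\<exists>D. dnf_computes n D f \<and> monotone_dnf D \<and> dnf_width D = w) \<longrightarrow>
          (\<exists>E. dnf_computes m E g \<and> monotone_dnf E \<and>
               real (dnf_width E) \<le> 784 * (real w * log 2 (real n) ^ 2)))"
    proof (cases "n = 1 \<or> d = 0")
      case True
      \<comment> \<open>The lower bound is 0 here, so the constant false on no variables will do;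
        for \<open>n = 1\<close> the factor \<open>log 2 n = 0\<close> even forces
        \<open>m = 0\<close>. It is computed by an empty OR gate and by the empty DNF.\<close>
      define B where "B = Circuit [Or_gate []] (Gate 0)"
      have B: "circuit_computes 0 B (\<lambda>_. 1)" "monotone_circuit B" "and_bottom B"
        "circuit_depth B = 1" "circuit_size B = 1"
        by (auto simp: B_def circuit_computes_def wf_circuit_def circuit_value_def monotone_circuit_def
            and_bottom_def circuit_depth_def circuit_size_def of_truth_def run_gates_def)
      have E: "dnf_computes 0 {} (\<lambda>_. 1)" "monotone_dnf {}" "dnf_width {} = 0"
        by (auto simp: dnf_computes_def wf_dnf_def dnf_value_def of_truth_def monotone_dnf_def dnf_width_def)
      have zero: "1 / 4 * (real n powr (1 / 3) * real d powr (2 / 3) * log 2 (real n)) = 0"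
        using True by auto
      show ?thesis
      proof (intro exI[of _ 0] exI[of _ "\<lambda>_. 1"] conjI allI impI)
        show "boolean_function 0 (\<lambda>_. 1)" by (simp add: boolean_function_def)
        show "real 0 \<le> 1120000 * (real n * log 2 (real n) ^ 4)" by simp
        show "real (approx_degree 0 (\<lambda>_. 1)) \<ge>
          1 / 4 * (real n powr (1 / 3) * real d powr (2 / 3) * log 2 (real n))" unfolding zero by simp
        fix k w :: nat and p :: "nat poly"
        show "\<exists>B. circuit_computes 0 B (\<lambda>_. 1) \<and> circuit_depth B \<le> k + 3 \<and> circuit_size B \<le> poly (Q p) 0"
          using B by (intro exI[of _ B]) (simp add: poly_Q)
        show "\<exists>B. circuit_computes 0 B (\<lambda>_. 1) \<and> monotone_circuit B \<and> and_bottom B \<and>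
            circuit_depth B \<le> k + 2 \<and> circuit_size B \<le> poly (Q p) 0"
          using B by (intro exI[of _ B]) (simp add: poly_Q)
        show "\<exists>E. dnf_computes 0 E (\<lambda>_. 1) \<and> monotone_dnf E \<and>
            real (dnf_width E) \<le> 784 * (real w * log 2 (real n) ^ 2)"
          using E by (intro exI[of _ "{}"]) simp
      qed
    next
      case False
      then have n: "n \<ge> 2" and d1: "d \<ge> 1" using n1 by auto
      define L where "L = log 2 (real n)"
      define l where "l = nat \<lceil>L\<rceil>"
      define N where "N = 5000 * n * l ^ 3"
      define r where "r = 28 * l"
      define b where "b = 2 * l + 5"
      define m where "m = N * (2 * b)"
      have L1: "L \<ge> 1" using n by (simp add: L_def)
      have l: "L \<le> real l" "real l \<le> 2 * L" using L1 unfolding l_def by linarith+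
      then have l1: "l \<ge> 1" using L1 by linarith
      have b7: "b \<le> 7 * l" using l1 by (simp add: b_def)
      have "real m \<le> real (70000 * n * l ^ 4)"
      proof -
        have "m \<le> 5000 * n * l ^ 3 * (2 * (7 * l))"
          unfolding m_def N_def using b7 by (intro mult_le_mono) auto
        also have "\<dots> = 70000 * n * l ^ 4" by (simp add: power3_eq_cube power4_eq_xxxx)
        finally show ?thesis by (simp only: of_nat_le_iff)
      qed
      also have "\<dots> = 70000 * (real n * real l ^ 4)" by simp
      also have "\<dots> \<le> 70000 * (real n * (2 * L) ^ 4)"
        using l by (intro mult_left_mono power_mono) auto
      finally have m_le: "real m \<le> 1120000 * (real n * L ^ 4)" by (simp add: power_mult_distrib)
      have nrN: "n * r \<le> N"
      proof -
        have "28 * (n * l) \<le> 5000 * (n * l ^ 3)"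
          using l1 by (intro mult_le_mono) (auto intro: self_le_power)
        then show ?thesis by (simp add: r_def N_def mult_ac)
      qed
      have Nm: "N \<le> m" by (simp add: m_def b_def)
      have "n * 1 \<le> n * r" using l1 by (intro mult_le_mono2) (simp add: r_def)
      with nrN Nm have nm: "n \<le> m" "n * r \<le> m" by linarith+
      have size: "n * r * N + n * r + n \<le> 1 + 2 * m + m * m"
        using mult_le_mono[OF nm(2) Nm] nm by linarith
      show ?thesis
      proof (intro exI[of _ m] exI[of _ "lifted n r N b f"] conjI allI impI)
        show "boolean_function m (lifted n r N b f)" by (rule boolean_lifted[OF f])
        show "real m \<le> 1120000 * (real n * log 2 (real n) ^ 4)" using m_le by (simp add: L_def)
        show "real (approx_degree m (lifted n r N b f)) \<ge>
          1 / 4 * (real n powr (1 / 3) * real d powr (2 / 3) * log 2 (real n))"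
          unfolding m_def N_def r_def b_def
          using lifted_lower_bound[OF n f d d1, of l] l(1) by (simp add: L_def)
      next
        fix k :: nat and p :: "nat poly"
        assume "\<exists>A. circuit_computes n A f \<and> circuit_depth A \<le> k \<and> circuit_size A \<le> poly p n"
        then obtain A where A: "circuit_computes n A f" "circuit_depth A \<le> k" "circuit_size A \<le> poly p n"
          by blast
        obtain B where "circuit_computes m B (lifted n r N b f)" "circuit_depth B \<le> circuit_depth A + 3"
          "circuit_size B = n * r * N + n * r + n + circuit_size A"
          using lifted_circuit[OF A(1)] unfolding m_def by blast
        then show "\<exists>B. circuit_computes m B (lifted n r N b f) \<and> circuit_depth B \<le> k + 3 \<and>
            circuit_size B \<le> poly (Q p) m"
          using A(2,3) size poly_nat_mono[OF nm(1), of p] by (intro exI[of _ B]) (simp add: poly_Q)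
      next
        fix k :: nat and p :: "nat poly"
        assume "\<exists>A. circuit_computes n A f \<and> monotone_circuit A \<and> and_bottom A \<and>
          circuit_depth A \<le> k \<and> circuit_size A \<le> poly p n"
        then obtain A where A: "circuit_computes n A f" "monotone_circuit A" "and_bottom A"
          "circuit_depth A \<le> k" "circuit_size A \<le> poly p n"
          by blast
        obtain B where "circuit_computes m B (lifted n r N b f)" "monotone_circuit B" "and_bottom B"
          "circuit_depth B \<le> circuit_depth A + 2" "circuit_size B = n * r * N + n * r + circuit_size A"
          using lifted_monotone_circuit[OF A(1-3)] unfolding m_def by blast
        then show "\<exists>B. circuit_computes m B (lifted n r N b f) \<and> monotone_circuit B \<and> and_bottom B \<and>
            circuit_depth B \<le> k + 2 \<and> circuit_size B \<le> poly (Q p) m"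
          using A(4,5) size poly_nat_mono[OF nm(1), of p] by (intro exI[of _ B]) (simp add: poly_Q)
      next
        fix w :: nat
        assume "\<exists>D. dnf_computes n D f \<and> monotone_dnf D \<and> dnf_width D = w"
        then obtain D where D: "dnf_computes n D f" "monotone_dnf D" "dnf_width D = w" by blast
        obtain E where E: "dnf_computes m E (lifted n r N b f)" "monotone_dnf E" "dnf_width E \<le> w * r * b"
          using lifted_dnf[OF D(1,2)] unfolding m_def D(3) by blast
        have "real (dnf_width E) \<le> real (w * (28 * l) * (7 * l))"
        proof -
          have "w * r * b \<le> w * (28 * l) * (7 * l)" using b7 by (simp add: r_def mult_le_mono)
          with E(3) show ?thesis by (simp only: of_nat_le_iff)
        qed
        also have "\<dots> = 196 * (real w * real l ^ 2)" by (simp add: power2_eq_square)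
        also have "\<dots> \<le> 196 * (real w * (2 * L) ^ 2)"
          using l by (intro mult_left_mono power_mono) auto
        finally have "real (dnf_width E) \<le> 784 * (real w * log 2 (real n) ^ 2)"
          by (simp add: L_def power_mult_distrib)
        with E(1,2) show "\<exists>E. dnf_computes m E (lifted n r N b f) \<and> monotone_dnf E \<and>
            real (dnf_width E) \<le> 784 * (real w * log 2 (real n) ^ 2)" by blast
      qed
    qed
  qed simp_all
qed

end
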